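(* Let $l,m,k_1,k_2$ be integers with $|l|\geqslant m>0$, $k_1>0$, $k_2>0$. The groups $G_1=G(l,m;k_1)$ and $G_2=G(l,m;k_2)$ are homomorphic images of each other and are not isomorphic if and only if: $|l|>m>1$, $m$ divides each of $l$, $k_1$, $k_2$, the integers $s=l/m$ and $m$ are coprime, and the rational number $k_1/k_2$ is an $s$-number which is not equal to $\pm s^{p}$ for any integer $p$.
   Context: For nonzero integers $l,m,k$, $G(l,m;k)$ denotes the one-relator group $\langle a,t \mid t^{-1}a^{-k}ta^{l}t^{-1}a^{k}t=a^{m}\rangle$. For a nonzero integer $n$, a nonzero integer $q$ is called an $n$-number if every prime divisor of $q$ divides $n$; a nonzero rational number is called an $n$-number if the numerator and the denominator of its irreducible fraction representation are both $n$-numbers. *)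

theory Defs
  imports Complex_Main "HOL-Algebra.Group" "HOL-Computational_Algebra.Primes"
begin

datatype gen = GA | GT

text \<open>A letter is a generator together with a flag: False = the generator, True = its inverse.\<close>
type_synonym letter = "gen \<times> bool"
type_synonym word = "letter list"

definition inv_letter :: "letter \<Rightarrow> letter" where
  "inv_letter x = (fst x, \<not> snd x)"

inductive pres_eq :: "word set \<Rightarrow> word \<Rightarrow> word \<Rightarrow> bool" for R where
  pres_refl: "pres_eq R w w"
| pres_sym: "pres_eq R u v \<Longrightarrow> pres_eq R v u"
| pres_trans: "pres_eq R u v \<Longrightarrow> pres_eq R v w \<Longrightarrow> pres_eq R u w"
| pres_cancel: "pres_eq R (u @ [x, inv_letter x] @ v) (u @ v)"
| pres_rel: "r \<in> R \<Longrightarrow> pres_eq R (u @ r @ v) (u @ v)"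

definition pres_class :: "word set \<Rightarrow> word \<Rightarrow> word set" where
  "pres_class R w = {v. pres_eq R w v}"

definition presented_group :: "word set \<Rightarrow> word set monoid" where
  "presented_group R =
     \<lparr> carrier = range (pres_class R),
       monoid.mult = (\<lambda>X Y. pres_class R ((SOME u. u \<in> X) @ (SOME v. v \<in> Y))),
       one = pres_class R [] \<rparr>"

definition apow :: "int \<Rightarrow> word" where
  "apow n = (if 0 \<le> n then replicate (nat n) (GA, False) else replicate (nat (- n)) (GA, True))"

definition G_relator :: "int \<Rightarrow> int \<Rightarrow> int \<Rightarrow> word" where
  "G_relator l m k =
     [(GT, True)] @ apow (- k) @ [(GT, False)] @ apow l @ [(GT, True)] @ apow k @ [(GT, False)] @ apow (- m)"

text \<open>G(l,m;k) = < a, t | t^-1 a^-k t a^l t^-1 a^k t = a^m >.\<close>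
definition Glmk :: "int \<Rightarrow> int \<Rightarrow> int \<Rightarrow> word set monoid" where
  "Glmk l m k = presented_group {G_relator l m k}"

definition int_n_number :: "int \<Rightarrow> int \<Rightarrow> bool" where
  "int_n_number n q \<longleftrightarrow> q \<noteq> 0 \<and> (\<forall>p::int. prime p \<longrightarrow> p dvd q \<longrightarrow> p dvd n)"

definition rat_n_number :: "int \<Rightarrow> rat \<Rightarrow> bool" where
  "rat_n_number n r \<longleftrightarrow> r \<noteq> 0 \<and>
     int_n_number n (fst (quotient_of r)) \<and> int_n_number n (snd (quotient_of r))"

definition homomorphic_image :: "('a, 'c) monoid_scheme \<Rightarrow> ('b, 'd) monoid_scheme \<Rightarrow> bool" where
  "homomorphic_image H G \<longleftrightarrow> (\<exists>f. f \<in> epi G H)"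

end

theory Submission
  imports Defs
begin

text \<open>
  With \<open>b = t\<^sup>-\<^sup>1 a\<^sup>k t\<close> the group \<open>G(l,m;k)\<close> is an HNN extension, with stable letter \<open>t\<close> conjugating \<open>a\<^sup>k\<close> to \<open>b\<close>,
  of \<open>BS(l,m) = \<langle>a, b | b\<^sup>-\<^sup>1 a\<^sup>l b = a\<^sup>m\<rangle>\<close>, which is itself an HNN extension of the infinite cyclic group \<open>\<langle>a\<rangle>\<close>.

  Let \<open>|l| > m\<close>. If \<open>C, T\<close> generate \<open>G(l,m;k\<^sub>2)\<close> and satisfy the relation of \<open>G(l,m;k\<^sub>1)\<close>, then \<open>C\<^sup>l\<close> and \<open>C\<^sup>m\<close> are
  conjugate, so \<open>C\<close> is elliptic at both levels and after conjugation \<open>C = a\<^sup>x\<close>. Normal forms force \<open>T = h t h'\<close>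
  with \<open>h, h'\<close> in \<open>BS(l,m)\<close> and \<open>h\<^sup>-\<^sup>1 a\<^sup>u h = a\<^sup>v\<close> for \<open>u = x k\<^sub>1\<close> and \<open>v = k\<^sub>2\<close>, whence \<open>x k\<^sub>1 = k\<^sub>2 (l/m)\<^sup>p\<close>.
  Epimorphisms both ways give \<open>x y = (l/m)\<^sup>N\<close> with \<open>N \<ge> 0\<close>. If \<open>N = 0\<close> or \<open>m = 1\<close> the groups are isomorphic;
  otherwise \<open>m\<close> divides \<open>l\<close>, and the abelianisation shows that \<open>s = l/m\<close> is prime to \<open>m\<close>. Conversely
  \<open>a \<mapsto> a\<^sup>x, t \<mapsto> b\<^sup>p t\<close> is onto whenever \<open>x\<close> divides a power of \<open>s\<close>, while for an isomorphism \<open>a\<close> is conjugate to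
  \<open>a\<^sup>w\<close> with \<open>w = x y\<close>, which for \<open>m > 1\<close> is only possible if \<open>x y = 1\<close>.

  If \<open>|l| = m\<close> the groups are residually finite, and epimorphisms both ways are isomorphisms.
\<close>

section \<open>Groups as a type class\<close>

text \<open>A group is a subset of a type of class \<open>grp\<close>; the groups under study live
  in types \<open>sym\<close> of permutations. An HNN extension is the group of permutations of the
  set of normal forms generated by the base and the stable letter. Applying an element to the empty
  normal form reads off its own normal form, so uniqueness comes for free and the universal property
  is evaluation. The construction is run twice, and in the second run the base reappears only as an
  isomorphic image. The combinatorics is therefore done in the locale \<open>hnn\<close>, which
  retains a length and the uniqueness of first syllables and survives injective homomorphisms.
  Besides normal forms, one invariant does most of the work: the exponent sum in \<open>b\<close> on
  BS(l,m), which keeps conjugates of powers of \<open>a\<close> and of \<open>b\<close> apart. The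
  relation \<open>scale\<close> records more than u = v (l/m)^p, namely that every intermediate
  conjugation is possible; \<open>m dvd k1\<close> and \<open>m dvd k2\<close> come from there. For
  \<open>\<bar>l\<bar> = m\<close> the length estimate that makes \<open>C\<close> elliptic fails,
  hence the detour through residual finiteness.\<close>

class grp =
  fixes gm :: "'a \<Rightarrow> 'a \<Rightarrow> 'a" (infixr "\<cdot>" 70)
    and gi :: "'a \<Rightarrow> 'a"
    and ge :: "'a"
  assumes gm_assoc [simp]: "(x \<cdot> y) \<cdot> z = x \<cdot> (y \<cdot> z)"
    and ge_left [simp]: "ge \<cdot> x = x"
    and gi_left [simp]: "gi x \<cdot> x = ge"
begin

lemma gi_cancel_left [simp]: "gi x \<cdot> (x \<cdot> y) = y"
  using gm_assoc[of "gi x" x y] by simp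

lemma gm_left_cancel [simp]: "x \<cdot> y = x \<cdot> z \<longleftrightarrow> y = z"
  by (metis gi_cancel_left)

lemma ge_right [simp]: "x \<cdot> ge = x"
  by (metis gi_cancel_left gi_left gm_left_cancel)

lemma gi_right [simp]: "x \<cdot> gi x = ge"
  by (metis gi_cancel_left ge_right gm_left_cancel)

lemma gi_cancel_right [simp]: "x \<cdot> (gi x \<cdot> y) = y"
  using gm_assoc[of x "gi x" y] by simp

lemma gm_right_cancel [simp]: "y \<cdot> x = z \<cdot> x \<longleftrightarrow> y = z"
  by (metis gm_assoc gi_right ge_right)

lemma gi_unique: "x \<cdot> y = ge \<Longrightarrow> gi x = y"
  by (metis gi_cancel_left ge_right)

lemma gi_gi [simp]: "gi (gi x) = x"
  by (rule gi_unique) simp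

lemma gi_gm [simp]: "gi (x \<cdot> y) = gi y \<cdot> gi x"
  by (rule gi_unique) simp

lemma gi_ge [simp]: "gi ge = ge"
  by (rule gi_unique) simp

lemma gi_eq_ge [simp]: "gi x = ge \<longleftrightarrow> x = ge"
  by (metis gi_gi gi_ge)

lemma gm_eq_self [simp]: "x \<cdot> y = x \<longleftrightarrow> y = ge" "y \<cdot> x = x \<longleftrightarrow> y = ge"
  by (metis ge_right gm_left_cancel, metis ge_left gm_right_cancel)

lemma self_eq_gm [simp]: "x = x \<cdot> y \<longleftrightarrow> y = ge" "x = y \<cdot> x \<longleftrightarrow> y = ge"
  using gm_eq_self by metis+

lemma gi_shift: "gi x \<cdot> y = z \<longleftrightarrow> y = x \<cdot> z"
  by (metis gi_cancel_left gi_cancel_right)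

section \<open>Integer powers, signed letters and subgroups\<close>

fun npw :: "'a \<Rightarrow> nat \<Rightarrow> 'a" where
  "npw x 0 = ge"
| "npw x (Suc n) = x \<cdot> npw x n"

definition pw :: "'a \<Rightarrow> int \<Rightarrow> 'a" (infixr "\<up>" 80) where
  "x \<up> n = (if n \<ge> 0 then npw x (nat n) else npw (gi x) (nat (- n)))"

definition te :: "'a \<Rightarrow> bool \<Rightarrow> 'a" where
  "te t e = (if e then t else gi t)"

definition sgrp :: "'a set \<Rightarrow> bool" where
  "sgrp S \<longleftrightarrow> ge \<in> S \<and> (\<forall>x\<in>S. \<forall>y\<in>S. x \<cdot> y \<in> S) \<and> (\<forall>x\<in>S. gi x \<in> S)"

lemma npw_comm: "npw x n \<cdot> x = x \<cdot> npw x n"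
  by (induction n) simp_all

lemma npw_gi: "npw (gi x) n = gi (npw x n)"
  by (induction n) (simp_all add: npw_comm[symmetric])

lemma pw_0 [simp]: "x \<up> 0 = ge"
  by (simp add: pw_def)

lemma pw_1 [simp]: "x \<up> 1 = x"
  by (simp add: pw_def)

lemma pw_minus: "x \<up> (- n) = gi (x \<up> n)"
  by (cases "n = 0"; cases "n > 0") (auto simp: pw_def npw_gi)

lemma pw_Suc: "x \<up> (n + 1) = x \<cdot> (x \<up> n)"
proof (cases "n \<ge> 0")
  case True
  then show ?thesis by (simp add: pw_def nat_add_distrib)
next
  case False
  have e: "x \<up> (- int j) = gi (npw x j)" for j
    by (cases "j = 0") (simp_all add: pw_def npw_gi)
  define j where "j = nat (- n - 1)"
  have n: "n = - int (Suc j)" "n + 1 = - int j"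
    using False by (auto simp: j_def)
  show ?thesis
    unfolding n(2) e by (subst n(1), subst e) (simp flip: npw_comm)
qed

lemma pw_add: "x \<up> (i + j) = (x \<up> i) \<cdot> (x \<up> j)"
proof (induction i rule: int_induct[of _ 0])
  case base show ?case by simp
next
  case (step1 i)
  then show ?case
    by (metis gm_assoc pw_Suc add.commute add.left_commute)
next
  case (step2 i)
  have "x \<cdot> (x \<up> (i - 1 + j)) = x \<cdot> (x \<up> (i - 1)) \<cdot> (x \<up> j)"
    using step2 pw_Suc[of x "i - 1 + j"] pw_Suc[of x "i - 1"]
    by (simp add: algebra_simps)
  then show ?case by simp
qed

lemma pw_comm: "(x \<up> i) \<cdot> (x \<up> j) = (x \<up> j) \<cdot> (x \<up> i)"
  by (metis add.commute pw_add)

lemma pw_pw: "(x \<up> i) \<up> j = x \<up> (i * j)"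
proof (induction j rule: int_induct[of _ 0])
  case base show ?case by simp
next
  case (step1 j)
  then show ?case by (simp add: pw_Suc pw_add algebra_simps pw_comm)
next
  case (step2 j)
  have "(x \<up> i) \<cdot> ((x \<up> i) \<up> (j - 1)) = (x \<up> i) \<cdot> (x \<up> (i * (j - 1)))"
    using step2 pw_Suc[of "x \<up> i" "j - 1"] pw_add[of x i "i * (j - 1)"]
    by (simp add: algebra_simps)
  then show ?case by simp
qed

lemma pw_ge [simp]: "ge \<up> n = ge"
proof -
  have "npw ge k = ge" for k by (induction k) simp_all
  then show ?thesis by (simp add: pw_def)
qed

lemma pw_conj: "(gi g \<cdot> x \<cdot> g) \<up> n = gi g \<cdot> (x \<up> n) \<cdot> g"
proof (induction n rule: int_induct[of _ 0])
  case base show ?case by simp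
next
  case (step1 j)
  then show ?case by (simp add: pw_Suc)
next
  case (step2 j)
  have "(gi g \<cdot> x \<cdot> g) \<cdot> ((gi g \<cdot> x \<cdot> g) \<up> (j - 1)) = (gi g \<cdot> x \<cdot> g) \<cdot> (gi g \<cdot> (x \<up> (j - 1)) \<cdot> g)"
    using step2 pw_Suc[of "gi g \<cdot> x \<cdot> g" "j - 1"] pw_Suc[of x "j - 1"]
    by simp
  then show ?case unfolding gm_left_cancel .
qed

lemma pw_conj': "(g \<cdot> x \<cdot> gi g) \<up> n = g \<cdot> (x \<up> n) \<cdot> gi g"
  using pw_conj[of "gi g" x n] by simp

lemma commute_pw: "x \<cdot> y = y \<cdot> x \<Longrightarrow> x \<cdot> (y \<up> n) = (y \<up> n) \<cdot> x"
  by (metis gi_shift pw_conj gm_assoc gi_cancel_left)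

lemma te_True [simp]: "te t True = t" and te_False [simp]: "te t False = gi t"
  by (simp_all add: te_def)

lemma gi_te: "gi (te t e) = te t (\<not> e)"
  by (simp add: te_def)

lemma te_te [simp]: "te t e \<cdot> te t (\<not> e) = ge" "te t (\<not> e) \<cdot> te t e = ge"
  "te t e \<cdot> te t (\<not> e) \<cdot> x = x" "te t (\<not> e) \<cdot> te t e \<cdot> x = x"
  by (cases e; simp)+

lemma sgrp_ge: "sgrp S \<Longrightarrow> ge \<in> S"
  and sgrp_gm: "sgrp S \<Longrightarrow> x \<in> S \<Longrightarrow> y \<in> S \<Longrightarrow> x \<cdot> y \<in> S"
  and sgrp_gi: "sgrp S \<Longrightarrow> x \<in> S \<Longrightarrow> gi x \<in> S"
  by (auto simp: sgrp_def)

lemma sgrp_npw: "sgrp S \<Longrightarrow> x \<in> S \<Longrightarrow> npw x n \<in> S"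
  by (induction n) (auto simp: sgrp_def)

lemma sgrp_pw: "sgrp S \<Longrightarrow> x \<in> S \<Longrightarrow> x \<up> n \<in> S"
  by (auto simp: pw_def sgrp_npw sgrp_gi)

lemma sgrp_te: "sgrp S \<Longrightarrow> t \<in> S \<Longrightarrow> te t e \<in> S"
  by (auto simp: te_def sgrp_gi)

lemma sgrp_gm_iff: "sgrp S \<Longrightarrow> x \<in> S \<Longrightarrow> x \<cdot> y \<in> S \<longleftrightarrow> y \<in> S"
  by (metis gi_cancel_left sgrp_gi sgrp_gm)

lemma sgrp_gm_iff2: "sgrp S \<Longrightarrow> y \<in> S \<Longrightarrow> x \<cdot> y \<in> S \<longleftrightarrow> x \<in> S"
  by (metis gm_assoc gi_right ge_right sgrp_gi sgrp_gm)

definition cyc :: "'a \<Rightarrow> 'a set" where "cyc x = range (\<lambda>i. x \<up> i)"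

lemma cycI [simp, intro]: "x \<up> i \<in> cyc x"
  by (simp add: cyc_def)

lemma cycE: "y \<in> cyc x \<Longrightarrow> (\<And>i. y = x \<up> i \<Longrightarrow> R) \<Longrightarrow> R"
  by (auto simp: cyc_def)

lemma sgrp_cyc: "sgrp (cyc x)"
proof -
  have "ge \<in> cyc x" using cycI[of x 0] by simp
  then show ?thesis
    by (auto simp: sgrp_def elim!: cycE simp flip: pw_add pw_minus)
qed

end

section \<open>Homomorphisms on a subgroup; values outside it are arbitrary\<close>

definition ghom :: "'a::grp set \<Rightarrow> ('a \<Rightarrow> 'b::grp) \<Rightarrow> bool" where
  "ghom S f \<longleftrightarrow> (\<forall>x\<in>S. \<forall>y\<in>S. f (x \<cdot> y) = f x \<cdot> f y)"

lemma ghom_gm: "ghom S f \<Longrightarrow> x \<in> S \<Longrightarrow> y \<in> S \<Longrightarrow> f (x \<cdot> y) = f x \<cdot> f y"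
  by (simp add: ghom_def)

lemma ghom_ge: "ghom S f \<Longrightarrow> sgrp S \<Longrightarrow> f ge = ge"
  by (metis ge_left ghom_gm gm_eq_self(1) sgrp_ge)

lemma ghom_gi: "ghom S f \<Longrightarrow> sgrp S \<Longrightarrow> x \<in> S \<Longrightarrow> f (gi x) = gi (f x)"
  using ghom_gm[of S f x "gi x"] gi_unique[of "f x" "f (gi x)"] by (simp add: ghom_ge sgrp_gi)

lemma ghom_npw: "ghom S f \<Longrightarrow> sgrp S \<Longrightarrow> x \<in> S \<Longrightarrow> f (npw x n) = npw (f x) n"
  by (induction n) (simp_all add: ghom_ge ghom_gm sgrp_npw)

lemma ghom_pw: "ghom S f \<Longrightarrow> sgrp S \<Longrightarrow> x \<in> S \<Longrightarrow> f (x \<up> n) = f x \<up> n"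
  by (auto simp: pw_def ghom_npw ghom_gi sgrp_gi)

lemma ghom_te: "ghom S f \<Longrightarrow> sgrp S \<Longrightarrow> x \<in> S \<Longrightarrow> f (te x e) = te (f x) e"
  by (auto simp: te_def ghom_gi)

lemma ghom_subset: "ghom S f \<Longrightarrow> R \<subseteq> S \<Longrightarrow> ghom R f"
  by (auto simp: ghom_def)

lemma ghom_comp: "ghom S f \<Longrightarrow> ghom R h \<Longrightarrow> f ` S \<subseteq> R \<Longrightarrow> ghom S (h \<circ> f)"
  by (auto simp: ghom_def image_subset_iff)

lemma sgrp_image: "ghom S f \<Longrightarrow> sgrp S \<Longrightarrow> sgrp (f ` S)"
  unfolding sgrp_def[of "f ` S"]
  by (auto simp flip: ghom_gm ghom_gi intro!: imageI sgrp_gm sgrp_gi)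
     (metis ghom_ge image_eqI sgrp_ge)

section \<open>Concrete groups: integers, products, permutations\<close>

instantiation int :: grp
begin
definition "gm_int (x::int) y = x + y"
definition "gi_int (x::int) = - x"
definition "ge_int = (0::int)"
instance by standard (simp_all add: gm_int_def gi_int_def ge_int_def)
end

lemmas int_grp = gm_int_def gi_int_def ge_int_def

lemma pw_int: "(x::int) \<up> n = x * n"
proof -
  have "npw y k = y * int k" for y :: int and k
    by (induction k) (simp_all add: int_grp algebra_simps)
  then show ?thesis by (simp add: pw_def int_grp)
qed

instantiation prod :: (grp, grp) grp
begin
definition "gm_prod x y = (fst x \<cdot> fst y, snd x \<cdot> snd y)"
definition "gi_prod x = (gi (fst x), gi (snd x))"
definition "ge_prod = (ge, ge)"
instance by standard (simp_all add: gm_prod_def gi_prod_def ge_prod_def)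
end

lemmas prod_grp = gm_prod_def gi_prod_def ge_prod_def

lemma pw_prod: "x \<up> n = (fst x \<up> n, snd x \<up> n)"
proof -
  have "npw y k = (npw (fst y) k, npw (snd y) k)" for y :: "'a \<times> 'b" and k
    by (induction k) (simp_all add: prod_grp)
  then show ?thesis by (simp add: pw_def prod_grp)
qed

text \<open>Permutation groups of a set depending on parameters are modelled inside the full
  symmetric group of a fixed type, by permutations that are the identity off that set.\<close>

typedef 'a sym = "{f :: 'a \<Rightarrow> 'a. bij f}" morphisms app Sym
  by (rule exI[of _ id]) simp

setup_lifting type_definition_sym

instantiation sym :: (type) grp
begin
lift_definition gm_sym :: "'a sym \<Rightarrow> 'a sym \<Rightarrow> 'a sym" is "\<lambda>f g x. f (g x)"
  by (metis bij_comp comp_apply ext)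
lift_definition gi_sym :: "'a sym \<Rightarrow> 'a sym" is "\<lambda>f. inv_into UNIV f" by (rule bij_imp_bij_inv)
lift_definition ge_sym :: "'a sym" is "\<lambda>x. x" by (simp add: bij_def)
instance
  by standard (transfer; simp add: bij_is_inj)+
end

lemma app_gm [simp]: "app (x \<cdot> y) z = app x (app y z)"
  by transfer simp

lemma app_ge [simp]: "app ge z = z"
  by transfer simp

lemma app_gi_cancel [simp]: "app (gi x) (app x z) = z" "app x (app (gi x) z) = z"
  by (metis app_gm app_ge gi_left, metis app_gm app_ge gi_right)

lemma sym_eqI: "(\<And>z. app x z = app y z) \<Longrightarrow> x = y"
  by transfer auto

lemma app_gi_eq: "app x z = w \<Longrightarrow> app (gi x) w = z"
  by auto

lemma app_Sym: "bij f \<Longrightarrow> app (Sym f) = f"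
  by (simp add: Sym_inverse)

lemma app_inj [simp]: "app x z = app x w \<longleftrightarrow> z = w"
  by (metis app_gi_cancel(1))

section \<open>Normal forms in HNN extensions\<close>

text \<open>The data of an HNN extension: a base, two associated subgroups and mutually inverse
  isomorphisms between them. Indexing by the sign of the stable letter lets each statement cover t
  and its inverse at once.\<close>

locale hnn_base =
  fixes H :: "'h::grp set" and A :: "bool \<Rightarrow> 'h set" and f :: "bool \<Rightarrow> 'h \<Rightarrow> 'h"
  assumes sH: "sgrp H" and sA: "sgrp (A e)" and AH: "A e \<subseteq> H"
    and fA: "p \<in> A e \<Longrightarrow> f e p \<in> A (\<not> e)"
    and f_gm: "p \<in> A e \<Longrightarrow> q \<in> A e \<Longrightarrow> f e (p \<cdot> q) = f e p \<cdot> f e q"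
    and f_f: "p \<in> A e \<Longrightarrow> f (\<not> e) (f e p) = p"
begin

lemma AHD: "p \<in> A e \<Longrightarrow> p \<in> H"
  using AH by blast

lemma f_ge: "f e ge = ge"
  using f_gm[OF sgrp_ge[OF sA] sgrp_ge[OF sA], of e] by simp

text \<open>The pair \<open>(e, A e)\<close> encodes the stable letter \<open>t\<close> (for \<open>e = True\<close>) or \<open>t\<^sup>-\<^sup>1\<close> together with the subgroup
  that passes through it from left to right: \<open>p t\<^sup>e = t\<^sup>e (f e p)\<close> for \<open>p \<in> A e\<close>. A list of pairs followed
  by an element of \<open>H\<close> stands for \<open>r\<^sub>1 t\<^sup>e\<^sup>1 \<dots> r\<^sub>n t\<^sup>e\<^sup>n h\<close> with coset representatives \<open>r\<^sub>i\<close>.\<close>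
definition rep :: "bool \<Rightarrow> 'h \<Rightarrow> 'h" where
  "rep e h = (if h \<in> A e then ge else (SOME r. r \<in> (\<lambda>p. h \<cdot> p) ` A e))"

lemma coset_eq:
  assumes "gi h \<cdot> h' \<in> A e" shows "(\<lambda>p. h \<cdot> p) ` A e = (\<lambda>p. h' \<cdot> p) ` A e"
proof -
  have *: "(\<lambda>p. h \<cdot> p) ` A e \<subseteq> (\<lambda>p. h' \<cdot> p) ` A e" if "gi h' \<cdot> h \<in> A e" for h h' :: 'h
  proof
    fix x assume "x \<in> (\<lambda>p. h \<cdot> p) ` A e"
    then obtain p where p: "p \<in> A e" "x = h \<cdot> p" by blast
    have "x = h' \<cdot> ((gi h' \<cdot> h) \<cdot> p)" by (simp add: p)
    then show "x \<in> (\<lambda>p. h' \<cdot> p) ` A e" using sgrp_gm[OF sA that p(1)] by blast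
  qed
  have "gi h' \<cdot> h \<in> A e" using sgrp_gi[OF sA assms] by simp
  then show ?thesis using * assms by blast
qed

lemma rep_coset: "rep e h \<in> (\<lambda>p. h \<cdot> p) ` A e"
proof (cases "h \<in> A e")
  case True
  then show ?thesis using sgrp_gi[OF sA True] unfolding rep_def by (auto intro!: image_eqI[of _ _ "gi h"])
next
  case False
  have "h \<cdot> ge \<in> (\<lambda>p. h \<cdot> p) ` A e" using sgrp_ge[OF sA] by blast
  then show ?thesis using False unfolding rep_def by (metis (mono_tags, lifting) someI)
qed

lemma rep_A: "gi (rep e h) \<cdot> h \<in> A e"
proof -
  obtain p where "p \<in> A e" "rep e h = h \<cdot> p" using rep_coset by blast
  then show ?thesis using sgrp_gi[OF sA] by simp
qed

lemma rep_H: "h \<in> H \<Longrightarrow> rep e h \<in> H"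
  using rep_coset[of e h] by (auto simp: sgrp_gm[OF sH] AHD)

lemma rep_eq: "gi h \<cdot> h' \<in> A e \<Longrightarrow> rep e h = rep e h'"
proof -
  assume a: "gi h \<cdot> h' \<in> A e"
  have "h \<in> A e \<longleftrightarrow> h' \<in> A e"
    using a sgrp_gm_iff[OF sA] sgrp_gi[OF sA]
    by (metis gi_cancel_right gi_gi sgrp_gm_iff2 sA)
  then show ?thesis unfolding rep_def using coset_eq[OF a] by simp
qed

lemma rep_rep [simp]: "rep e (rep e h) = rep e h"
  by (rule rep_eq[OF rep_A])

lemma rep_eqD: "rep e h = rep e h' \<Longrightarrow> gi h \<cdot> h' \<in> A e"
  using sgrp_gm[OF sA sgrp_gi[OF sA rep_A[of e h]] rep_A[of e h']] by simp

lemma rep_ge: "rep e h = ge \<longleftrightarrow> h \<in> A e"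
  using rep_A[of e h] unfolding rep_def by (auto split: if_splits)

lemma rep_1 [simp]: "rep e ge = ge"
  by (simp add: rep_ge sgrp_ge[OF sA])

text \<open>When \<open>g\<close> meets a syllable \<open>r\<close> t^e, the product
  \<open>g \<cdot> r\<close> splits into a representative and an element of \<open>A e\<close>; this
  is what that element becomes to the right of the stable letter.\<close>

definition pass :: "'h \<Rightarrow> 'h \<Rightarrow> bool \<Rightarrow> 'h" where
  "pass g r e = f e (gi (rep e (g \<cdot> r)) \<cdot> (g \<cdot> r))"

lemma pass_A: "pass g r e \<in> A (\<not> e)"
  unfolding pass_def by (rule fA[OF rep_A])

lemma pass_H: "pass g r e \<in> H"
  using pass_A AHD by blast

text \<open>Pushing \<open>g\<close> through a word from the left has two outputs: the new syllables
  (\<open>actl\<close>) and the element of the base that comes out on the right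
  (\<open>actr\<close>).\<close>

primrec actl :: "'h \<Rightarrow> ('h \<times> bool) list \<Rightarrow> ('h \<times> bool) list" where
  "actl g [] = []"
| "actl g (x # xs) = (rep (snd x) (g \<cdot> fst x), snd x) # actl (pass g (fst x) (snd x)) xs"

primrec actr :: "'h \<Rightarrow> ('h \<times> bool) list \<Rightarrow> 'h" where
  "actr g [] = g"
| "actr g (x # xs) = actr (pass g (fst x) (snd x)) xs"

text \<open>As the trivial coset is represented by \<open>ge\<close>, this is exactly the case where
  putting t^e in front creates a pinch.\<close>

definition canc :: "bool \<Rightarrow> ('h \<times> bool) list \<Rightarrow> bool" where
  "canc e xs \<longleftrightarrow> (\<exists>ys. xs = (ge, \<not> e) # ys)"

primrec vl :: "('h \<times> bool) list \<Rightarrow> bool" where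
  "vl [] = True"
| "vl (x # xs) \<longleftrightarrow> fst x \<in> H \<and> rep (snd x) (fst x) = fst x \<and> \<not> canc (snd x) xs \<and> vl xs"

lemma length_actl [simp]: "length (actl g xs) = length xs"
  by (induction xs arbitrary: g) simp_all

lemma actr_H: "g \<in> H \<Longrightarrow> actr g xs \<in> H"
  by (induction xs arbitrary: g) (simp_all add: pass_H)

text \<open>Multiplication by an element of \<open>A (\<not> e)\<close> fixes the trivial coset and
  moves no other coset to it, so a pinch is neither created nor destroyed.\<close>

lemma canc_actl:
  assumes "g \<in> A (\<not> e)" "vl xs" shows "canc e (actl g xs) \<longleftrightarrow> canc e xs"
proof (cases xs)
  case Nil then show ?thesis by simp
next
  case (Cons x ys)
  obtain r e' where x: "x = (r, e')" by fastforce
  have "rep e' (g \<cdot> r) = ge \<longleftrightarrow> r = ge" if "e' = (\<not> e)"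
    using assms Cons x that sgrp_gm_iff[OF sA] by (simp add: rep_ge) (metis rep_ge sgrp_ge[OF sA])
  then show ?thesis unfolding canc_def Cons x by auto
qed

lemma vl_actl: "g \<in> H \<Longrightarrow> vl xs \<Longrightarrow> vl (actl g xs)"
  by (induction xs arbitrary: g) (auto simp: rep_H sgrp_gm[OF sH] pass_H canc_actl[OF pass_A])

lemma pass_ge:
  assumes "rep e r = r" shows "pass ge r e = ge"
  using assms by (simp add: pass_def f_ge)

lemma act_ge: "vl xs \<Longrightarrow> actl ge xs = xs \<and> actr ge xs = ge"
  by (induction xs) (auto simp: pass_ge)

lemma pass_pass: "pass g (rep e (g' \<cdot> r)) e \<cdot> pass g' r e = pass (g \<cdot> g') r e"
  and rep_mult: "rep e (g \<cdot> rep e (g' \<cdot> r)) = rep e (g \<cdot> g' \<cdot> r)"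
proof -
  have "gi (g \<cdot> rep e (g' \<cdot> r)) \<cdot> (g \<cdot> g' \<cdot> r) \<in> A e"
    using rep_A[of e "g' \<cdot> r"] by simp
  from rep_eq[OF this] show r: "rep e (g \<cdot> rep e (g' \<cdot> r)) = rep e (g \<cdot> g' \<cdot> r)" .
  have "gi (rep e (g \<cdot> rep e (g' \<cdot> r))) \<cdot> g \<cdot> rep e (g' \<cdot> r) \<in> A e"
    by (rule rep_A)
  from f_gm[OF this rep_A[of e "g' \<cdot> r"]]
  show "pass g (rep e (g' \<cdot> r)) e \<cdot> pass g' r e = pass (g \<cdot> g') r e"
    unfolding pass_def by (simp add: r)
qed

lemma act_act: "actl g (actl g' xs) = actl (g \<cdot> g') xs \<and>
    actr g (actl g' xs) \<cdot> actr g' xs = actr (g \<cdot> g') xs"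
proof (induction xs arbitrary: g g')
  case (Cons x xs)
  show ?case using Cons[of "pass g (rep (snd x) (g' \<cdot> fst x)) (snd x)" "pass g' (fst x) (snd x)"]
    by (simp add: pass_pass rep_mult)
qed simp

section \<open>The HNN extension as a group of permutations of normal forms\<close>

definition V :: "(('h \<times> bool) list \<times> 'h) set" where
  "V = {(xs, h). vl xs \<and> h \<in> H}"

definition act :: "'h \<Rightarrow> ('h \<times> bool) list \<times> 'h \<Rightarrow> ('h \<times> bool) list \<times> 'h" where
  "act g x = (actl g (fst x), actr g (fst x) \<cdot> snd x)"

definition tact :: "bool \<Rightarrow> ('h \<times> bool) list \<times> 'h \<Rightarrow> ('h \<times> bool) list \<times> 'h" where
  "tact e x = (if canc e (fst x) then tl (fst x) else (ge, e) # fst x, snd x)"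

lemma act_V: "g \<in> H \<Longrightarrow> x \<in> V \<Longrightarrow> act g x \<in> V"
  by (auto simp: V_def act_def vl_actl actr_H sgrp_gm[OF sH])

lemma act_comp: "act g (act g' x) = act (g \<cdot> g') x"
  using act_act[of g g' "fst x"] by (auto simp: act_def simp flip: gm_assoc)

lemma act_1: "x \<in> V \<Longrightarrow> act ge x = x"
  by (auto simp: V_def act_def act_ge)

lemma tact_V: "x \<in> V \<Longrightarrow> tact e x \<in> V"
  by (auto simp: V_def tact_def canc_def sgrp_ge[OF sH])

lemma tact_tact: "x \<in> V \<Longrightarrow> tact (\<not> e) (tact e x) = x"
  by (auto simp: V_def tact_def canc_def)

text \<open>The defining relation of the HNN extension on normal forms. In the cancelling case
  \<open>f e p\<close> travels back through the inverse letter and reappears as \<open>p\<close> by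
  \<open>f_f\<close>.\<close>

lemma act_tact:
  assumes "p \<in> A e" "x \<in> V" shows "act p (tact e x) = tact e (act (f e p) x)"
proof -
  obtain xs h where x: "x = (xs, h)" "vl xs" using assms(2) by (auto simp: V_def)
  have c: "canc e (actl (f e p) xs) \<longleftrightarrow> canc e xs" by (rule canc_actl[OF fA[OF assms(1)] x(2)])
  have rp: "rep e p = ge" using assms(1) by (simp add: rep_ge)
  show ?thesis
  proof (cases "canc e xs")
    case True
    then obtain ys where ys: "xs = (ge, \<not> e) # ys" by (auto simp: canc_def)
    have "rep (\<not> e) (f e p) = ge" using fA[OF assms(1)] by (simp add: rep_ge)
    then show ?thesis using True c by (simp add: x tact_def act_def ys pass_def f_f[OF assms(1)])
  next
    case False
    then show ?thesis using c by (simp add: x tact_def act_def pass_def rp)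
  qed
qed

text \<open>Valid normal forms are only a subset of the type; the identity outside makes a
  permutation of the whole type.\<close>

definition on_V :: "(('h \<times> bool) list \<times> 'h \<Rightarrow> ('h \<times> bool) list \<times> 'h) \<Rightarrow> (('h \<times> bool) list \<times> 'h) sym" where
  "on_V F = Sym (\<lambda>x. if x \<in> V then F x else x)"

lemma app_on_V:
  assumes "\<And>x. x \<in> V \<Longrightarrow> F x \<in> V \<and> F' x \<in> V \<and> F (F' x) = x \<and> F' (F x) = x"
  shows "app (on_V F) x = (if x \<in> V then F x else x)"
proof -
  have "bij (\<lambda>x. if x \<in> V then F x else x)"
    by (rule o_bij[of "\<lambda>x. if x \<in> V then F' x else x"]) (auto simp: fun_eq_iff assms)
  then show ?thesis by (simp add: on_V_def app_Sym)
qed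

definition hi :: "'h \<Rightarrow> (('h \<times> bool) list \<times> 'h) sym" where "hi g = on_V (act g)"
definition tt :: "(('h \<times> bool) list \<times> 'h) sym" where "tt = on_V (tact True)"

lemma app_hi: "g \<in> H \<Longrightarrow> app (hi g) x = (if x \<in> V then act g x else x)"
  unfolding hi_def
  by (rule app_on_V[of _ "act (gi g)"]) (auto simp: act_V act_comp act_1 sgrp_gi[OF sH])

lemma app_tt: "app tt x = (if x \<in> V then tact True x else x)"
  unfolding tt_def
  by (rule app_on_V[of _ "tact False"]) (use tact_tact[of _ True] tact_tact[of _ False] in \<open>auto simp: tact_V\<close>)

lemma app_te: "app (te tt e) x = (if x \<in> V then tact e x else x)"
proof (cases e)
  case True then show ?thesis by (simp add: app_tt)
next
  case False
  have "app (gi tt) x = (if x \<in> V then tact False x else x)"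
    by (rule app_gi_eq) (use tact_tact[of _ False] in \<open>auto simp: app_tt tact_V\<close>)
  then show ?thesis using False by simp
qed

lemma hi_hom: "ghom H hi"
  unfolding ghom_def by (auto intro!: sym_eqI simp: app_hi act_V act_comp sgrp_gm[OF sH])

lemma tt_rel: "p \<in> A e \<Longrightarrow> hi p \<cdot> te tt e = te tt e \<cdot> hi (f e p)"
  by (rule sym_eqI) (auto simp: app_hi[OF AHD] app_te act_V[OF AHD[OF fA]] tact_V act_tact AHD[OF fA] app_hi)

text \<open>Growing by left factors only matches the left action, so that induction follows one
  syllable at a time.\<close>

inductive_set Gr :: "(('h \<times> bool) list \<times> 'h) sym set" where
  Gr_ge: "ge \<in> Gr"
| Gr_hi: "g \<in> Gr \<Longrightarrow> h \<in> H \<Longrightarrow> hi h \<cdot> g \<in> Gr"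
| Gr_te: "g \<in> Gr \<Longrightarrow> te tt e \<cdot> g \<in> Gr"

lemma Gr_gm: "x \<in> Gr \<Longrightarrow> y \<in> Gr \<Longrightarrow> x \<cdot> y \<in> Gr"
  by (induction rule: Gr.induct) (auto intro: Gr.intros)

lemma hi_Gr: "h \<in> H \<Longrightarrow> hi h \<in> Gr"
  using Gr_hi[OF Gr_ge] by simp

lemma te_Gr: "te tt e \<in> Gr"
  using Gr_te[OF Gr_ge] by simp

lemma sGr: "sgrp Gr"
proof -
  have "gi x \<in> Gr" if "x \<in> Gr" for x
    using that
  proof (induction rule: Gr.induct)
    case (Gr_hi g h)
    have "gi (hi h) \<in> Gr"
      using hi_Gr[OF sgrp_gi[OF sH Gr_hi(2)]] ghom_gi[OF hi_hom sH Gr_hi(2)] by simp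
    then show ?case using Gr_hi Gr_gm by simp
  next
    case (Gr_te g e)
    then show ?case using te_Gr Gr_gm by (simp add: gi_te)
  qed (simp add: Gr_ge)
  then show ?thesis by (auto simp: sgrp_def Gr_ge Gr_gm)
qed

abbreviation x0 :: "('h \<times> bool) list \<times> 'h" where "x0 \<equiv> ([], ge)"

lemma x0_V: "x0 \<in> V"
  by (simp add: V_def sgrp_ge[OF sH])

lemma Gr_V: "g \<in> Gr \<Longrightarrow> x \<in> V \<Longrightarrow> app g x \<in> V"
  by (induction rule: Gr.induct) (auto simp: app_hi app_te act_V tact_V)

section \<open>Evaluation of normal forms and the universal property\<close>

primrec evl :: "('h \<Rightarrow> 'k::grp) \<Rightarrow> 'k \<Rightarrow> ('h \<times> bool) list \<Rightarrow> 'k" where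
  "evl k \<tau> [] = ge"
| "evl k \<tau> (x # xs) = k (fst x) \<cdot> te \<tau> (snd x) \<cdot> evl k \<tau> xs"

definition ev :: "('h \<Rightarrow> 'k::grp) \<Rightarrow> 'k \<Rightarrow> ('h \<times> bool) list \<times> 'h \<Rightarrow> 'k" where
  "ev k \<tau> x = evl k \<tau> (fst x) \<cdot> k (snd x)"

context
  fixes k :: "'h \<Rightarrow> 'k::grp" and \<tau> :: 'k
  assumes k: "ghom H k" and rel: "\<And>p e. p \<in> A e \<Longrightarrow> k p \<cdot> te \<tau> e = te \<tau> e \<cdot> k (f e p)"
begin

text \<open>The rewriting behind the action uses only the relations \<open>rel\<close>, so in any
  group satisfying them evaluation turns the action into left multiplication.\<close>

lemma evl_actl: "g \<in> H \<Longrightarrow> vl xs \<Longrightarrow> evl k \<tau> (actl g xs) \<cdot> k (actr g xs) = k g \<cdot> evl k \<tau> xs"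
proof (induction xs arbitrary: g)
  case (Cons x xs)
  obtain r e where x: "x = (r, e)" by fastforce
  have r: "r \<in> H" and v: "vl xs" using Cons x by auto
  let ?p = "gi (rep e (g \<cdot> r)) \<cdot> (g \<cdot> r)"
  have gr: "g \<cdot> r \<in> H" by (rule sgrp_gm[OF sH Cons(2) r])
  have "evl k \<tau> (actl g (x # xs)) \<cdot> k (actr g (x # xs)) = k (rep e (g \<cdot> r)) \<cdot> te \<tau> e \<cdot> k (pass g r e) \<cdot> evl k \<tau> xs"
    using Cons.IH[OF pass_H v] by (simp add: x)
  also have "te \<tau> e \<cdot> k (pass g r e) = k ?p \<cdot> te \<tau> e"
    using rel[OF rep_A] by (simp add: pass_def)
  then have "k (rep e (g \<cdot> r)) \<cdot> te \<tau> e \<cdot> k (pass g r e) \<cdot> evl k \<tau> xs = k (rep e (g \<cdot> r)) \<cdot> k ?p \<cdot> te \<tau> e \<cdot> evl k \<tau> xs"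
    by (metis gm_assoc)
  also have "\<dots> = k (g \<cdot> r) \<cdot> te \<tau> e \<cdot> evl k \<tau> xs"
    using ghom_gm[OF k rep_H[OF gr] AHD[OF rep_A[of e "g \<cdot> r"]], of e] by (simp flip: gm_assoc)
  also have "\<dots> = k g \<cdot> evl k \<tau> (x # xs)"
    using ghom_gm[OF k _ r, of g] Cons by (simp add: x)
  finally show ?case .
qed simp

lemma ev_act: "g \<in> H \<Longrightarrow> x \<in> V \<Longrightarrow> ev k \<tau> (act g x) = k g \<cdot> ev k \<tau> x"
  using evl_actl[of g "fst x"]
  by (auto simp: ev_def act_def V_def ghom_gm[OF k] actr_H simp flip: gm_assoc)

lemma ev_tact: "x \<in> V \<Longrightarrow> ev k \<tau> (tact e x) = te \<tau> e \<cdot> ev k \<tau> x"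
  by (auto simp: ev_def tact_def V_def ghom_ge[OF k sH] canc_def)

text \<open>No word for \<open>g\<close> has to be chosen, hence no well-definedness argument
  arises: the permutation itself produces the normal form that is evaluated.\<close>

definition ext :: "(('h \<times> bool) list \<times> 'h) sym \<Rightarrow> 'k" where
  "ext g = ev k \<tau> (app g x0)"

lemma ev_app: "g \<in> Gr \<Longrightarrow> x \<in> V \<Longrightarrow> ev k \<tau> (app g x) = ext g \<cdot> ev k \<tau> x"
proof (induction arbitrary: x rule: Gr.induct)
  case Gr_ge then show ?case by (simp add: ext_def ev_def ghom_ge[OF k sH])
next
  case (Gr_hi g h)
  have "ext (hi h \<cdot> g) = k h \<cdot> ext g"
    using Gr_hi(1,2) by (simp add: ext_def app_hi ev_act Gr_V x0_V)
  then show ?case using Gr_hi by (simp add: app_hi ev_act Gr_V)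
next
  case (Gr_te g e)
  have "ext (te tt e \<cdot> g) = te \<tau> e \<cdot> ext g"
    using Gr_te(1) by (simp add: ext_def app_te ev_tact Gr_V x0_V)
  then show ?case using Gr_te by (simp add: app_te ev_tact Gr_V)
qed

lemma ext_hom: "ghom Gr ext"
  by (auto simp: ghom_def ext_def[of "_ \<cdot> _"] ev_app Gr_V x0_V simp flip: ext_def)

lemma ext_hi: "h \<in> H \<Longrightarrow> ext (hi h) = k h"
  using x0_V by (simp add: ext_def app_hi act_def ev_def)

lemma ext_tt: "ext tt = \<tau>"
  using x0_V by (simp add: ext_def app_tt tact_def canc_def ev_def ghom_ge[OF k sH])

end

lemma universal:
  fixes k :: "'h \<Rightarrow> 'k::grp"
  assumes "ghom H k" "\<And>p e. p \<in> A e \<Longrightarrow> k p \<cdot> te \<tau> e = te \<tau> e \<cdot> k (f e p)"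
  shows "\<exists>F. ghom Gr F \<and> (\<forall>h\<in>H. F (hi h) = k h) \<and> F tt = \<tau>"
  using ext_hom[OF assms] ext_hi[OF assms] ext_tt[OF assms] by blast

abbreviation nf :: "('h \<times> bool) list \<times> 'h \<Rightarrow> (('h \<times> bool) list \<times> 'h) sym" where
  "nf \<equiv> ev hi tt"

lemma evl_Gr: "vl xs \<Longrightarrow> evl hi tt xs \<in> Gr"
  by (induction xs) (auto simp: Gr_ge Gr_hi Gr_te)

lemma nf_Gr: "x \<in> V \<Longrightarrow> nf x \<in> Gr"
  by (auto simp: ev_def V_def evl_Gr hi_Gr intro: Gr_gm)

lemma app_nf:
  assumes "x \<in> V" shows "app (nf x) x0 = x"
proof -
  have "app (evl hi tt xs) ([], h) = (xs, h)" if "h \<in> H" "vl xs" for xs h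
    using that(2)
  proof (induction xs)
    case (Cons x xs)
    have v: "(xs, h) \<in> V" "((ge, snd x) # xs, h) \<in> V" "(x # xs, h) \<in> V"
      using Cons that by (auto simp: V_def sgrp_ge[OF sH])
    have "act (fst x) ((ge, snd x) # xs, h) = (x # xs, h)"
      using Cons(2) by (simp add: act_def pass_def act_ge f_ge)
    then show ?case using Cons v by (simp add: app_te app_hi tact_def)
  qed simp
  moreover have "app (hi (snd x)) x0 = ([], snd x)"
    using assms x0_V by (auto simp: V_def app_hi act_def)
  ultimately show ?thesis using assms by (auto simp: ev_def V_def)
qed

text \<open>The extension of the inclusion of base and stable letter is a homomorphism of
  \<open>Gr\<close> that fixes the generators, hence the identity; by definition it evaluates the
  normal form.\<close>

lemma nf_app:
  assumes "g \<in> Gr" shows "nf (app g x0) = g"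
proof -
  have e: "ext hi tt y = nf (app y x0)" if "y \<in> Gr" for y
    using that by (simp add: ext_def[OF hi_hom tt_rel])
  have "ext hi tt y = y" if "y \<in> Gr" for y
    using that
  proof (induction rule: Gr.induct)
    case Gr_ge then show ?case by (simp add: ghom_ge[OF ext_hom[OF hi_hom tt_rel] sGr])
  next
    case (Gr_hi g h)
    then show ?case
      by (simp add: ghom_gm[OF ext_hom[OF hi_hom tt_rel] hi_Gr] ext_hi[OF hi_hom tt_rel])
  next
    case (Gr_te g e)
    have "tt \<in> Gr" using te_Gr[of True] by simp
    with Gr_te show ?case
      by (simp add: ghom_gm[OF ext_hom[OF hi_hom tt_rel] te_Gr] ghom_te[OF ext_hom[OF hi_hom tt_rel] sGr]
          ext_tt[OF hi_hom tt_rel])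
  qed
  then show ?thesis using assms e by simp
qed

lemma hi_inj: "inj_on hi H"
proof (rule inj_onI)
  fix x y assume "x \<in> H" "y \<in> H" "hi x = hi y"
  then have "act x x0 = act y x0" using x0_V by (metis app_hi)
  then show "x = y" by (simp add: act_def)
qed

definition len :: "(('h \<times> bool) list \<times> 'h) sym \<Rightarrow> nat" where
  "len g = length (fst (app g x0))"

end

section \<open>Length in HNN extensions\<close>

lemma conj_swap: "gi g \<cdot> x \<cdot> g = y \<longleftrightarrow> x = g \<cdot> y \<cdot> gi g" for g :: "'a::grp"
proof
  assume "gi g \<cdot> x \<cdot> g = y"
  then have "g \<cdot> y \<cdot> gi g = g \<cdot> (gi g \<cdot> x \<cdot> g) \<cdot> gi g" by simp
  then show "x = g \<cdot> y \<cdot> gi g" by simp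
qed simp

text \<open>What is used of Britton's lemma, free of coset representatives and of the type of normal
  forms: a length, and in \<open>uniq\<close> the fact that the first syllable of a reduced product
  is determined up to \<open>A e\<close>.\<close>

locale hnn =
  fixes G H :: "'g::grp set" and t :: 'g and A :: "bool \<Rightarrow> 'g set" and ln :: "'g \<Rightarrow> nat"
  assumes sG: "sgrp G" and sH: "sgrp H" and HG: "H \<subseteq> G" and tG: "t \<in> G"
    and sA: "sgrp (A e)" and AH: "A e \<subseteq> H"
    and At: "p \<in> A e \<Longrightarrow> te t (\<not> e) \<cdot> p \<cdot> te t e \<in> A (\<not> e)"
    and ln0: "g \<in> G \<Longrightarrow> ln g = 0 \<longleftrightarrow> g \<in> H"
    and lnS: "g \<in> G \<Longrightarrow> ln g = Suc n \<Longrightarrow> \<exists>h\<in>H. \<exists>e. \<exists>g'\<in>G. g = h \<cdot> te t e \<cdot> g' \<and> ln g' = n"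
    and lnH: "h \<in> H \<Longrightarrow> g \<in> G \<Longrightarrow> ln (h \<cdot> g) = ln g"
    and lnt: "g \<in> G \<Longrightarrow> ln (te t e \<cdot> g) = Suc (ln g) \<or> ln g = Suc (ln (te t e \<cdot> g))"
    and uniq: "h \<in> H \<Longrightarrow> h' \<in> H \<Longrightarrow> g \<in> G \<Longrightarrow> g' \<in> G \<Longrightarrow> h \<cdot> te t e \<cdot> g = h' \<cdot> te t e' \<cdot> g' \<Longrightarrow>
      ln (te t e \<cdot> g) = Suc (ln g) \<Longrightarrow> ln (te t e' \<cdot> g') = Suc (ln g') \<Longrightarrow> e = e' \<and> gi h \<cdot> h' \<in> A e"
begin

lemma HGD: "h \<in> H \<Longrightarrow> h \<in> G"
  using HG by blast

lemma AHD: "p \<in> A e \<Longrightarrow> p \<in> H"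
  using AH by blast

lemma teG: "te t e \<in> G"
  by (rule sgrp_te[OF sG tG])

lemmas G_closed = sgrp_gm[OF sG] sgrp_gi[OF sG] teG HGD sgrp_ge[OF sG]
lemmas H_closed = sgrp_gm[OF sH] sgrp_gi[OF sH] sgrp_ge[OF sH]

text \<open>The junction between t^e and \<open>g\<close> is reduced.\<close>

definition full :: "bool \<Rightarrow> 'g \<Rightarrow> bool" where
  "full e g \<longleftrightarrow> ln (te t e \<cdot> g) = Suc (ln g)"

lemma ln_ge [simp]: "ln ge = 0"
  using ln0[of ge] by (simp add: G_closed H_closed)

lemma full_ge: "full e ge"
  using lnt[of ge e] by (simp add: full_def G_closed)

lemma decomp:
  assumes "g \<in> G" "ln g \<noteq> 0"
  obtains h e g' where "h \<in> H" "g' \<in> G" "g = h \<cdot> te t e \<cdot> g'" "full e g'" "ln g = Suc (ln g')"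
proof -
  obtain n where n: "ln g = Suc n" using assms(2) not0_implies_Suc by blast
  obtain h e g' where h: "h \<in> H" "g' \<in> G" "g = h \<cdot> te t e \<cdot> g'" "ln g' = n"
    using lnS[OF assms(1) n] by blast
  have "full e g'" using lnH[OF h(1), of "te t e \<cdot> g'"] h n by (simp add: full_def G_closed)
  then show ?thesis using that h n by blast
qed

lemma ln_full: "h \<in> H \<Longrightarrow> g \<in> G \<Longrightarrow> full e g \<Longrightarrow> ln (h \<cdot> te t e \<cdot> g) = Suc (ln g)"
  by (simp add: lnH full_def G_closed)

lemma ln_te_le: "g \<in> G \<Longrightarrow> ln (te t e \<cdot> g) \<le> Suc (ln g)"
  using lnt[of g e] by auto

lemma ln_gm_le: "x \<in> G \<Longrightarrow> y \<in> G \<Longrightarrow> ln (x \<cdot> y) \<le> ln x + ln y"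
proof (induction "ln x" arbitrary: x)
  case 0
  then show ?case using ln0 lnH by auto
next
  case (Suc n)
  then obtain h e x' where x: "h \<in> H" "x' \<in> G" "x = h \<cdot> te t e \<cdot> x'" "ln x' = n"
    using lnS[of x n] by metis
  have "ln (x \<cdot> y) = ln (te t e \<cdot> x' \<cdot> y)" using lnH x Suc by (simp add: G_closed)
  also have "\<dots> \<le> Suc (ln (x' \<cdot> y))" using ln_te_le x Suc by (simp add: G_closed)
  finally show ?case using Suc(1)[of x'] x Suc(2-) by simp
qed

lemma ln_te: "ln (te t e) \<le> 1"
  using ln_te_le[of ge e] by (simp add: G_closed)

lemma ln_gi: "x \<in> G \<Longrightarrow> ln (gi x) = ln x"
proof -
  have le: "ln (gi x) \<le> ln x" if "x \<in> G" for x
    using that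
  proof (induction "ln x" arbitrary: x)
    case 0
    then show ?case using ln0 by (metis G_closed(2) H_closed(2) order_refl)
  next
    case (Suc n)
    then obtain h e x' where x: "h \<in> H" "x' \<in> G" "x = h \<cdot> te t e \<cdot> x'" "ln x' = n"
      using lnS[of x n] by metis
    have "ln (gi x) = ln (gi x' \<cdot> te t (\<not> e) \<cdot> gi h)" by (simp add: x gi_te)
    also have "\<dots> \<le> ln (gi x') + ln (te t (\<not> e) \<cdot> gi h)"
      using x by (intro ln_gm_le) (simp_all add: G_closed)
    also have "ln (te t (\<not> e) \<cdot> gi h) \<le> ln (te t (\<not> e)) + ln (gi h)"
      using x by (intro ln_gm_le) (simp_all add: G_closed)
    finally show ?case
      using Suc(1)[of x'] x Suc(2-) ln_te[of "\<not> e"] ln0[of "gi h"] by (simp add: G_closed H_closed)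
  qed
  show "x \<in> G \<Longrightarrow> ln (gi x) = ln x" using le[of x] le[of "gi x"] G_closed by auto
qed

lemma lnHr: "h \<in> H \<Longrightarrow> g \<in> G \<Longrightarrow> ln (g \<cdot> h) = ln g"
  using ln_gi[of "g \<cdot> h"] lnH[of "gi h" "gi g"] ln_gi[of g] by (simp add: G_closed H_closed)

lemma pinch: "p \<in> A e \<Longrightarrow> te t (\<not> e) \<cdot> p \<cdot> te t e \<in> H"
  using At AHD by blast

text \<open>If \<open>te t e'\<close> cancelled into the product, the product would also begin with
  the opposite letter and trivial coefficient; \<open>uniq\<close> compares this with
  \<open>h \<cdot> te t e\<close>.\<close>

lemma full_step:
  assumes "h \<in> H" "g \<in> G" "full e g" "\<not> (e' = (\<not> e) \<and> h \<in> A e)"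
  shows "full e' (h \<cdot> te t e \<cdot> g)"
proof (rule ccontr)
  let ?g = "h \<cdot> te t e \<cdot> g" let ?k = "te t e' \<cdot> ?g"
  have G: "?g \<in> G" "?k \<in> G" using assms by (simp_all add: G_closed)
  assume "\<not> full e' ?g"
  then have "ln ?g = Suc (ln ?k)" using lnt[OF G(1)] by (auto simp: full_def)
  then have "ln (te t (\<not> e') \<cdot> ?k) = Suc (ln ?k)" by simp
  from uniq[OF H_closed(3) assms(1) G(2) assms(2) _ this, of e] assms(3,4)
  show False by (auto simp: full_def)
qed

lemma full_iff:
  assumes "h \<in> H" "g \<in> G" "full e g"
  shows "full e' (h \<cdot> te t e \<cdot> g) \<longleftrightarrow> \<not> (e' = (\<not> e) \<and> h \<in> A e)"
proof -
  have False if "e' = (\<not> e)" "h \<in> A e" "full e' (h \<cdot> te t e \<cdot> g)"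
  proof -
    have p: "te t (\<not> e) \<cdot> h \<cdot> te t e \<in> H" using pinch that by blast
    have "ln (te t e' \<cdot> h \<cdot> te t e \<cdot> g) = ln g" using lnH[OF p assms(2)] that by simp
    then show False using that ln_full[OF assms] by (simp add: full_def)
  qed
  then show ?thesis using full_step[OF assms] by blast
qed

text \<open>Both \<open>h t\<^sup>e x y\<close> and \<open>g h t\<^sup>e x\<close> are reduced expressions of the same element when \<open>y\<close> is the conjugate,
  so their first syllables agree.\<close>
lemma conj_A:
  assumes h: "h \<in> H" and x: "x \<in> G" "full e x" and g: "g \<in> H"
    and c: "gi (h \<cdot> te t e \<cdot> x) \<cdot> g \<cdot> (h \<cdot> te t e \<cdot> x) \<in> H"
  shows "gi h \<cdot> g \<cdot> h \<in> A e"
proof -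
  define y where "y = gi (h \<cdot> te t e \<cdot> x) \<cdot> g \<cdot> (h \<cdot> te t e \<cdot> x)"
  have yH: "y \<in> H" using c y_def by simp
  have "h \<cdot> te t e \<cdot> (x \<cdot> y) = (g \<cdot> h) \<cdot> te t e \<cdot> x" by (simp add: y_def gi_te)
  moreover have "ln (te t e \<cdot> (x \<cdot> y)) = Suc (ln (x \<cdot> y))"
    using lnHr[OF yH, of x] lnHr[OF yH, of "te t e \<cdot> x"] x by (simp add: full_def G_closed)
  ultimately show ?thesis
    using uniq[of h "g \<cdot> h" "x \<cdot> y" x e e] h g x yH by (simp add: full_def G_closed H_closed)
qed

text \<open>Concatenation at a reduced junction is reduced, and appending \<open>y\<close> does not change the first
  syllable; the second part makes the induction work.\<close>
lemma concat_full:
  assumes "x \<in> G" "y \<in> G" "ln (x \<cdot> te t e) = Suc (ln x)" "full e y"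
  shows "ln (x \<cdot> te t e \<cdot> y) = Suc (ln x + ln y) \<and>
    (\<exists>h\<in>H. \<exists>f. \<exists>u\<in>G. \<exists>v\<in>G. x \<cdot> te t e = h \<cdot> te t f \<cdot> u \<and> full f u \<and> x \<cdot> te t e \<cdot> y = h \<cdot> te t f \<cdot> v \<and> full f v)"
  using assms(1,3)
proof (induction "ln x" arbitrary: x)
  case 0
  then have x: "x \<in> H" using ln0 by auto
  have "x \<cdot> te t e = x \<cdot> te t e \<cdot> ge" by simp
  then have "\<exists>h\<in>H. \<exists>f. \<exists>u\<in>G. \<exists>v\<in>G. x \<cdot> te t e = h \<cdot> te t f \<cdot> u \<and> full f u \<and> x \<cdot> te t e \<cdot> y = h \<cdot> te t f \<cdot> v \<and> full f v"
    using x full_ge assms(2,4) G_closed(5) by blast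
  then show ?case using ln_full[OF x assms(2,4)] 0 by simp
next
  case (Suc n)
  then obtain h f x' where x: "h \<in> H" "x' \<in> G" "x = h \<cdot> te t f \<cdot> x'" "full f x'" "ln x = Suc (ln x')"
    using decomp[of x] by (metis nat.distinct(1))
  have G: "x' \<cdot> te t e \<in> G" using x by (simp add: G_closed)
  have l: "ln (x \<cdot> te t e) = ln (te t f \<cdot> x' \<cdot> te t e)"
    using lnH[OF x(1), of "te t f \<cdot> x' \<cdot> te t e"] x by (simp add: G_closed)
  have "ln (x' \<cdot> te t e) \<le> ln x' + ln (te t e)" by (rule ln_gm_le[OF x(2) teG])
  then have l': "ln (x' \<cdot> te t e) = Suc (ln x')" "full f (x' \<cdot> te t e)"
    using l ln_te_le[OF G, of f] ln_te[of e] Suc x(5) by (auto simp: full_def)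
  obtain h1 f1 u v where IH: "ln (x' \<cdot> te t e \<cdot> y) = Suc (ln x' + ln y)" "h1 \<in> H" "u \<in> G" "v \<in> G"
    "x' \<cdot> te t e = h1 \<cdot> te t f1 \<cdot> u" "full f1 u" "x' \<cdot> te t e \<cdot> y = h1 \<cdot> te t f1 \<cdot> v" "full f1 v"
    using Suc(1)[of x'] Suc(2) x l' by auto
  have "full f (x' \<cdot> te t e \<cdot> y)"
    using l'(2) full_iff[OF IH(2,3,6)] full_iff[OF IH(2,4,8)] IH(5,7) by metis
  moreover have "x' \<cdot> te t e \<cdot> y \<in> G" using x assms by (simp add: G_closed)
  moreover have "x \<cdot> te t e = h \<cdot> te t f \<cdot> (x' \<cdot> te t e)" "x \<cdot> te t e \<cdot> y = h \<cdot> te t f \<cdot> (x' \<cdot> te t e \<cdot> y)"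
    by (simp_all add: x)
  ultimately show ?case using ln_full[OF x(1), of "x' \<cdot> te t e \<cdot> y" f] l'(2) x(1,5) IH(1) G
    by (metis add_Suc)
qed

text \<open>The last stable letter of \<open>y\<close> separates the two junctions. Cutting
  \<open>y\<close> there reduces the claim to \<open>concat_full\<close>.\<close>

lemma concat:
  assumes "x \<in> G" "y \<in> G" "z \<in> G" "ln (x \<cdot> y) = ln x + ln y" "ln (y \<cdot> z) = ln y + ln z" "ln y \<noteq> 0"
  shows "ln (x \<cdot> y \<cdot> z) = ln x + ln y + ln z"
proof -
  have "gi y \<in> G" "ln (gi y) \<noteq> 0" using assms by (simp_all add: G_closed ln_gi)
  from decomp[OF this] obtain h e y' where y': "h \<in> H" "y' \<in> G" "gi y = h \<cdot> te t e \<cdot> y'" "full e y'" "ln (gi y) = Suc (ln y')"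
    by blast
  define w where "w = gi y'"
  define f where "f = (\<not> e)"
  define k where "k = gi h"
  have "gi (gi y) = w \<cdot> te t f \<cdot> k" unfolding y'(3) by (simp add: w_def f_def k_def gi_te)
  then have y: "y = w \<cdot> te t f \<cdot> k" by simp
  have w: "w \<in> G" "ln y = Suc (ln w)" and k: "k \<in> H" "k \<cdot> z \<in> G"
    using y'(1,2,5) assms(2,3) ln_gi[of y] by (simp_all add: w_def k_def G_closed H_closed ln_gi)
  have xw: "x \<cdot> w \<in> G" using assms w by (simp add: G_closed)
  have lxw: "ln (x \<cdot> w) \<le> ln x + ln w" by (rule ln_gm_le[OF assms(1) w(1)])
  have 1: "ln (x \<cdot> y) = ln ((x \<cdot> w) \<cdot> te t f)"
    using lnHr[OF k(1) sgrp_gm[OF sG xw teG[of f]]] by (simp add: y)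
  have lxt: "ln ((x \<cdot> w) \<cdot> te t f) \<le> Suc (ln (x \<cdot> w))"
    using ln_gm_le[OF xw teG[of f]] ln_te[of f] by linarith
  have x1: "ln ((x \<cdot> w) \<cdot> te t f) = Suc (ln (x \<cdot> w))" "ln (x \<cdot> w) = ln x + ln w"
    using 1 lxw lxt assms(4) w(2) by linarith+
  have "ln (y \<cdot> z) \<le> ln w + ln (te t f \<cdot> (k \<cdot> z))"
    using ln_gm_le[OF w(1), of "te t f \<cdot> (k \<cdot> z)"] k by (simp add: y G_closed)
  then have "Suc (ln (k \<cdot> z)) \<le> ln (te t f \<cdot> (k \<cdot> z))"
    using assms(5) w(2) lnH[OF k(1) assms(3)] by simp
  then have z1: "full f (k \<cdot> z)" using ln_te_le[OF k(2), of f] by (simp add: full_def)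
  show ?thesis using concat_full[OF xw k(2) x1(1) z1] x1 w(2) lnH[OF k(1) assms(3)] by (simp add: y)
qed

text \<open>Cyclically reduced elements of positive length; on the Bass-Serre tree these are the
  hyperbolic elements whose axis passes through the base vertex.\<close>

definition hyp :: "'g \<Rightarrow> bool" where
  "hyp x \<longleftrightarrow> x \<in> G \<and> ln x \<noteq> 0 \<and> ln (x \<cdot> x) = 2 * ln x"

lemma ln_hyp_npw: "hyp x \<Longrightarrow> ln (npw x n) = n * ln x"
proof (induction n rule: induct_nat_012)
  case (ge2 n)
  have "ln (x \<cdot> x \<cdot> npw x n) = ln x + ln x + ln (npw x n)"
    using ge2 by (intro concat) (auto simp: hyp_def sgrp_npw[OF sG])
  then show ?case using ge2 by simp
qed (simp_all add: hyp_def)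

lemma ln_hyp_pw: "hyp x \<Longrightarrow> ln (x \<up> n) = nat \<bar>n\<bar> * ln x"
proof (cases "n \<ge> 0")
  case False
  assume h: "hyp x"
  have "ln (x \<up> n) = ln (gi (npw x (nat (- n))))" using False by (simp add: pw_def npw_gi)
  also have "\<dots> = ln (npw x (nat (- n)))" using h by (intro ln_gi) (simp add: hyp_def sgrp_npw[OF sG])
  finally show ?thesis using ln_hyp_npw[OF h] False by simp
qed (simp add: pw_def ln_hyp_npw)

text \<open>In a conjugate of minimal length, moving the first syllable to the end does not shorten
  the element, so its junction with itself is reduced.\<close>

lemma cyclic_reduction:
  assumes "x \<in> G" obtains g where "g \<in> G" "gi g \<cdot> x \<cdot> g \<in> H \<or> hyp (gi g \<cdot> x \<cdot> g)"
proof -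
  obtain g where g: "g \<in> G" and min: "\<And>y. y \<in> G \<Longrightarrow> ln (gi g \<cdot> x \<cdot> g) \<le> ln (gi y \<cdot> x \<cdot> y)"
    using ex_has_least_nat[of "\<lambda>g. g \<in> G" ge "\<lambda>g. ln (gi g \<cdot> x \<cdot> g)"] G_closed(5) by blast
  define z where "z = gi g \<cdot> x \<cdot> g"
  have z: "z \<in> G" using g assms by (simp add: z_def G_closed)
  have "hyp z" if nz: "ln z \<noteq> 0"
  proof -
    obtain h e c where c: "h \<in> H" "c \<in> G" "z = h \<cdot> te t e \<cdot> c" "full e c" "ln z = Suc (ln c)"
      using decomp[OF z nz] .
    let ?u = "h \<cdot> te t e"
    have u: "?u \<in> G" "ln ?u = 1" using c(1) full_ge[of e] lnH[OF c(1) teG[of e]] by (simp_all add: G_closed full_def)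
    have "gi (g \<cdot> ?u) \<cdot> x \<cdot> (g \<cdot> ?u) = gi ?u \<cdot> z \<cdot> ?u" by (simp add: z_def)
    also have "\<dots> = c \<cdot> ?u" by (simp add: c(3))
    finally have "ln z \<le> ln (c \<cdot> ?u)" using min[of "g \<cdot> ?u"] g u by (simp add: G_closed flip: z_def)
    then have cu: "ln (c \<cdot> ?u) = ln c + ln ?u" using ln_gm_le[OF c(2) u(1)] c(5) u(2) by linarith
    have uc: "ln (?u \<cdot> c) = ln ?u + ln c" using c u by simp
    \<comment> \<open>\<open>concat\<close> requires a middle factor of positive length. If
      \<open>c\<close> lies in \<open>H\<close> there is only one stable letter, and two letters of
      equal sign never form a pinch.\<close>
    have "ln (z \<cdot> z) = 2 * ln z"
    proof (cases "ln c = 0")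
      case True
      then have cH: "c \<in> H" using c ln0 by blast
      then have "full e (c \<cdot> h \<cdot> te t e \<cdot> c)"
        using full_step[of "c \<cdot> h" c e e] c by (simp add: H_closed)
      moreover have "ln (c \<cdot> h \<cdot> te t e \<cdot> c) = Suc (ln c)" using ln_full[of "c \<cdot> h" c e] c cH by (simp add: H_closed)
      ultimately show ?thesis
        using ln_full[OF c(1), of "c \<cdot> h \<cdot> te t e \<cdot> c" e] c u True by (simp add: c(3) G_closed)
    next
      case False
      have 1: "ln (?u \<cdot> c \<cdot> ?u) = ln ?u + ln c + ln ?u"
        by (rule concat[OF u(1) c(2) u(1) uc cu False])
      have "ln ((?u \<cdot> c) \<cdot> ?u \<cdot> c) = ln (?u \<cdot> c) + ln ?u + ln c"
        by (rule concat) (use u c uc 1 in \<open>simp_all add: G_closed\<close>)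
      then show ?thesis using uc u(2) c(5) by (simp add: c(3))
    qed
    then show ?thesis using z nz by (simp add: hyp_def)
  qed
  then show ?thesis using that[OF g] ln0[OF z] z_def by blast
qed

text \<open>Powers of an element conjugate into \<open>H\<close> have bounded length, here at most
  \<open>2 * ln w\<close>, whereas those of a hyperbolic element grow linearly; the exponent
  \<open>?N\<close> is just large enough for a contradiction.\<close>

lemma root_elliptic:
  assumes "x \<in> G" "g \<in> G" "n \<noteq> 0" "gi g \<cdot> (x \<up> n) \<cdot> g \<in> H"
  obtains y where "y \<in> G" "gi y \<cdot> x \<cdot> y \<in> H"
proof -
  obtain y where y: "y \<in> G" and d: "gi y \<cdot> x \<cdot> y \<in> H \<or> hyp (gi y \<cdot> x \<cdot> y)"
    using cyclic_reduction[OF assms(1)] .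
  have False if h: "hyp (gi y \<cdot> x \<cdot> y)"
  proof -
    let ?z = "gi y \<cdot> x \<cdot> y"
    define w where "w = gi y \<cdot> g"
    let ?N = "int (2 * ln w + 1)"
    define X where "X = (gi g \<cdot> (x \<up> n) \<cdot> g) \<up> ?N"
    have w: "w \<in> G" using y assms by (simp add: w_def G_closed)
    have X: "X \<in> H" using assms sgrp_pw[OF sH] by (simp add: X_def)
    have "?z \<up> (n * ?N) = w \<cdot> X \<cdot> gi w"
      unfolding X_def w_def pw_conj pw_pw by simp
    then have "ln (?z \<up> (n * ?N)) \<le> ln w + ln (X \<cdot> gi w)"
      using ln_gm_le[OF w sgrp_gm[OF sG HGD[OF X] sgrp_gi[OF sG w]]] by simp
    then have "ln (?z \<up> (n * ?N)) \<le> 2 * ln w"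
      using lnH[OF X sgrp_gi[OF sG w]] ln_gi[OF w] by linarith
    moreover have "ln (?z \<up> (n * ?N)) = nat \<bar>n * ?N\<bar> * ln ?z" by (rule ln_hyp_pw[OF h])
    moreover have "nat \<bar>n * ?N\<bar> \<ge> 2 * ln w + 1"
    proof -
      have "\<bar>n\<bar> \<ge> 1" using assms by simp
      then have "\<bar>n\<bar> * ?N \<ge> 1 * ?N" by (intro mult_right_mono) auto
      then have "\<bar>n * ?N\<bar> \<ge> int (2 * ln w + 1)" by (simp add: abs_mult)
      then show ?thesis by linarith
    qed
    moreover have "ln ?z \<ge> 1" using h by (simp add: hyp_def)
    ultimately have "(2 * ln w + 1) * 1 \<le> 2 * ln w"
      by (metis mult_le_mono order_trans)
    then show False by simp
  qed
  then show ?thesis using that y d by blast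
qed

text \<open>Conjugation by \<open>C\<close> changes the length by at most \<open>2 * ln C\<close>,
  but for a hyperbolic element the lengths of the \<open>l * ?N\<close>-th and
  \<open>m * ?N\<close>-th powers differ by at least \<open>?N\<close>.\<close>

lemma conj_pw_elliptic:
  assumes "x \<in> G" "B \<in> G" "gi B \<cdot> (x \<up> l) \<cdot> B = x \<up> m" "\<bar>l\<bar> > \<bar>m\<bar>"
  obtains y where "y \<in> G" "gi y \<cdot> x \<cdot> y \<in> H"
proof -
  obtain y where y: "y \<in> G" and d: "gi y \<cdot> x \<cdot> y \<in> H \<or> hyp (gi y \<cdot> x \<cdot> y)"
    using cyclic_reduction[OF assms(1)] .
  have False if h: "hyp (gi y \<cdot> x \<cdot> y)"
  proof -
    define C where "C = gi y \<cdot> B \<cdot> y"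
    let ?z = "gi y \<cdot> x \<cdot> y"
    let ?N = "int (2 * ln C + 1)"
    have C: "C \<in> G" using y assms by (simp add: C_def G_closed)
    have zG: "?z \<up> (m * ?N) \<in> G" using y assms(1) by (simp add: G_closed sgrp_pw[OF sG])
    have "gi C \<cdot> (?z \<up> l) \<cdot> C = gi y \<cdot> (gi B \<cdot> (x \<up> l) \<cdot> B) \<cdot> y" unfolding pw_conj C_def by simp
    also have "\<dots> = ?z \<up> m" unfolding pw_conj assms(3) ..
    finally have "?z \<up> l = C \<cdot> (?z \<up> m) \<cdot> gi C" unfolding conj_swap .
    then have "?z \<up> (l * ?N) = C \<cdot> (?z \<up> (m * ?N)) \<cdot> gi C" unfolding pw_pw[symmetric] pw_conj'[symmetric] by (rule arg_cong)
    then have "ln (?z \<up> (l * ?N)) \<le> ln C + (ln (?z \<up> (m * ?N)) + ln (gi C))"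
      using ln_gm_le[OF C sgrp_gm[OF sG zG sgrp_gi[OF sG C]]] ln_gm_le[OF zG sgrp_gi[OF sG C]] by simp
    then have "nat \<bar>l * ?N\<bar> * ln ?z \<le> nat \<bar>m * ?N\<bar> * ln ?z + 2 * ln C"
      using ln_hyp_pw[OF h] ln_gi[OF C] by simp
    then have "int (nat \<bar>l * ?N\<bar> * ln ?z) \<le> int (nat \<bar>m * ?N\<bar> * ln ?z + 2 * ln C)"
      by (rule of_nat_mono)
    then have "\<bar>l\<bar> * ?N * int (ln ?z) \<le> \<bar>m\<bar> * ?N * int (ln ?z) + 2 * int (ln C)"
      by (simp add: abs_mult)
    moreover have "(\<bar>m\<bar> + 1) * (?N * int (ln ?z)) \<le> \<bar>l\<bar> * (?N * int (ln ?z))"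
      using assms(4) by (intro mult_right_mono) auto
    ultimately have "?N * int (ln ?z) \<le> 2 * int (ln C)" by (simp add: algebra_simps)
    moreover have "?N * 1 \<le> ?N * int (ln ?z)" by (rule mult_left_mono) (use h in \<open>auto simp: hyp_def\<close>)
    ultimately have "?N * 1 \<le> 2 * int (ln C)" by linarith
    then show False by simp
  qed
  then show ?thesis using that y d by blast
qed

end

text \<open>For \<open>uniq\<close>, the normal form of a reduced product begins with
  \<open>(rep e h, e)\<close>, so equal products have equal signs and equal cosets.\<close>

lemma (in hnn_base) hnn_Gr: "hnn Gr (hi ` H) tt (\<lambda>e. hi ` A e) len"
proof
  show "sgrp Gr" by (rule sGr)
  show sH': "sgrp (hi ` H)" by (rule sgrp_image[OF hi_hom sH])
  show "hi ` H \<subseteq> Gr" using hi_Gr by blast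
  show "tt \<in> Gr" using te_Gr[of True] by simp
  show "sgrp (hi ` A e)" for e by (rule sgrp_image[OF ghom_subset[OF hi_hom AH] sA])
  show "hi ` A e \<subseteq> hi ` H" for e using AH by blast
  show "te tt (\<not> e) \<cdot> p \<cdot> te tt e \<in> hi ` A (\<not> e)" if "p \<in> hi ` A e" for p e
    using that fA tt_rel by auto
  show "len g = 0 \<longleftrightarrow> g \<in> hi ` H" if g: "g \<in> Gr" for g
  proof
    assume "len g = 0"
    then obtain h where "app g x0 = ([], h)" by (metis len_def length_0_conv prod.collapse)
    moreover have "app g x0 \<in> V" using Gr_V[OF g x0_V] .
    ultimately show "g \<in> hi ` H" using nf_app[OF g] by (auto simp: ev_def V_def)
  next
    assume "g \<in> hi ` H" then show "len g = 0" using x0_V by (auto simp: len_def app_hi act_def)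
  qed
  show "\<exists>h\<in>hi ` H. \<exists>e. \<exists>g'\<in>Gr. g = h \<cdot> te tt e \<cdot> g' \<and> len g' = n" if g: "g \<in> Gr" and n: "len g = Suc n" for g n
  proof -
    obtain r e xs h where x: "app g x0 = ((r, e) # xs, h)"
      using n unfolding len_def by (metis length_Suc_conv prod.collapse)
    have V: "(xs, h) \<in> V" "r \<in> H" using Gr_V[OF g x0_V] x by (auto simp: V_def)
    have "g = hi r \<cdot> te tt e \<cdot> nf (xs, h)" using nf_app[OF g] by (simp add: x ev_def)
    moreover have "len (nf (xs, h)) = n" using n x app_nf[OF V(1)] by (simp add: len_def)
    ultimately show ?thesis using V nf_Gr by blast
  qed
  show "len (h \<cdot> g) = len g" if "h \<in> hi ` H" "g \<in> Gr" for h g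
    using that Gr_V[OF _ x0_V] by (auto simp: len_def app_hi act_def)
  show "len (te tt e \<cdot> g) = Suc (len g) \<or> len g = Suc (len (te tt e \<cdot> g))" if "g \<in> Gr" for g e
    using that Gr_V[OF _ x0_V] by (auto simp: len_def app_te tact_def canc_def)
  fix h h' g g' e e'
  assume h: "h \<in> hi ` H" "h' \<in> hi ` H" and g: "g \<in> Gr" "g' \<in> Gr"
    and eq: "h \<cdot> te tt e \<cdot> g = h' \<cdot> te tt e' \<cdot> g'"
    and full: "len (te tt e \<cdot> g) = Suc (len g)" "len (te tt e' \<cdot> g') = Suc (len g')"
  have hd: "hd (fst (app (hi h \<cdot> te tt e \<cdot> g) x0)) = (rep e h, e)"
    if "h \<in> H" "g \<in> Gr" "len (te tt e \<cdot> g) = Suc (len g)" for h e g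
  proof -
    have V: "app g x0 \<in> V" using Gr_V that x0_V by blast
    have "\<not> canc e (fst (app g x0))" using that(3) V by (auto simp: len_def app_te tact_def canc_def)
    then have "app (te tt e \<cdot> g) x0 = ((ge, e) # fst (app g x0), snd (app g x0))"
      using V by (simp add: app_te tact_def)
    moreover have "app (te tt e \<cdot> g) x0 \<in> V" using Gr_V[OF Gr_te[OF that(2)] x0_V] .
    ultimately show ?thesis using that by (simp add: app_hi act_def)
  qed
  obtain k k' where k: "k \<in> H" "h = hi k" "k' \<in> H" "h' = hi k'" using h by blast
  have "(rep e k, e) = (rep e' k', e')"
    using hd[OF k(1) g(1) full(1)] hd[OF k(3) g(2) full(2)] eq unfolding k by metis
  then have e: "e' = e" "gi k \<cdot> k' \<in> A e" using rep_eqD by auto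
  moreover have "hi (gi k \<cdot> k') = gi h \<cdot> h'"
    using k by (simp add: ghom_gm[OF hi_hom] ghom_gi[OF hi_hom sH] sgrp_gi[OF sH])
  ultimately show "e = e' \<and> gi h \<cdot> h' \<in> hi ` A e" by (metis image_eqI)
qed

lemma hnn_transfer:
  fixes \<iota> :: "'a::grp \<Rightarrow> 'b::grp"
  assumes "hnn G H t A L" and hom: "ghom G \<iota>" and inj: "inj_on \<iota> G"
  shows "hnn (\<iota> ` G) (\<iota> ` H) (\<iota> t) (\<lambda>e. \<iota> ` A e) (\<lambda>g. L (inv_into G \<iota> g))"
proof -
  interpret hnn G H t A L by fact
  have ln: "L (inv_into G \<iota> (\<iota> g)) = L g" if "g \<in> G" for g
    using that inj by simp
  have im: "\<iota> x \<cdot> \<iota> y = \<iota> (x \<cdot> y)" if "x \<in> G" "y \<in> G" for x y using ghom_gm[OF hom that] by simp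
  have te: "te (\<iota> t) e = \<iota> (te t e)" for e using ghom_te[OF hom sG tG] by simp
  have gi: "gi (\<iota> x) = \<iota> (gi x)" if "x \<in> G" for x using ghom_gi[OF hom sG that] by simp
  have eq: "\<iota> x = \<iota> y \<longleftrightarrow> x = y" if "x \<in> G" "y \<in> G" for x y using inj that by (meson inj_onD)
  have mem: "\<iota> x \<in> \<iota> ` S \<longleftrightarrow> x \<in> S" if "x \<in> G" "S \<subseteq> G" for x S
    using eq that by (auto simp: image_iff subset_iff)
  have AG: "A e \<subseteq> G" for e using AH HG by blast
  note r = im te gi G_closed AHD ln
  show ?thesis
  proof
    show "sgrp (\<iota> ` G)" "sgrp (\<iota> ` H)" "\<And>e. sgrp (\<iota> ` A e)"
      using sgrp_image ghom_subset[OF hom] hom sG sH sA HG AG by blast+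
    show "\<iota> ` H \<subseteq> \<iota> ` G" "\<iota> t \<in> \<iota> ` G" "\<And>e. \<iota> ` A e \<subseteq> \<iota> ` H" using HG tG AH by blast+
    show "te (\<iota> t) (\<not> e) \<cdot> p \<cdot> te (\<iota> t) e \<in> \<iota> ` A (\<not> e)" if "p \<in> \<iota> ` A e" for p e
      using that At by (auto simp: r)
    show "L (inv_into G \<iota> g) = 0 \<longleftrightarrow> g \<in> \<iota> ` H" if g: "g \<in> \<iota> ` G" for g
    proof -
      obtain y where "y \<in> G" "g = \<iota> y" using g by blast
      then show ?thesis using ln0 by (simp add: ln mem[OF _ HG])
    qed
    show "\<exists>h\<in>\<iota> ` H. \<exists>e. \<exists>g'\<in>\<iota> ` G. g = h \<cdot> te (\<iota> t) e \<cdot> g' \<and> L (inv_into G \<iota> g') = n"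
      if g: "g \<in> \<iota> ` G" and n: "L (inv_into G \<iota> g) = Suc n" for g n
    proof -
      obtain y where y: "y \<in> G" "g = \<iota> y" "L y = Suc n" using g n by (auto simp: ln)
      obtain h e g' where "h \<in> H" "g' \<in> G" "y = h \<cdot> te t e \<cdot> g'" "L g' = n" using lnS[OF y(1,3)] by blast
      then show ?thesis using y by (auto simp: r intro!: bexI[of _ "\<iota> h"] exI[of _ e] bexI[of _ "\<iota> g'"])
    qed
    show "L (inv_into G \<iota> (h \<cdot> g)) = L (inv_into G \<iota> g)" if "h \<in> \<iota> ` H" "g \<in> \<iota> ` G" for h g
      using that by (auto simp: r lnH)
    show "L (inv_into G \<iota> (te (\<iota> t) e \<cdot> g)) = Suc (L (inv_into G \<iota> g)) \<or>
        L (inv_into G \<iota> g) = Suc (L (inv_into G \<iota> (te (\<iota> t) e \<cdot> g)))" if g: "g \<in> \<iota> ` G" for g e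
    proof -
      obtain y where y: "y \<in> G" "g = \<iota> y" using g by blast
      then show ?thesis using lnt[OF y(1), of e] by (simp add: r)
    qed
    fix h h' g g' e e'
    assume *: "h \<in> \<iota> ` H" "h' \<in> \<iota> ` H" "g \<in> \<iota> ` G" "g' \<in> \<iota> ` G"
    obtain k k' y y' where k: "k \<in> H" "h = \<iota> k" "k' \<in> H" "h' = \<iota> k'" "y \<in> G" "g = \<iota> y" "y' \<in> G" "g' = \<iota> y'"
      using * by blast
    assume "h \<cdot> te (\<iota> t) e \<cdot> g = h' \<cdot> te (\<iota> t) e' \<cdot> g'"
      "L (inv_into G \<iota> (te (\<iota> t) e \<cdot> g)) = Suc (L (inv_into G \<iota> g))"
      "L (inv_into G \<iota> (te (\<iota> t) e' \<cdot> g')) = Suc (L (inv_into G \<iota> g'))"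
    then have "e = e' \<and> gi k \<cdot> k' \<in> A e" using uniq[of k k' y y' e e'] k by (auto simp: r eq)
    then show "e = e' \<and> gi h \<cdot> h' \<in> \<iota> ` A e" using k by (auto simp: r)
  qed
qed

section \<open>Baumslag-Solitar groups\<close>

text \<open>\<open>step l m u v\<close> means that the relation \<open>b\<^sup>-\<^sup>1 a\<^sup>l b = a\<^sup>m\<close> turns \<open>a\<^sup>u\<close> into \<open>a\<^sup>v\<close>; \<open>scale l m p\<close> is its
  \<open>p\<close>-th iterate, \<open>p\<close> an integer, so \<open>v = u (m / l)\<^sup>p\<close> with divisibility conditions.\<close>
definition step :: "int \<Rightarrow> int \<Rightarrow> int \<Rightarrow> int \<Rightarrow> bool" where
  "step l m u v \<longleftrightarrow> (\<exists>j. u = l * j \<and> v = m * j)"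

definition scale :: "int \<Rightarrow> int \<Rightarrow> int \<Rightarrow> int \<Rightarrow> int \<Rightarrow> bool" where
  "scale l m p u v \<longleftrightarrow> (if p \<ge> 0 then (step l m ^^ nat p) u v else (step l m ^^ nat (- p)) v u)"

lemma step_inj: "m \<noteq> 0 \<Longrightarrow> step l m u w \<Longrightarrow> step l m v w \<Longrightarrow> u = v"
  and step_fun: "l \<noteq> 0 \<Longrightarrow> step l m w u \<Longrightarrow> step l m w v \<Longrightarrow> u = v"
  by (auto simp: step_def)

text \<open>For negative \<open>p\<close> the new step undoes the last of the reversed steps,
  because \<open>step\<close> is injective.\<close>

lemma scale_Suc:
  assumes "m \<noteq> 0" "step l m u w" "scale l m p w v" shows "scale l m (p + 1) u v"
proof (cases "p \<ge> 0")
  case True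
  then show ?thesis using assms relpowp_Suc_I2[of "step l m" u w "nat p" v]
    by (simp add: scale_def nat_add_distrib)
next
  case False
  define n where "n = nat (- p - 1)"
  have n: "nat (- p) = Suc n" using False by (simp add: n_def)
  then obtain w' where w': "(step l m ^^ n) v w'" "step l m w' w"
    using assms(3) False by (auto simp: scale_def)
  have "w' = u" by (rule step_inj[OF assms(1) w'(2) assms(2)])
  then show ?thesis using w' False by (cases "p = -1") (auto simp: scale_def n_def)
qed

lemma scale_pred:
  assumes "l \<noteq> 0" "step l m w u" "scale l m p w v" shows "scale l m (p - 1) u v"
proof (cases "p > 0")
  case True
  define n where "n = nat (p - 1)"
  have n: "nat p = Suc n" using True by (simp add: n_def)
  have "(step l m ^^ Suc n) w v" using assms(3) True n by (simp add: scale_def)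
  then obtain w' where w': "step l m w w'" "(step l m ^^ n) w' v"
    by (rule relpowp_Suc_E2)
  have "w' = u" by (rule step_fun[OF assms(1) w'(1) assms(2)])
  then show ?thesis using w' True by (simp add: scale_def n_def)
next
  case False
  have "(step l m ^^ nat (- p)) v w" using assms(3) False by (cases "p = 0") (auto simp: scale_def)
  then have "(step l m ^^ Suc (nat (- p))) v u" using assms(2) by auto
  then show ?thesis using False by (simp add: scale_def Suc_nat_eq_nat_zadd1)
qed

lemma scale_0 [simp]: "scale l m 0 u v \<longleftrightarrow> u = v"
  by (auto simp: scale_def)

lemma steps_eq: "(step l m ^^ n) u v \<Longrightarrow> u * m ^ n = v * l ^ n"
proof (induction n arbitrary: v)
  case (Suc n)
  then obtain w where "(step l m ^^ n) u w" "step l m w v" by auto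
  then obtain j where "(step l m ^^ n) u (l * j)" "v = m * j" by (auto simp: step_def[of l m w])
  then show ?case using Suc.IH[of "l * j"] by (simp add: algebra_simps)
qed simp

text \<open>\<open>\<tau>\<close> is the exponent sum in \<open>b\<close>. It vanishes on conjugates
  of powers of \<open>a\<close> and recovers the exponent on conjugates of powers of
  \<open>b\<close>.\<close>

locale bs = hnn G "cyc a" b A ln
  for G :: "'g::grp set" and a b :: 'g and A :: "bool \<Rightarrow> 'g set" and ln :: "'g \<Rightarrow> nat" +
  fixes l m :: int and \<tau> :: "'g \<Rightarrow> int"
  assumes l0: "l \<noteq> 0" and m0: "m \<noteq> 0"
    and AT: "A True = cyc (a \<up> l)" and AF: "A False = cyc (a \<up> m)"
    and rel: "gi b \<cdot> (a \<up> l) \<cdot> b = a \<up> m"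
    and a_inf: "a \<up> i = ge \<Longrightarrow> i = 0"
    and \<tau>_hom: "ghom G \<tau>" and \<tau>_a: "\<tau> a = 0" and \<tau>_b: "\<tau> b = 1"
begin

lemma aG: "a \<up> i \<in> G"
  using HGD by blast

lemma bG: "b \<up> i \<in> G"
  by (rule sgrp_pw[OF sG tG])

lemma a_inj: "a \<up> i = a \<up> j \<longleftrightarrow> i = j"
proof
  assume "a \<up> i = a \<up> j"
  then have "a \<up> (i - j) = ge" using pw_add[of a "i - j" j] by simp
  then show "i = j" using a_inf by fastforce
qed simp

lemma \<tau>_gm: "x \<in> G \<Longrightarrow> y \<in> G \<Longrightarrow> \<tau> (x \<cdot> y) = \<tau> x + \<tau> y"
  using ghom_gm[OF \<tau>_hom] by (simp add: int_grp)

lemma \<tau>_gi: "x \<in> G \<Longrightarrow> \<tau> (gi x) = - \<tau> x"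
  using ghom_gi[OF \<tau>_hom sG] by (simp add: int_grp)

lemma \<tau>_apw: "\<tau> (a \<up> i) = 0"
  using ghom_pw[OF \<tau>_hom sG aG[of 1], of i] by (simp add: \<tau>_a pw_int)

lemma \<tau>_bpw: "\<tau> (b \<up> i) = i"
  using ghom_pw[OF \<tau>_hom sG tG, of i] by (simp add: \<tau>_b pw_int)

lemma \<tau>_conj: "g \<in> G \<Longrightarrow> x \<in> G \<Longrightarrow> \<tau> (gi g \<cdot> x \<cdot> g) = \<tau> x"
  by (simp add: \<tau>_gm \<tau>_gi G_closed)

lemma b_inj: "b \<up> i = b \<up> j \<longleftrightarrow> i = j"
  using \<tau>_bpw by metis

lemma rel_pw: "gi b \<cdot> (a \<up> (l * j)) \<cdot> b = a \<up> (m * j)"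
  using pw_conj[of b "a \<up> l" j] by (simp add: rel pw_pw)

lemma rel_pw': "b \<cdot> (a \<up> (m * j)) \<cdot> gi b = a \<up> (l * j)"
  by (simp flip: rel_pw)

lemma a_in_A: "a \<up> u \<in> A True \<longleftrightarrow> l dvd u" "a \<up> u \<in> A False \<longleftrightarrow> m dvd u"
  by (auto simp: AT AF pw_pw a_inj cyc_def image_iff dvd_def)

text \<open>By \<open>conj_A\<close> the current power of \<open>a\<close> must be able to pass each
  letter of \<open>g\<close>, one step forwards for \<open>b\<close> and one backwards for its
  inverse. Opposite steps cancel, which leaves the exponent sum.\<close>

lemma conj_scale: "g \<in> G \<Longrightarrow> gi g \<cdot> (a \<up> u) \<cdot> g = a \<up> v \<Longrightarrow> scale l m (\<tau> g) u v"
proof (induction "ln g" arbitrary: g u)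
  case 0
  then obtain i where g: "g = a \<up> i" using ln0 by (auto elim: cycE)
  have "a \<up> u = a \<up> v" using 0(3) by (simp add: g flip: pw_add pw_minus)
  then show ?case by (simp add: g \<tau>_apw a_inj)
next
  case (Suc n)
  have n0: "ln g \<noteq> 0" using Suc(2) by simp
  obtain h e g' where g: "h \<in> cyc a" "g' \<in> G" "g = h \<cdot> te b e \<cdot> g'" "full e g'" "ln g = Suc (ln g')"
    using decomp[OF Suc(3) n0] .
  obtain i where h: "h = a \<up> i" using g(1) by (auto elim: cycE)
  have c: "gi h \<cdot> (a \<up> u) \<cdot> h = a \<up> u" by (simp add: h flip: pw_add pw_minus)
  have "gi g \<cdot> (a \<up> u) \<cdot> g \<in> cyc a" using Suc by simp
  then have uA: "a \<up> u \<in> A e" using conj_A[OF g(1,2,4), of "a \<up> u"] c by (simp add: g(3))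
  have eq: "gi g' \<cdot> (te b (\<not> e) \<cdot> (a \<up> u) \<cdot> te b e) \<cdot> g' = a \<up> v"
    using Suc(4) c by (simp add: g(3) gi_te) (metis gm_assoc)
  have \<tau>g: "\<tau> g = \<tau> (te b e) + \<tau> g'"
    using g \<tau>_apw[of i] by (simp add: \<tau>_gm G_closed h aG)
  show ?case
  proof (cases e)
    case True
    then obtain j where j: "u = l * j" using uA a_in_A by auto
    have "scale l m (\<tau> g') (m * j) v"
      using Suc(1)[of g' "m * j"] g Suc(2) eq True by (simp add: j) (metis gm_assoc rel_pw)
    then show ?thesis using scale_Suc[OF m0, of l u "m * j" "\<tau> g'" v] True
      by (auto simp: \<tau>g \<tau>_b step_def j add.commute)
  next
    case False
    then obtain j where j: "u = m * j" using uA a_in_A by auto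
    have "scale l m (\<tau> g') (l * j) v"
      using Suc(1)[of g' "l * j"] g Suc(2) eq False by (simp add: j) (metis gm_assoc rel_pw')
    then show ?thesis using scale_pred[OF l0, of m "l * j" u "\<tau> g'" v] False
      by (auto simp: \<tau>g \<tau>_b \<tau>_gi tG step_def j)
  qed
qed

lemma ln_npw_b: "h \<in> G \<Longrightarrow> full True h \<Longrightarrow> ln (npw b n \<cdot> h) = n + ln h \<and> full True (npw b n \<cdot> h)"
proof (induction n)
  case (Suc n)
  have G: "npw b n \<cdot> h \<in> G" using Suc by (simp add: G_closed sgrp_npw[OF sG tG])
  have "full True (ge \<cdot> te b True \<cdot> (npw b n \<cdot> h))"
    using full_step[OF H_closed(3) G, of True True] Suc by simp
  then show ?case using Suc by (simp add: full_def)
qed simp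

text \<open>Choose \<open>h\<close> shortest modulo left powers of \<open>b\<close>. Then \<open>b\<^sup>n h\<close> is reduced as written and starts with \<open>b\<close>,
  hence so does \<open>h\<close>, unless \<open>h\<close> is a power of \<open>a\<close>.\<close>
lemma centralizer_b_aux:
  "h \<in> G \<Longrightarrow> npw b (Suc n) \<cdot> h = h \<cdot> npw b (Suc n) \<Longrightarrow> \<exists>u v. h = (b \<up> u) \<cdot> (a \<up> v)"
proof (induction "ln h" arbitrary: h rule: less_induct)
  case less
  let ?B = "npw b (Suc n)"
  have BG: "?B \<in> G" by (rule sgrp_npw[OF sG tG])
  show ?case
  proof (cases "ln h = 0")
    case True
    then obtain v where "h = (b \<up> 0) \<cdot> (a \<up> v)" using ln0 less(2) by (auto elim: cycE)
    then show ?thesis by blast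
  next
    case False
    obtain c e g where h: "c \<in> cyc a" "g \<in> G" "h = c \<cdot> te b e \<cdot> g" "full e g" "ln h = Suc (ln g)"
      using decomp[OF less(2) False] .
    have "\<exists>s. ln ((b \<up> s) \<cdot> h) < ln h"
    proof (rule ccontr)
      assume no: "\<nexists>s. ln ((b \<up> s) \<cdot> h) < ln h"
      have "\<not> ln (b \<cdot> h) < ln h" "\<not> ln (gi b \<cdot> h) < ln h"
        using no pw_1[of b] pw_minus[of b 1] by metis+
      then have f: "full True h" "full False h"
        using lnt[OF less(2), of True] lnt[OF less(2), of False] by (auto simp: full_def)
      have Bh: "ln (?B \<cdot> h) = Suc n + ln h" using ln_npw_b[OF less(2) f(1)] by blast
      have lB: "ln ?B = Suc n" using ln_npw_b[OF G_closed(5) full_ge, of "Suc n"] by simp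
      have gB: "g \<cdot> ?B \<in> G" using h(2) BG by (simp add: G_closed)
      have "ln (g \<cdot> ?B) \<le> ln g + Suc n" using ln_gm_le[OF h(2) BG] lB by simp
      moreover have "ln (c \<cdot> te b e \<cdot> (g \<cdot> ?B)) = Suc n + ln h"
        using Bh less(3) by (simp add: h(3))
      then have "ln (te b e \<cdot> (g \<cdot> ?B)) = Suc n + ln h"
        using lnH[OF h(1), of "te b e \<cdot> (g \<cdot> ?B)"] gB by (simp add: G_closed del: npw.simps)
      ultimately have fg: "ln (te b e \<cdot> (g \<cdot> ?B)) = Suc (ln (g \<cdot> ?B))"
        using ln_te_le[OF gB, of e] h(5) by linarith
      have nG: "npw b n \<cdot> h \<in> G" using less(2) by (simp add: G_closed sgrp_npw[OF sG tG])
      have "ge \<cdot> te b True \<cdot> (npw b n \<cdot> h) = c \<cdot> te b e \<cdot> (g \<cdot> ?B)"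
        using less(3) by (simp add: h(3))
      from uniq[OF H_closed(3) h(1) nG gB this _ fg] ln_npw_b[OF less(2) f(1), of n]
      \<comment> \<open>So \<open>h\<close> itself begins with \<open>b\<close>, and removing this
        letter shortens \<open>h\<close>, contrary to \<open>f(2)\<close>.\<close>
      have e: "e = True" "c \<in> A True" by (auto simp: full_def)
      then have "gi b \<cdot> h = (te b (\<not> True) \<cdot> c \<cdot> te b True) \<cdot> g" by (simp add: h(3))
      then have "ln (gi b \<cdot> h) = ln g" using lnH[OF pinch[OF e(2)] h(2)] by simp
      then show False using f(2) h(5) by (simp add: full_def)
    qed
    then obtain s where s: "ln ((b \<up> s) \<cdot> h) < ln h" by blast
    have G: "(b \<up> s) \<cdot> h \<in> G" using less(2) bG by (simp add: G_closed)
    have "?B = b \<up> int (Suc n)" by (simp only: pw_def nat_int) simp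
    then have "?B \<cdot> (b \<up> s) = (b \<up> s) \<cdot> ?B" using pw_comm by metis
    then have "?B \<cdot> (b \<up> s) \<cdot> h = (b \<up> s) \<cdot> h \<cdot> ?B" using less(3) by (metis gm_assoc)
    then obtain u v where uv: "(b \<up> s) \<cdot> h = (b \<up> u) \<cdot> (a \<up> v)" using less(1)[OF s G] by auto
    have "b \<up> u = (b \<up> s) \<cdot> (b \<up> (u - s))" using pw_add[of b s "u - s"] by simp
    then have "h = (b \<up> (u - s)) \<cdot> (a \<up> v)" using uv by simp
    then show ?thesis by blast
  qed
qed

text \<open>The exponent sum gives \<open>i = j\<close>. In
  \<open>h = (b \<up> u) \<cdot> (a \<up> v)\<close> the factor \<open>a \<up> v\<close> commutes
  with a nontrivial power of \<open>b\<close>, so \<open>conj_scale\<close> relates \<open>v\<close>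
  to itself by at least one step: \<open>m\<close> divides \<open>v\<close>, and \<open>v\<close> is
  0 or l and m have equal absolute value.\<close>

lemma centralizer_b:
  assumes h: "h \<in> G" and j: "j \<noteq> 0" and c: "gi h \<cdot> (b \<up> j) \<cdot> h = b \<up> i"
  obtains u v where "i = j" "h = (b \<up> u) \<cdot> (a \<up> v)" "v = 0 \<or> \<bar>l\<bar> = \<bar>m\<bar> \<and> m dvd v"
proof -
  have ij: "i = j" using \<tau>_conj[OF h bG, of j] by (simp add: c \<tau>_bpw)
  define n where "n = nat (\<bar>j\<bar> - 1)"
  have n: "int (Suc n) = \<bar>j\<bar>" using j by (simp add: n_def)
  have B: "npw b (Suc n) = b \<up> \<bar>j\<bar>" by (simp only: pw_def n[symmetric] nat_int) simp
  have 1: "(b \<up> j) \<cdot> h = h \<cdot> (b \<up> j)" using c unfolding ij gi_shift .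
  have com: "(b \<up> \<bar>j\<bar>) \<cdot> h = h \<cdot> (b \<up> \<bar>j\<bar>)"
  proof (cases "j \<ge> 0")
    case False
    have "gi (b \<up> j) \<cdot> h = h \<cdot> gi (b \<up> j)" using 1 by (simp add: gi_shift) (metis gm_assoc gi_right ge_right)
    then show ?thesis using False by (simp add: pw_minus)
  qed (use 1 in simp)
  then obtain u v where h': "h = (b \<up> u) \<cdot> (a \<up> v)"
    using centralizer_b_aux[OF h, of n] unfolding B by blast
  have "gi (b \<up> \<bar>j\<bar>) \<cdot> (a \<up> v) \<cdot> (b \<up> \<bar>j\<bar>) = a \<up> v"
    using com pw_comm[of b "\<bar>j\<bar>" u] unfolding gi_shift h' by (metis gm_assoc gm_left_cancel)
  from conj_scale[OF bG this] have s: "(step l m ^^ Suc n) v v"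
    using n by (simp add: \<tau>_bpw scale_def del: relpowp.simps flip: n) (metis nat_int of_nat_Suc)
  have "v = 0 \<or> \<bar>l\<bar> = \<bar>m\<bar> \<and> m dvd v"
  proof -
    have "m dvd v" using s by (auto simp: step_def)
    moreover have "v = 0 \<or> m ^ Suc n = l ^ Suc n" using steps_eq[OF s] by (simp del: power_Suc)
    moreover have "\<bar>l\<bar> = \<bar>m\<bar>" if "m ^ Suc n = l ^ Suc n"
    proof -
      have "\<bar>m\<bar> ^ Suc n = \<bar>l\<bar> ^ Suc n" using that by (metis power_abs)
      then show ?thesis by (metis abs_ge_zero power_inject_base)
    qed
    ultimately show ?thesis by blast
  qed
  then show ?thesis using that ij h' by blast
qed

end

lemma bs_transfer:
  fixes \<iota> :: "'a::grp \<Rightarrow> 'b::grp"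
  assumes "bs G a b A L l m \<tau>" and hom: "ghom G \<iota>" and inj: "inj_on \<iota> G"
  shows "bs (\<iota> ` G) (\<iota> a) (\<iota> b) (\<lambda>e. \<iota> ` A e) (\<lambda>g. L (inv_into G \<iota> g)) l m (\<lambda>g. \<tau> (inv_into G \<iota> g))"
proof -
  interpret bs G a b A L l m \<tau> by fact
  have pw: "\<iota> x \<up> i = \<iota> (x \<up> i)" if "x \<in> G" for x i using ghom_pw[OF hom sG that] by simp
  have a: "a \<in> G" using aG[of 1] by simp
  have cyc: "\<iota> ` cyc (a \<up> i) = cyc (\<iota> a \<up> i)" for i
    using pw[OF a] pw[OF aG] by (auto simp: cyc_def image_image)
  have cyc1: "\<iota> ` cyc a = cyc (\<iota> a)" using cyc[of 1] by simp
  have inv: "inv_into G \<iota> (\<iota> x) = x" if "x \<in> G" for x using inj that by simp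
  have im: "\<iota> x \<cdot> \<iota> y = \<iota> (x \<cdot> y)" if "x \<in> G" "y \<in> G" for x y using ghom_gm[OF hom that] by simp
  have gi: "gi (\<iota> x) = \<iota> (gi x)" if "x \<in> G" for x using ghom_gi[OF hom sG that] by simp
  show ?thesis
    unfolding bs_def bs_axioms_def
  proof (intro conjI allI impI)
    show "hnn (\<iota> ` G) (cyc (\<iota> a)) (\<iota> b) (\<lambda>e. \<iota> ` A e) (\<lambda>g. L (inv_into G \<iota> g))"
      using hnn_transfer[OF hnn_axioms hom inj] by (simp add: cyc1)
    show "\<iota> ` A True = cyc (\<iota> a \<up> l)" "\<iota> ` A False = cyc (\<iota> a \<up> m)" by (simp_all add: AT AF cyc)
    show "gi (\<iota> b) \<cdot> (\<iota> a \<up> l) \<cdot> \<iota> b = \<iota> a \<up> m"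
      using rel by (simp add: pw a im gi aG tG G_closed)
    show "i = 0" if "\<iota> a \<up> i = ge" for i
    proof -
      have "\<iota> (a \<up> i) = \<iota> ge" using that ghom_ge[OF hom sG] by (simp add: pw a)
      then have "a \<up> i = ge" using inj aG G_closed(5) by (meson inj_onD)
      then show ?thesis by (rule a_inf)
    qed
    show "ghom (\<iota> ` G) (\<lambda>g. \<tau> (inv_into G \<iota> g))"
      unfolding ghom_def by (auto simp: im inv G_closed ghom_gm[OF \<tau>_hom])
    show "\<tau> (inv_into G \<iota> (\<iota> a)) = 0" "\<tau> (inv_into G \<iota> (\<iota> b)) = 1" by (simp_all add: inv a tG \<tau>_a \<tau>_b)
  qed (fact l0 m0)+
qed

section \<open>Construction of BS(l,m) over the integers\<close>

definition bsA :: "int \<Rightarrow> int \<Rightarrow> bool \<Rightarrow> int set" where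
  "bsA l m e = range (\<lambda>j. (if e then l else m) * j)"

definition bsf :: "int \<Rightarrow> int \<Rightarrow> bool \<Rightarrow> int \<Rightarrow> int" where
  "bsf l m e u = (if e then u div l * m else u div m * l)"

lemma hnn_base_bs:
  assumes "l \<noteq> 0" "m \<noteq> 0" shows "hnn_base UNIV (bsA l m) (bsf l m)"
proof
  show "sgrp (UNIV :: int set)" by (simp add: sgrp_def)
  show "sgrp (bsA l m e)" for e
    unfolding sgrp_def bsA_def int_grp
    by (auto simp: image_iff simp flip: distrib_left) (metis mult_zero_right mult_minus_right)+
  show "bsf l m e p \<in> bsA l m (\<not> e)" if "p \<in> bsA l m e" for e p
    by (auto simp: bsf_def bsA_def)
  show "bsf l m e (p \<cdot> q) = bsf l m e p \<cdot> bsf l m e q" if "p \<in> bsA l m e" "q \<in> bsA l m e" for e p q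
    using that assms by (auto simp: bsf_def bsA_def int_grp algebra_simps simp flip: distrib_left)
  show "bsf l m (\<not> e) (bsf l m e p) = p" if "p \<in> bsA l m e" for e p
    using that assms by (auto simp: bsf_def bsA_def)
qed simp

type_synonym bsg = "((int \<times> bool) list \<times> int) sym"

definition BS :: "int \<Rightarrow> int \<Rightarrow> bsg set" where "BS l m = hnn_base.Gr UNIV (bsA l m) (bsf l m)"
definition BSa :: "int \<Rightarrow> int \<Rightarrow> bsg" where "BSa l m = hnn_base.hi UNIV (bsA l m) (bsf l m) 1"
definition BSb :: "int \<Rightarrow> int \<Rightarrow> bsg" where "BSb l m = hnn_base.tt UNIV (bsA l m)"

context
  fixes l m :: int
  assumes l0: "l \<noteq> 0" and m0: "m \<noteq> 0"
begin

interpretation hnn_base UNIV "bsA l m" "bsf l m"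
  by (rule hnn_base_bs[OF l0 m0])

lemma hi_eq: "hi i = BSa l m \<up> i"
  using ghom_pw[OF hi_hom sH, of 1 i] by (simp add: BSa_def pw_int)

lemma BS_universal:
  fixes \<alpha> \<beta> :: "'k::grp"
  assumes r: "gi \<beta> \<cdot> (\<alpha> \<up> l) \<cdot> \<beta> = \<alpha> \<up> m"
  obtains F where "ghom (BS l m) F" "F (BSa l m) = \<alpha>" "F (BSb l m) = \<beta>"
proof -
  have r1: "gi \<beta> \<cdot> (\<alpha> \<up> (l * j)) \<cdot> \<beta> = \<alpha> \<up> (m * j)" for j
    using pw_conj[of \<beta> "\<alpha> \<up> l" j] by (simp add: r pw_pw)
  have "\<exists>F. ghom Gr F \<and> (\<forall>h\<in>UNIV. F (hi h) = \<alpha> \<up> h) \<and> F tt = \<beta>"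
  proof (rule universal)
    show "ghom UNIV ((\<up>) \<alpha>)" by (simp add: ghom_def int_grp pw_add)
    show "(\<alpha> \<up> p) \<cdot> te \<beta> e = te \<beta> e \<cdot> (\<alpha> \<up> bsf l m e p)" if p: "p \<in> bsA l m e" for p e
    proof (cases e)
      case True
      then obtain j where "p = l * j" using p by (auto simp: bsA_def)
      then show ?thesis using True l0 r1[of j] by (simp add: bsf_def gi_shift mult.commute)
    next
      case False
      then obtain j where "p = m * j" using p by (auto simp: bsA_def)
      then show ?thesis using False m0 r1[of j, symmetric] by (simp add: bsf_def mult.commute)
    qed
  qed
  then obtain F where "ghom Gr F" "F (hi 1) = \<alpha> \<up> 1" "F tt = \<beta>" by blast
  then show ?thesis using that by (simp add: BS_def BSa_def BSb_def)
qed

lemma BS_least: "sgrp S \<Longrightarrow> BSa l m \<in> S \<Longrightarrow> BSb l m \<in> S \<Longrightarrow> BS l m \<subseteq> S"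
proof
  fix x assume S: "sgrp S" "BSa l m \<in> S" "BSb l m \<in> S" and "x \<in> BS l m"
  then have "x \<in> Gr" by (simp add: BS_def)
  then show "x \<in> S"
  proof (induction rule: Gr.induct)
    case Gr_ge then show ?case using sgrp_ge[OF S(1)] .
  next
    case (Gr_hi g h) then show ?case using S by (simp add: hi_eq sgrp_gm sgrp_pw)
  next
    case (Gr_te g e) then show ?case using S by (simp add: sgrp_gm sgrp_te flip: BSb_def)
  qed
qed

lemma bs_BS: "\<exists>A L \<tau>. bs (BS l m) (BSa l m) (BSb l m) A L l m \<tau>"
proof -
  have cyc: "range hi = cyc (BSa l m)" "hi ` bsA l m True = cyc (BSa l m \<up> l)" "hi ` bsA l m False = cyc (BSa l m \<up> m)"
    by (auto simp: bsA_def[of l m True] bsA_def[of l m False] hi_eq cyc_def pw_pw image_image)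
  obtain \<tau> :: "bsg \<Rightarrow> int" where \<tau>: "ghom (BS l m) \<tau>" "\<tau> (BSa l m) = 0" "\<tau> (BSb l m) = 1"
    by (rule BS_universal[of 1 0]) (auto simp: int_grp pw_int)
  have "bs (BS l m) (BSa l m) (BSb l m) (\<lambda>e. hi ` bsA l m e) len l m \<tau>"
    unfolding bs_def bs_axioms_def
  proof (intro conjI allI impI)
    show "hnn (BS l m) (cyc (BSa l m)) (BSb l m) (\<lambda>e. hi ` bsA l m e) len"
      using hnn_Gr by (simp add: cyc BS_def BSb_def)
    show "gi (BSb l m) \<cdot> (BSa l m \<up> l) \<cdot> BSb l m = BSa l m \<up> m"
      using tt_rel[of l True] l0 by (simp add: bsA_def bsf_def BSb_def gi_shift flip: hi_eq)
    show "i = 0" if "BSa l m \<up> i = ge" for i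
      using hi_inj that ghom_ge[OF hi_hom sH] by (simp add: inj_on_def int_grp flip: hi_eq)
  qed (use \<tau> l0 m0 cyc in auto)
  then show ?thesis by blast
qed

end

section \<open>The groups G(l,m;k) as HNN extensions\<close>

lemma steps_ge:
  fixes l m :: int
  assumes "l * m ^ n = m * l ^ n" "m > 0" "\<bar>l\<bar> > m" shows "n = 1"
proof (cases n)
  case 0
  then show ?thesis using assms by simp
next
  case (Suc j)
  then have "m ^ j = l ^ j" using assms by auto
  then have "m ^ j = \<bar>l\<bar> ^ j" using assms(2) by (metis abs_of_pos power_abs)
  then have "j = 0" using power_strict_mono[OF assms(3), of j] assms(2) by (cases "j = 0") auto
  then show ?thesis using Suc by simp
qed

text \<open>The hypothesis says (l/m)^p = l/m, and l/m has absolute value greater than 1.\<close>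

lemma scale_self:
  assumes s: "scale l m p (x * l) (x * m)" and "x \<noteq> 0" "m > 0" "\<bar>l\<bar> > m" shows "p = 1"
proof (cases "p \<ge> 0")
  case True
  then have "(x * l) * m ^ nat p = (x * m) * l ^ nat p" using s steps_eq by (simp add: scale_def)
  then have "l * m ^ nat p = m * l ^ nat p" using assms(2) by simp
  from steps_ge[OF this assms(3,4)] show ?thesis using True by simp
next
  case False
  then have "(x * m) * m ^ nat (- p) = (x * l) * l ^ nat (- p)" using s steps_eq by (simp add: scale_def)
  then have "m ^ Suc (nat (- p)) = l ^ Suc (nat (- p))" using assms(2) by simp
  then have "m ^ Suc (nat (- p)) = \<bar>l\<bar> ^ Suc (nat (- p))" using assms(3) by (metis abs_of_pos power_abs)
  then show ?thesis using power_strict_mono[OF assms(4), of "Suc (nat (- p))"] assms(3) by linarith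
qed

text \<open>Both levels at once: \<open>A1\<close> and \<open>L1\<close> belong to the inner
  extension with stable letter \<open>b\<close>, \<open>A\<close> and \<open>L\<close> to the outer
  one with stable letter \<open>t\<close>.\<close>

locale gbg = inner: bs H a b A1 L1 l m \<tau> + outer: hnn G H t A L
  for G H :: "'g::grp set" and a b t :: 'g and A1 A :: "bool \<Rightarrow> 'g set" and L1 L :: "'g \<Rightarrow> nat"
    and l m :: int and \<tau> :: "'g \<Rightarrow> int" +
  fixes k :: int
  assumes k0: "k \<noteq> 0" and AT: "A True = cyc (a \<up> k)" and AF: "A False = cyc b"
    and trel: "gi t \<cdot> (a \<up> k) \<cdot> t = b"
begin

lemma aG: "a \<up> i \<in> G" and bG: "b \<up> i \<in> G"
  using inner.aG inner.bG outer.HGD by blast+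

lemma trel_pw: "gi t \<cdot> (a \<up> (k * i)) \<cdot> t = b \<up> i"
  using pw_conj[of t "a \<up> k" i] by (simp add: trel pw_pw)

lemma t_notin_H: "t \<notin> H"
  using outer.full_ge[of True] outer.ln0[OF outer.tG] by (simp add: outer.full_def)

text \<open>In a cyclic group \<open>a \<up> k\<close> would equal its conjugate \<open>b\<close>,
  but their exponent sums are 0 and 1.\<close>

lemma not_generated_by_one: "\<not> G \<subseteq> cyc z"
proof
  assume "G \<subseteq> cyc z"
  then have "t \<in> cyc z" "a \<up> k \<in> cyc z" using outer.tG aG by auto
  then obtain i j where "t = z \<up> i" "a \<up> k = z \<up> j" by (auto elim!: cycE)
  then have "gi t \<cdot> (a \<up> k) \<cdot> t = a \<up> k" by (simp flip: pw_add pw_minus)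
  then have "a \<up> k = b" by (simp add: trel)
  then show False using inner.\<tau>_apw[of k] inner.\<tau>_b by simp
qed

end

locale gbg_big = gbg +
  assumes m_pos: "m > 0" and lm: "\<bar>l\<bar> > m"
begin

text \<open>Otherwise the first syllable of \<open>x\<close> lets a conjugate of
  \<open>b \<up> j\<close> pass. By the exponent sum it is the inverse of \<open>t\<close>, and by
  \<open>centralizer_b\<close> its coefficient is a power of \<open>b\<close>, so \<open>t\<close>
  would cancel against it.\<close>

lemma b_pw_conj_H:
  assumes x: "x \<in> G" "outer.full True x" and j: "j \<noteq> 0" and c: "gi x \<cdot> (b \<up> j) \<cdot> x \<in> H"
  shows "x \<in> H"
proof (rule ccontr)
  assume "x \<notin> H"
  then have "L x \<noteq> 0" using outer.ln0 x by blast
  from outer.decomp[OF x(1) this] obtain h e x' where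
    h: "h \<in> H" "x' \<in> G" "x = h \<cdot> te t e \<cdot> x'" "outer.full e x'" by metis
  have cA: "gi h \<cdot> (b \<up> j) \<cdot> h \<in> A e"
    using outer.conj_A[OF h(1,2,4) inner.bG[of j]] c by (simp add: h(3))
  have \<tau>: "\<tau> (gi h \<cdot> (b \<up> j) \<cdot> h) = j"
    using inner.\<tau>_conj[OF h(1) inner.bG[of j]] inner.\<tau>_bpw by simp
  show False
  proof (cases e)
    case True
    then obtain i where "gi h \<cdot> (b \<up> j) \<cdot> h = a \<up> i" using cA by (auto simp: AT pw_pw elim!: cycE)
    then show False using \<tau> j inner.\<tau>_apw by simp
  next
    case False
    then obtain i where i: "gi h \<cdot> (b \<up> j) \<cdot> h = b \<up> i" using cA by (auto simp: AF elim!: cycE)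
    obtain u v where "h = (b \<up> u) \<cdot> (a \<up> v)" "v = 0 \<or> \<bar>l\<bar> = \<bar>m\<bar> \<and> m dvd v"
      using inner.centralizer_b[OF h(1) j i] by metis
    then have "h \<in> A False" using lm m_pos by (auto simp: AF)
    then show False using outer.full_iff[OF h(1,2,4), of True] x(2) False h(3) by simp
  qed
qed

text \<open>A nontrivial power of \<open>a\<close> can pass only \<open>t\<close>, since the
  exponent sum forbids a conjugate in \<open>cyc b\<close>. Beyond \<open>t\<close> it has become a
  power of \<open>b\<close>, and \<open>b_pw_conj_H\<close> allows no second stable letter.\<close>

lemma a_pw_conj_H:
  assumes g: "g \<in> G" "g \<notin> H" and u: "u \<noteq> 0" and c: "gi g \<cdot> (a \<up> u) \<cdot> g \<in> H"
  obtains h g' i where "h \<in> H" "g' \<in> H" "g = h \<cdot> t \<cdot> g'" "i \<noteq> 0" "gi h \<cdot> (a \<up> u) \<cdot> h = a \<up> (k * i)"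
    "gi g \<cdot> (a \<up> u) \<cdot> g = gi g' \<cdot> (b \<up> i) \<cdot> g'"
proof -
  have "L g \<noteq> 0" using outer.ln0 g by blast
  from outer.decomp[OF g(1) this] obtain h e g' where
    h: "h \<in> H" "g' \<in> G" "g = h \<cdot> te t e \<cdot> g'" "outer.full e g'" by metis
  have cA: "gi h \<cdot> (a \<up> u) \<cdot> h \<in> A e"
    using outer.conj_A[OF h(1,2,4) inner.aG[of u]] c by (simp add: h(3))
  have \<tau>: "\<tau> (gi h \<cdot> (a \<up> u) \<cdot> h) = 0"
    using inner.\<tau>_conj[OF h(1) inner.aG[of u]] inner.\<tau>_apw by simp
  have ne: "gi h \<cdot> (a \<up> u) \<cdot> h \<noteq> ge" using u inner.a_inf unfolding conj_swap by auto
  have e: e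
  proof (rule ccontr)
    assume "\<not> e"
    then obtain i where i: "gi h \<cdot> (a \<up> u) \<cdot> h = b \<up> i" using cA by (auto simp: AF elim!: cycE)
    then show False using \<tau> ne inner.\<tau>_bpw by simp
  qed
  then obtain i where i: "gi h \<cdot> (a \<up> u) \<cdot> h = a \<up> (k * i)" using cA by (auto simp: AT pw_pw elim!: cycE)
  have i0: "i \<noteq> 0" using ne i by auto
  have "gi g \<cdot> (a \<up> u) \<cdot> g = gi g' \<cdot> (gi t \<cdot> (gi h \<cdot> (a \<up> u) \<cdot> h) \<cdot> t) \<cdot> g'" using e by (simp add: h(3))
  also have "\<dots> = gi g' \<cdot> (b \<up> i) \<cdot> g'" unfolding i trel_pw ..
  finally have eq: "gi g \<cdot> (a \<up> u) \<cdot> g = gi g' \<cdot> (b \<up> i) \<cdot> g'" .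
  have "g' \<in> H" using b_pw_conj_H[OF h(2) _ i0] h(4) c e eq by simp
  then show ?thesis using that[OF h(1) _ _ i0 i eq] h(3) e by simp
qed

text \<open>Outside \<open>H\<close> the result would be conjugate in \<open>H\<close> to a
  nontrivial power of \<open>b\<close>, which has nonzero exponent sum.\<close>

lemma a_pw_conj_a:
  assumes g: "g \<in> G" and u: "u \<noteq> 0" and c: "gi g \<cdot> (a \<up> u) \<cdot> g = a \<up> v"
  shows "g \<in> H"
proof (rule ccontr)
  assume "g \<notin> H"
  moreover have "gi g \<cdot> (a \<up> u) \<cdot> g \<in> H" using c inner.aG by simp
  ultimately obtain g' i where "g' \<in> H" "i \<noteq> 0" "a \<up> v = gi g' \<cdot> (b \<up> i) \<cdot> g'"
    using a_pw_conj_H[OF g _ u] c by metis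
  then show False
    using inner.\<tau>_conj[of g' "b \<up> i"] inner.bG[of i] inner.\<tau>_bpw inner.\<tau>_apw[of v] by simp
qed

text \<open>After \<open>C\<close> is conjugated into \<open>H\<close>, a conjugator inside
  \<open>H\<close> is handled by the length argument in BS(l,m). If it lies outside, a conjugate
  \<open>D\<close> of \<open>C\<close> has its \<open>l\<close>-th power in an associated subgroup:
  a power of \<open>a\<close> makes \<open>D\<close> elliptic as a root, and a nontrivial power of
  \<open>b\<close> is centralised by \<open>D\<close>, so that \<open>D\<close> is a power of
  \<open>b\<close>, which \<open>t\<close> conjugates to a power of \<open>a\<close>.\<close>

lemma conj_into_a:
  assumes C: "C \<in> G" and B: "B \<in> G" and r: "gi B \<cdot> (C \<up> l) \<cdot> B = C \<up> m"
  obtains g x where "g \<in> G" "gi g \<cdot> C \<cdot> g = a \<up> x"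
proof -
  have l0: "l \<noteq> 0" using lm m_pos by auto
  have lm': "\<bar>l\<bar> > \<bar>m\<bar>" using lm m_pos by simp
  obtain y where y: "y \<in> G" "gi y \<cdot> C \<cdot> y \<in> H" using outer.conj_pw_elliptic[OF C B r lm'] .
  define C1 where "C1 = gi y \<cdot> C \<cdot> y"
  define B1 where "B1 = gi y \<cdot> B \<cdot> y"
  have C1: "C1 \<in> H" and B1: "B1 \<in> G" using y B by (simp_all add: C1_def B1_def outer.G_closed)
  have r1: "gi B1 \<cdot> (C1 \<up> l) \<cdot> B1 = C1 \<up> m"
    unfolding C1_def B1_def pw_conj r[symmetric] by simp
  have *: "\<exists>g\<in>G. \<exists>x. gi g \<cdot> C1 \<cdot> g = a \<up> x"
  proof (cases "B1 \<in> H")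
    case True
    obtain z where "z \<in> H" "gi z \<cdot> C1 \<cdot> z \<in> cyc a"
      using inner.conj_pw_elliptic[OF C1 True r1 lm'] .
    then show ?thesis using outer.HGD by (auto elim!: cycE)
  next
    case False
    then have "L B1 \<noteq> 0" using outer.ln0 B1 by blast
    from outer.decomp[OF B1 this] obtain h e z where
      h: "h \<in> H" "z \<in> G" "B1 = h \<cdot> te t e \<cdot> z" "outer.full e z" by metis
    define D where "D = gi h \<cdot> C1 \<cdot> h"
    have D: "D \<in> H" using h C1 by (simp add: D_def outer.H_closed)
    have "gi B1 \<cdot> (C1 \<up> l) \<cdot> B1 \<in> H" unfolding r1 by (rule sgrp_pw[OF outer.sH C1])
    then have DA: "D \<up> l \<in> A e"
      using outer.conj_A[OF h(1,2,4) sgrp_pw[OF outer.sH C1]] by (simp add: D_def pw_conj h(3))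
    have elliptic: "\<exists>g\<in>G. \<exists>x. gi g \<cdot> D \<cdot> g = a \<up> x" if "D \<up> l \<in> cyc a"
    proof -
      have "gi ge \<cdot> (D \<up> l) \<cdot> ge \<in> cyc a" using that by simp
      from inner.root_elliptic[OF D inner.G_closed(5) l0 this]
      obtain z where "z \<in> H" "gi z \<cdot> D \<cdot> z \<in> cyc a" .
      then show ?thesis using outer.HGD by (auto elim!: cycE)
    qed
    have "\<exists>g\<in>G. \<exists>x. gi g \<cdot> D \<cdot> g = a \<up> x"
    proof (cases e)
      case True
      then show ?thesis using DA elliptic by (auto simp: AT pw_pw elim!: cycE)
    next
      case False
      then obtain j where j: "D \<up> l = b \<up> j" using DA by (auto simp: AF elim!: cycE)
      show ?thesis
      proof (cases "j = 0")
        case True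
        then show ?thesis using elliptic j cycI[of a 0] by simp
      next
        case j0: False
        have "gi D \<cdot> (b \<up> j) \<cdot> D = b \<up> j" unfolding j[symmetric] gi_shift
          using commute_pw[of D D l] by simp
        from inner.centralizer_b[OF D j0 this] obtain u v where
          "D = (b \<up> u) \<cdot> (a \<up> v)" "v = 0 \<or> \<bar>l\<bar> = \<bar>m\<bar> \<and> m dvd v" by metis
        then have "D = b \<up> u" using lm m_pos by auto
        then have "gi (gi t) \<cdot> D \<cdot> gi t = a \<up> (k * u)" by (simp flip: trel_pw)
        then show ?thesis using outer.tG outer.G_closed by blast
      qed
    qed
    then obtain g x where g: "g \<in> G" "gi g \<cdot> D \<cdot> g = a \<up> x" by blast
    then have "gi (h \<cdot> g) \<cdot> C1 \<cdot> (h \<cdot> g) = a \<up> x" by (simp add: D_def)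
    moreover have "h \<cdot> g \<in> G" using g h by (simp add: outer.G_closed)
    ultimately show ?thesis by blast
  qed
  then obtain g x where g: "g \<in> G" "gi g \<cdot> C1 \<cdot> g = a \<up> x" by blast
  then have "gi (y \<cdot> g) \<cdot> C \<cdot> (y \<cdot> g) = a \<up> x" by (simp add: C1_def)
  moreover have "y \<cdot> g \<in> G" using g y by (simp add: outer.G_closed)
  ultimately show ?thesis using that by blast
qed

text \<open>If \<open>T2\<close> lay in \<open>H\<close>, a conjugate of \<open>H\<close> would
  contain both generators and hence \<open>G\<close>, although \<open>t\<close> is not in
  \<open>H\<close>. So \<open>a_pw_conj_H\<close> applies to \<open>T2\<close>, and it remains to
  see that the power of \<open>b\<close> which it yields is \<open>b\<close> itself.\<close>

lemma generating_pair:
  assumes C: "C \<in> G" and T: "T \<in> G" and K: "K \<noteq> 0"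
    and gen: "\<And>S. sgrp S \<Longrightarrow> C \<in> S \<Longrightarrow> T \<in> S \<Longrightarrow> G \<subseteq> S"
    and r: "gi (gi T \<cdot> (C \<up> K) \<cdot> T) \<cdot> (C \<up> l) \<cdot> (gi T \<cdot> (C \<up> K) \<cdot> T) = C \<up> m"
  obtains g x p where "g \<in> G" "gi g \<cdot> C \<cdot> g = a \<up> x" "scale l m p (x * K) k"
proof -
  define B where "B = gi T \<cdot> (C \<up> K) \<cdot> T"
  have B: "B \<in> G" using C T by (simp add: B_def outer.G_closed sgrp_pw[OF outer.sG])
  obtain g x where g: "g \<in> G" "gi g \<cdot> C \<cdot> g = a \<up> x"
    using conj_into_a[OF C B] r by (auto simp: B_def)
  define T2 where "T2 = gi g \<cdot> T \<cdot> g"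
  define B2 where "B2 = gi g \<cdot> B \<cdot> g"
  have T2: "T2 \<in> G" and B2: "B2 \<in> G" using g T B by (simp_all add: T2_def B2_def outer.G_closed)
  have ax: "a \<up> (x * i) = gi g \<cdot> (C \<up> i) \<cdot> g" for i
    using pw_conj[of g C i] by (simp add: g(2) pw_pw)
  have B2_eq: "B2 = gi T2 \<cdot> (a \<up> (x * K)) \<cdot> T2" unfolding ax by (simp add: B2_def B_def T2_def)
  have r2: "gi B2 \<cdot> (a \<up> (x * l)) \<cdot> B2 = a \<up> (x * m)"
    unfolding ax r[folded B_def, symmetric] by (simp add: B2_def)
  have T2H: "T2 \<notin> H"
  proof
    assume "T2 \<in> H"
    define S where "S = (\<lambda>z. g \<cdot> z \<cdot> gi g) ` H"
    have "ghom H (\<lambda>z. g \<cdot> z \<cdot> gi g)" by (simp add: ghom_def)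
    then have "sgrp S" unfolding S_def by (rule sgrp_image) (rule outer.sH)
    moreover have "C \<in> S" using g(2) inner.aG[of x] unfolding S_def conj_swap by blast
    moreover have "T = g \<cdot> T2 \<cdot> gi g" by (simp add: T2_def)
    then have "T \<in> S" using \<open>T2 \<in> H\<close> by (simp add: S_def)
    ultimately have "G \<subseteq> S" by (rule gen)
    moreover have "g \<cdot> t \<cdot> gi g \<in> G" using g outer.tG by (simp add: outer.G_closed)
    ultimately obtain z where "z \<in> H" "g \<cdot> t \<cdot> gi g = g \<cdot> z \<cdot> gi g" by (auto simp: S_def)
    then show False using t_notin_H by simp
  qed
  have x0: "x \<noteq> 0"
  proof
    assume "x = 0"
    then have "C = ge" using g(2) unfolding conj_swap by simp
    then have "C \<in> cyc T" using cycI[of T 0] by simp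
    moreover have "T \<in> cyc T" using cycI[of T 1] by simp
    ultimately show False using gen[OF sgrp_cyc] not_generated_by_one by blast
  qed
  have "x * l \<noteq> 0" "x * K \<noteq> 0" using x0 lm m_pos K by auto
  have B2H: "B2 \<in> H" using a_pw_conj_a[OF B2 \<open>x * l \<noteq> 0\<close> r2] .
  then obtain h g' i where h: "h \<in> H" "g' \<in> H" "gi h \<cdot> (a \<up> (x * K)) \<cdot> h = a \<up> (k * i)" "B2 = gi g' \<cdot> (b \<up> i) \<cdot> g'"
    using a_pw_conj_H[OF T2 T2H \<open>x * K \<noteq> 0\<close>] B2_eq by metis
  \<comment> \<open>\<open>B2\<close> conjugates \<open>a \<up> (x * l)\<close> to
    \<open>a \<up> (x * m)\<close>, which fixes its exponent sum as 1.\<close>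
  have "\<tau> B2 = i" using inner.\<tau>_conj[OF h(2) inner.bG[of i]] h(4) inner.\<tau>_bpw by simp
  then have "scale l m i (x * l) (x * m)" using inner.conj_scale[OF B2H r2] by simp
  then have "i = 1" using scale_self x0 m_pos lm by blast
  then have "scale l m (\<tau> h) (x * K) k" using inner.conj_scale[OF h(1)] h(3) by simp
  then show ?thesis using that g by blast
qed

end

section \<open>Construction of G(l,m;k) over BS(l,m)\<close>

definition gA :: "int \<Rightarrow> int \<Rightarrow> int \<Rightarrow> bool \<Rightarrow> bsg set" where
  "gA l m k e = (if e then cyc (BSa l m \<up> k) else cyc (BSb l m))"

text \<open>The descriptions are proper for nonzero parameters, because \<open>a\<close> and
  \<open>b\<close> have infinite order; see \<open>gf_simps\<close>.\<close>

definition gf :: "int \<Rightarrow> int \<Rightarrow> int \<Rightarrow> bool \<Rightarrow> bsg \<Rightarrow> bsg" where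
  "gf l m k e p = (if e then BSb l m \<up> (THE i. p = BSa l m \<up> (k * i))
     else BSa l m \<up> (k * (THE i. p = BSb l m \<up> i)))"

type_synonym gg = "((bsg \<times> bool) list \<times> bsg) sym"

definition GG :: "int \<Rightarrow> int \<Rightarrow> int \<Rightarrow> gg set" where "GG l m k = hnn_base.Gr (BS l m) (gA l m k) (gf l m k)"
definition GGa :: "int \<Rightarrow> int \<Rightarrow> int \<Rightarrow> gg" where "GGa l m k = hnn_base.hi (BS l m) (gA l m k) (gf l m k) (BSa l m)"
definition GGt :: "int \<Rightarrow> int \<Rightarrow> int \<Rightarrow> gg" where "GGt l m k = hnn_base.tt (BS l m) (gA l m k)"

definition relG :: "int \<Rightarrow> int \<Rightarrow> int \<Rightarrow> 'k::grp \<Rightarrow> 'k \<Rightarrow> bool" where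
  "relG l m k \<alpha> \<tau> \<longleftrightarrow> gi (gi \<tau> \<cdot> (\<alpha> \<up> k) \<cdot> \<tau>) \<cdot> (\<alpha> \<up> l) \<cdot> (gi \<tau> \<cdot> (\<alpha> \<up> k) \<cdot> \<tau>) = \<alpha> \<up> m"

context
  fixes l m k :: int
  assumes l0: "l \<noteq> 0" and m0: "m \<noteq> 0" and k0: "k \<noteq> 0"
begin

lemma gf_simps: "gf l m k True (BSa l m \<up> (k * i)) = BSb l m \<up> i"
  "gf l m k False (BSb l m \<up> i) = BSa l m \<up> (k * i)"
proof -
  obtain A L \<tau> where "bs (BS l m) (BSa l m) (BSb l m) A L l m \<tau>" using bs_BS[OF l0 m0] by blast
  then interpret bs "BS l m" "BSa l m" "BSb l m" A L l m \<tau> .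
  show "gf l m k True (BSa l m \<up> (k * i)) = BSb l m \<up> i"
    "gf l m k False (BSb l m \<up> i) = BSa l m \<up> (k * i)"
    using k0 by (simp_all add: gf_def a_inj b_inj)
qed

lemma hnn_base_GG: "hnn_base (BS l m) (gA l m k) (gf l m k)"
proof -
  obtain A L \<tau> where "bs (BS l m) (BSa l m) (BSb l m) A L l m \<tau>" using bs_BS[OF l0 m0] by blast
  then interpret bs "BS l m" "BSa l m" "BSb l m" A L l m \<tau> .
  have gA: "gA l m k True = range (\<lambda>i. BSa l m \<up> (k * i))" "gA l m k False = range (\<lambda>i. BSb l m \<up> i)"
    by (simp_all add: gA_def cyc_def pw_pw)
  show ?thesis
  proof
    show "sgrp (BS l m)" by (rule sG)
    show "sgrp (gA l m k e)" for e by (simp add: gA_def sgrp_cyc)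
    show "gA l m k e \<subseteq> BS l m" for e
      using aG bG by (cases e) (auto simp: gA)
    show "gf l m k e p \<in> gA l m k (\<not> e)" if "p \<in> gA l m k e" for e p
      using that by (cases e) (auto simp: gA gf_simps)
    show "gf l m k (\<not> e) (gf l m k e p) = p" if "p \<in> gA l m k e" for e p
      using that by (cases e) (auto simp: gA gf_simps)
    show "gf l m k e (p \<cdot> q) = gf l m k e p \<cdot> gf l m k e q" if "p \<in> gA l m k e" "q \<in> gA l m k e" for e p q
      using that by (cases e) (auto simp: gA gf_simps simp flip: pw_add distrib_left)
  qed
qed

interpretation hnn_base "BS l m" "gA l m k" "gf l m k"
  by (rule hnn_base_GG)

lemma BSa_in: "BSa l m \<in> BS l m" and BSb_in: "BSb l m \<in> BS l m"
proof -
  obtain A L \<tau> where "bs (BS l m) (BSa l m) (BSb l m) A L l m \<tau>" using bs_BS[OF l0 m0] by blast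
  then interpret bs "BS l m" "BSa l m" "BSb l m" A L l m \<tau> .
  show "BSa l m \<in> BS l m" "BSb l m \<in> BS l m" using aG[of 1] tG by simp_all
qed

lemma hi_apw: "hi (BSa l m \<up> i) = GGa l m k \<up> i"
  using ghom_pw[OF hi_hom sH BSa_in] by (simp add: GGa_def)

lemma hi_bpw: "hi (BSb l m \<up> i) = hi (BSb l m) \<up> i"
  using ghom_pw[OF hi_hom sH BSb_in] by simp

lemma GG_b: "gi (GGt l m k) \<cdot> (GGa l m k \<up> k) \<cdot> GGt l m k = hi (BSb l m)"
proof -
  have "hi (BSa l m \<up> k) \<cdot> te tt True = te tt True \<cdot> hi (gf l m k True (BSa l m \<up> k))"
    by (rule tt_rel) (use cycI[of "BSa l m \<up> k" 1] in \<open>simp add: gA_def\<close>)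
  then show ?thesis using gf_simps(1)[of 1] by (simp add: hi_apw GGt_def gi_shift)
qed

lemma GG_gbg: "\<exists>H A1 A L1 L \<tau>. gbg (GG l m k) H (GGa l m k) (gi (GGt l m k) \<cdot> (GGa l m k \<up> k) \<cdot> GGt l m k) (GGt l m k) A1 A L1 L l m \<tau> k"
proof -
  obtain A1 L1 \<tau> where bs: "bs (BS l m) (BSa l m) (BSb l m) A1 L1 l m \<tau>" using bs_BS[OF l0 m0] by blast
  have "bs (hi ` BS l m) (hi (BSa l m)) (hi (BSb l m)) (\<lambda>e. hi ` A1 e) (\<lambda>g. L1 (inv_into (BS l m) hi g)) l m (\<lambda>g. \<tau> (inv_into (BS l m) hi g))"
    by (rule bs_transfer[OF bs hi_hom hi_inj])
  moreover have "hnn (GG l m k) (hi ` BS l m) (GGt l m k) (\<lambda>e. hi ` gA l m k e) len"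
    using hnn_Gr by (simp add: GG_def GGt_def)
  moreover have "hi ` gA l m k True = cyc (GGa l m k \<up> k)" "hi ` gA l m k False = cyc (hi (BSb l m))"
    by (auto simp: gA_def cyc_def pw_pw image_image hi_apw hi_bpw)
  ultimately have "gbg (GG l m k) (hi ` BS l m) (GGa l m k) (hi (BSb l m)) (GGt l m k) (\<lambda>e. hi ` A1 e) (\<lambda>e. hi ` gA l m k e)
      (\<lambda>g. L1 (inv_into (BS l m) hi g)) len l m (\<lambda>g. \<tau> (inv_into (BS l m) hi g)) k"
    unfolding gbg_def gbg_axioms_def using k0 GG_b by (simp add: GGa_def)
  then show ?thesis unfolding GG_b by blast
qed

lemma GG_sgrp: "sgrp (GG l m k)" and GGa_in: "GGa l m k \<in> GG l m k" and GGt_in: "GGt l m k \<in> GG l m k"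
  using sGr hi_Gr[OF BSa_in] te_Gr[of True] by (simp_all add: GG_def GGa_def GGt_def)

lemma GG_rel: "relG l m k (GGa l m k) (GGt l m k)"
proof -
  obtain H A1 A L1 L \<tau> where "gbg (GG l m k) H (GGa l m k) (gi (GGt l m k) \<cdot> (GGa l m k \<up> k) \<cdot> GGt l m k) (GGt l m k) A1 A L1 L l m \<tau> k"
    using GG_gbg by blast
  then interpret gbg "GG l m k" H "GGa l m k" "gi (GGt l m k) \<cdot> (GGa l m k \<up> k) \<cdot> GGt l m k" "GGt l m k" A1 A L1 L l m \<tau> k .
  show ?thesis unfolding relG_def by (rule inner.rel)
qed

lemma GG_least:
  assumes S: "sgrp S" "GGa l m k \<in> S" "GGt l m k \<in> S" shows "GG l m k \<subseteq> S"
proof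
  let ?S = "{h \<in> BS l m. hi h \<in> S}"
  have "sgrp ?S"
    unfolding sgrp_def using S(1)
    by (auto simp: ghom_gm[OF hi_hom] ghom_gi[OF hi_hom sH] ghom_ge[OF hi_hom sH] sgrp_gm[OF sH] sgrp_gi[OF sH]
        sgrp_ge[OF sH] sgrp_ge sgrp_gm sgrp_gi)
  moreover have "BSa l m \<in> ?S" using S BSa_in by (simp add: GGa_def)
  \<comment> \<open>\<open>b\<close> is not among the two generators of the outer group; it is
    recovered as a conjugate of a power of \<open>a\<close>.\<close>
  moreover have "BSb l m \<in> ?S" using S BSb_in by (simp add: sgrp_gm sgrp_gi sgrp_pw flip: GG_b)
  ultimately have hS: "BS l m \<subseteq> ?S" by (rule BS_least[OF l0 m0])
  fix x assume "x \<in> GG l m k"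
  then have "x \<in> Gr" by (simp add: GG_def)
  then show "x \<in> S"
  proof (induction rule: Gr.induct)
    case Gr_ge then show ?case using sgrp_ge[OF S(1)] .
  next
    case (Gr_hi g h) then show ?case using S hS by (auto intro: sgrp_gm)
  next
    case (Gr_te g e) then show ?case using S by (simp add: sgrp_gm sgrp_te flip: GGt_def)
  qed
qed

lemma GG_universal:
  fixes \<alpha> \<tau> :: "'k::grp"
  assumes r: "relG l m k \<alpha> \<tau>"
  obtains F where "ghom (GG l m k) F" "F (GGa l m k) = \<alpha>" "F (GGt l m k) = \<tau>"
proof -
  define \<beta> where "\<beta> = gi \<tau> \<cdot> (\<alpha> \<up> k) \<cdot> \<tau>"
  have "gi \<beta> \<cdot> (\<alpha> \<up> l) \<cdot> \<beta> = \<alpha> \<up> m" using r by (simp add: relG_def \<beta>_def)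
  then obtain f where f: "ghom (BS l m) f" "f (BSa l m) = \<alpha>" "f (BSb l m) = \<beta>"
    using BS_universal[OF l0 m0] by blast
  have pw: "f (BSa l m \<up> i) = \<alpha> \<up> i" "f (BSb l m \<up> i) = \<beta> \<up> i" for i
    using ghom_pw[OF f(1) sH] BSa_in BSb_in f by auto
  have \<beta>: "\<beta> \<up> i = gi \<tau> \<cdot> (\<alpha> \<up> (k * i)) \<cdot> \<tau>" for i
    by (simp add: \<beta>_def pw_conj pw_pw)
  have "\<exists>F. ghom Gr F \<and> (\<forall>h\<in>BS l m. F (hi h) = f h) \<and> F tt = \<tau>"
  proof (rule universal[OF f(1)])
    show "f p \<cdot> te \<tau> e = te \<tau> e \<cdot> f (gf l m k e p)" if "p \<in> gA l m k e" for p e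
      using that by (cases e) (auto simp: gA_def cyc_def pw_pw gf_simps pw \<beta>)
  qed
  then show ?thesis using that BSa_in f(2) by (auto simp: GG_def GGa_def GGt_def)
qed

end

section \<open>Comparison with the presentation\<close>

fun letter_val :: "'g::grp \<Rightarrow> 'g \<Rightarrow> letter \<Rightarrow> 'g" where
  "letter_val \<alpha> \<tau> (GA, s) = (if s then gi \<alpha> else \<alpha>)"
| "letter_val \<alpha> \<tau> (GT, s) = (if s then gi \<tau> else \<tau>)"

primrec word_val :: "'g::grp \<Rightarrow> 'g \<Rightarrow> word \<Rightarrow> 'g" where
  "word_val \<alpha> \<tau> [] = ge"
| "word_val \<alpha> \<tau> (x # w) = letter_val \<alpha> \<tau> x \<cdot> word_val \<alpha> \<tau> w"

lemma word_val_append [simp]: "word_val \<alpha> \<tau> (u @ v) = word_val \<alpha> \<tau> u \<cdot> word_val \<alpha> \<tau> v"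
  by (induction u) simp_all

lemma letter_val_inv: "letter_val \<alpha> \<tau> (inv_letter x) = gi (letter_val \<alpha> \<tau> x)"
  by (cases "(\<alpha>, \<tau>, x)" rule: letter_val.cases) (auto simp: inv_letter_def)

lemma word_val_apow [simp]: "word_val \<alpha> \<tau> (apow n) = \<alpha> \<up> n"
proof -
  have "word_val \<alpha> \<tau> (replicate j x) = npw (letter_val \<alpha> \<tau> x) j" for j x
    by (induction j) simp_all
  then show ?thesis by (simp add: apow_def pw_def)
qed

lemma word_val_relator: "word_val \<alpha> \<tau> (G_relator l m k) = ge \<longleftrightarrow> relG l m k \<alpha> \<tau>"
proof -
  define B where "B = gi \<tau> \<cdot> (\<alpha> \<up> k) \<cdot> \<tau>"
  have "word_val \<alpha> \<tau> (G_relator l m k) = gi B \<cdot> (\<alpha> \<up> l) \<cdot> B \<cdot> gi (\<alpha> \<up> m)"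
    by (simp add: G_relator_def B_def pw_minus)
  also have "\<dots> = ge \<longleftrightarrow> gi B \<cdot> (\<alpha> \<up> l) \<cdot> B = \<alpha> \<up> m"
    using gm_right_cancel[of "gi B \<cdot> (\<alpha> \<up> l) \<cdot> B \<cdot> gi (\<alpha> \<up> m)" "\<alpha> \<up> m" ge] by simp
  finally show ?thesis by (simp add: relG_def B_def)
qed

lemma pres_eq_word_val:
  "pres_eq R u v \<Longrightarrow> (\<And>r. r \<in> R \<Longrightarrow> word_val \<alpha> \<tau> r = ge) \<Longrightarrow> word_val \<alpha> \<tau> u = word_val \<alpha> \<tau> v"
  by (induction rule: pres_eq.induct) (simp_all add: letter_val_inv)

lemma pres_eq_append_left: "pres_eq R u v \<Longrightarrow> pres_eq R (w @ u) (w @ v)"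
proof (induction rule: pres_eq.induct)
  case (pres_cancel u x v)
  show ?case using pres_eq.pres_cancel[of R "w @ u" x v] by simp
next
  case (pres_rel r u v)
  then show ?case using pres_eq.pres_rel[of r R "w @ u" v] by simp
qed (auto intro: pres_eq.intros)

lemma pres_class_eq: "pres_class R u = pres_class R v \<longleftrightarrow> pres_eq R u v"
  unfolding pres_class_def by (auto intro: pres_refl pres_sym pres_trans)

text \<open>The left regular action of the presentation, extended by the identity to all sets of
  words. It turns the presentation into a target for \<open>GG_universal\<close> without first
  showing that \<open>presented_group\<close> is a group.\<close>

definition letter_act :: "word set \<Rightarrow> letter \<Rightarrow> word set \<Rightarrow> word set" where
  "letter_act R x X = (if X \<in> range (pres_class R) then {v. \<exists>w\<in>X. pres_eq R (x # w) v} else X)"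

lemma letter_act_class: "letter_act R x (pres_class R w) = pres_class R (x # w)"
proof -
  have "pres_eq R (x # w) v" if "pres_eq R w u" "pres_eq R (x # u) v" for u v
    using pres_eq_append_left[OF that(1), of "[x]"] that(2) by (auto intro: pres_trans)
  then show ?thesis unfolding letter_act_def by (auto simp: pres_class_def intro: pres_refl)
qed

lemma inv_inv_letter [simp]: "inv_letter (inv_letter x) = x"
  by (simp add: inv_letter_def)

lemma letter_act_inv: "letter_act R x (letter_act R (inv_letter x) X) = X"
proof (cases "X \<in> range (pres_class R)")
  case True
  then obtain w where "X = pres_class R w" by blast
  moreover have "pres_eq R (x # inv_letter x # w) w" using pres_cancel[of R "[]" x w] by simp
  ultimately show ?thesis by (simp add: letter_act_class pres_class_eq)
qed (simp add: letter_act_def)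

definition regular :: "word set \<Rightarrow> letter \<Rightarrow> word set sym" where
  "regular R x = Sym (letter_act R x)"

lemma app_regular: "app (regular R x) = letter_act R x"
  unfolding regular_def
  using letter_act_inv[of R x] letter_act_inv[of R "inv_letter x"]
  by (intro app_Sym o_bij[of "letter_act R (inv_letter x)"]) (auto simp: fun_eq_iff)

lemma app_gi_regular: "app (gi (regular R x)) = letter_act R (inv_letter x)"
  by (rule ext, rule app_gi_eq) (simp add: app_regular letter_act_inv)

lemma app_letter_val_regular:
  "app (letter_val (regular R (GA, False)) (regular R (GT, False)) x) = letter_act R x"
proof -
  obtain y s where "x = (y, s)" by fastforce
  then show ?thesis by (cases y; cases s) (simp_all add: app_regular app_gi_regular inv_letter_def)
qed

lemma app_word_val_regular:
  "app (word_val (regular R (GA, False)) (regular R (GT, False)) w) (pres_class R u) = pres_class R (w @ u)"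
  by (induction w) (simp_all add: app_letter_val_regular letter_act_class)

lemma regular_relator:
  assumes "r \<in> R" shows "word_val (regular R (GA, False)) (regular R (GT, False)) r = ge"
proof (rule sym_eqI)
  fix X
  show "app (word_val (regular R (GA, False)) (regular R (GT, False)) r) X = app ge X"
  proof (cases "X \<in> range (pres_class R)")
    case True
    then obtain u where "X = pres_class R u" by blast
    moreover have "pres_eq R (r @ u) u" using pres_rel[OF assms, of "[]" u] by simp
    ultimately show ?thesis by (simp add: app_word_val_regular pres_class_eq)
  next
    case False
    have "app (word_val (regular R (GA, False)) (regular R (GT, False)) w) X = X" for w
      using False by (induction w) (simp_all add: app_letter_val_regular letter_act_def)
    then show ?thesis by simp
  qed
qed

lemma word_val_in: "sgrp S \<Longrightarrow> \<alpha> \<in> S \<Longrightarrow> \<tau> \<in> S \<Longrightarrow> word_val \<alpha> \<tau> w \<in> S"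
proof (induction w)
  case (Cons x w)
  obtain y s where "x = (y, s)" by fastforce
  then have "letter_val \<alpha> \<tau> x \<in> S" using Cons by (cases y) (auto simp: sgrp_gi)
  then show ?case using Cons by (simp add: sgrp_gm)
qed (simp add: sgrp_ge)

lemma ghom_word_val:
  assumes "ghom S F" "sgrp S" "\<alpha> \<in> S" "\<tau> \<in> S"
  shows "F (word_val \<alpha> \<tau> w) = word_val (F \<alpha>) (F \<tau>) w"
proof (induction w)
  case Nil then show ?case using assms by (simp add: ghom_ge)
next
  case (Cons x w)
  obtain y s where x: "x = (y, s)" by fastforce
  have "letter_val \<alpha> \<tau> x \<in> S" "F (letter_val \<alpha> \<tau> x) = letter_val (F \<alpha>) (F \<tau>) x"
    using assms x by (cases y; auto simp: sgrp_gi ghom_gi)+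
  then show ?case using Cons word_val_in[OF assms(2-4)] by (simp add: ghom_gm[OF assms(1)])
qed

lemma sgrp_range_word_val: "sgrp (range (word_val \<alpha> \<tau>))"
proof -
  have "gi (word_val \<alpha> \<tau> w) = word_val \<alpha> \<tau> (rev (map inv_letter w))" for w
    by (induction w) (simp_all add: letter_val_inv)
  moreover have "ge = word_val \<alpha> \<tau> []" by simp
  ultimately show ?thesis unfolding sgrp_def by (auto simp flip: word_val_append simp del: word_val.simps)
qed

abbreviation GGw :: "int \<Rightarrow> int \<Rightarrow> int \<Rightarrow> word \<Rightarrow> gg" where
  "GGw l m k \<equiv> word_val (GGa l m k) (GGt l m k)"

context
  fixes l m k :: int
  assumes l0: "l \<noteq> 0" and m0: "m \<noteq> 0" and k0: "k \<noteq> 0"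
begin

lemma GG_range: "GG l m k = range (GGw l m k)"
proof
  have "word_val (GGa l m k) (GGt l m k) [(GA, False)] = GGa l m k" "word_val (GGa l m k) (GGt l m k) [(GT, False)] = GGt l m k"
    by simp_all
  then show "GG l m k \<subseteq> range (GGw l m k)"
    by (intro GG_least[OF l0 m0 k0] sgrp_range_word_val) (metis rangeI)+
  show "range (GGw l m k) \<subseteq> GG l m k"
    using word_val_in[OF GG_sgrp[OF l0 m0 k0] GGa_in[OF l0 m0 k0] GGt_in[OF l0 m0 k0]] by blast
qed

text \<open>From left to right, the universal property maps the concrete group to the regular
  action, and applying both images to the class of the empty word compares the words. The converse
  holds because the relator is trivial in the concrete group.\<close>

lemma GGw_eq: "GGw l m k u = GGw l m k v \<longleftrightarrow> pres_eq {G_relator l m k} u v"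
proof
  let ?R = "{G_relator l m k}"
  let ?a = "regular ?R (GA, False)" and ?t = "regular ?R (GT, False)"
  assume eq: "GGw l m k u = GGw l m k v"
  have "relG l m k ?a ?t" using regular_relator[of "G_relator l m k" ?R] word_val_relator by blast
  then obtain F where F: "ghom (GG l m k) F" "F (GGa l m k) = ?a" "F (GGt l m k) = ?t"
    using GG_universal[OF l0 m0 k0] by blast
  have "word_val ?a ?t u = word_val ?a ?t v"
    using ghom_word_val[OF F(1) GG_sgrp[OF l0 m0 k0] GGa_in[OF l0 m0 k0] GGt_in[OF l0 m0 k0]] eq F(2,3) by metis
  then have "pres_class ?R (u @ []) = pres_class ?R (v @ [])"
    using app_word_val_regular by metis
  then show "pres_eq ?R u v" by (simp add: pres_class_eq)
next
  assume "pres_eq {G_relator l m k} u v"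
  then show "GGw l m k u = GGw l m k v"
    by (rule pres_eq_word_val) (use GG_rel[OF l0 m0 k0] in \<open>auto simp: word_val_relator\<close>)
qed

definition rlz :: "word set \<Rightarrow> gg" where "rlz X = GGw l m k (SOME u. u \<in> X)"

lemma rlz_class: "rlz (pres_class {G_relator l m k} w) = GGw l m k w"
proof -
  have "(SOME u. u \<in> pres_class {G_relator l m k} w) \<in> pres_class {G_relator l m k} w"
    by (rule someI[of _ w]) (simp add: pres_class_def pres_refl)
  then show ?thesis unfolding rlz_def GGw_eq by (auto simp: pres_class_def intro: pres_sym)
qed

lemma carrier_Glmk: "carrier (Glmk l m k) = range (pres_class {G_relator l m k})"
  by (simp add: Glmk_def presented_group_def)

lemma rlz_bij: "bij_betw rlz (carrier (Glmk l m k)) (GG l m k)"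
  unfolding carrier_Glmk bij_betw_def inj_on_def GG_range
  by (auto simp: rlz_class GGw_eq pres_class_eq image_image)

lemma rlz_mult:
  assumes "X \<in> carrier (Glmk l m k)" "Y \<in> carrier (Glmk l m k)"
  shows "X \<otimes>\<^bsub>Glmk l m k\<^esub> Y \<in> carrier (Glmk l m k)" "rlz (X \<otimes>\<^bsub>Glmk l m k\<^esub> Y) = rlz X \<cdot> rlz Y"
proof -
  have eq: "X \<otimes>\<^bsub>Glmk l m k\<^esub> Y = pres_class {G_relator l m k} ((SOME u. u \<in> X) @ (SOME v. v \<in> Y))"
    by (simp add: Glmk_def presented_group_def)
  show "X \<otimes>\<^bsub>Glmk l m k\<^esub> Y \<in> carrier (Glmk l m k)" unfolding eq carrier_Glmk by blast
  show "rlz (X \<otimes>\<^bsub>Glmk l m k\<^esub> Y) = rlz X \<cdot> rlz Y"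
    unfolding eq rlz_class by (simp add: rlz_def)
qed

lemma Glmk_realization: "\<exists>\<Phi>. bij_betw \<Phi> (carrier (Glmk l m k)) (GG l m k) \<and>
    (\<forall>X\<in>carrier (Glmk l m k). \<forall>Y\<in>carrier (Glmk l m k).
      X \<otimes>\<^bsub>Glmk l m k\<^esub> Y \<in> carrier (Glmk l m k) \<and> \<Phi> (X \<otimes>\<^bsub>Glmk l m k\<^esub> Y) = \<Phi> X \<cdot> \<Phi> Y)"
  using rlz_bij rlz_mult by blast

end

text \<open>Homomorphisms, epimorphisms and isomorphisms of HOL-Algebra speak only of carriers and
  products, so bijections that respect products transport them.\<close>

lemma hom_realization:
  fixes \<Phi> :: "'a \<Rightarrow> 'g::grp" and \<Psi> :: "'b \<Rightarrow> 'k::grp"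
  assumes \<Phi>: "bij_betw \<Phi> (carrier M) S" "\<forall>X\<in>carrier M. \<forall>Y\<in>carrier M. X \<otimes>\<^bsub>M\<^esub> Y \<in> carrier M \<and> \<Phi> (X \<otimes>\<^bsub>M\<^esub> Y) = \<Phi> X \<cdot> \<Phi> Y"
    and \<Psi>: "bij_betw \<Psi> (carrier N) T" "\<forall>X\<in>carrier N. \<forall>Y\<in>carrier N. X \<otimes>\<^bsub>N\<^esub> Y \<in> carrier N \<and> \<Psi> (X \<otimes>\<^bsub>N\<^esub> Y) = \<Psi> X \<cdot> \<Psi> Y"
    and T: "sgrp T"
  shows "(\<exists>f. f \<in> epi M N) \<longleftrightarrow> (\<exists>g. ghom S g \<and> g ` S = T)"
    and "M \<cong> N \<longleftrightarrow> (\<exists>g. ghom S g \<and> bij_betw g S T)"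
proof -
  let ?\<Phi>' = "inv_into (carrier M) \<Phi>" and ?\<Psi>' = "inv_into (carrier N) \<Psi>"
  have \<Phi>': "?\<Phi>' (\<Phi> X) = X" if "X \<in> carrier M" for X using \<Phi>(1) that by (simp add: bij_betw_def)
  have \<Psi>': "?\<Psi>' (\<Psi> X) = X" if "X \<in> carrier N" for X using \<Psi>(1) that by (simp add: bij_betw_def)
  have S: "S = \<Phi> ` carrier M" and T': "T = \<Psi> ` carrier N" using \<Phi>(1) \<Psi>(1) by (auto simp: bij_betw_def)
  have fwd: "ghom S (\<Psi> \<circ> f \<circ> ?\<Phi>')" if f: "f \<in> hom M N" for f
    unfolding ghom_def
  proof (intro ballI)
    fix x y assume "x \<in> S" "y \<in> S"
    then obtain X Y where X: "X \<in> carrier M" "x = \<Phi> X" "Y \<in> carrier M" "y = \<Phi> Y" by (auto simp: S)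
    have "x \<cdot> y = \<Phi> (X \<otimes>\<^bsub>M\<^esub> Y)" "X \<otimes>\<^bsub>M\<^esub> Y \<in> carrier M" using X \<Phi>(2) by auto
    moreover have "f X \<in> carrier N" "f Y \<in> carrier N" using f X by (auto simp: hom_def)
    ultimately show "(\<Psi> \<circ> f \<circ> ?\<Phi>') (x \<cdot> y) = (\<Psi> \<circ> f \<circ> ?\<Phi>') x \<cdot> (\<Psi> \<circ> f \<circ> ?\<Phi>') y"
      using f X \<Psi>(2) by (simp add: \<Phi>' hom_def)
  qed
  have bwd: "?\<Psi>' \<circ> g \<circ> \<Phi> \<in> hom M N" if g: "ghom S g" "g ` S \<subseteq> T" for g
  proof -
    have gX: "\<exists>Z\<in>carrier N. g (\<Phi> X) = \<Psi> Z" if "X \<in> carrier M" for X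
      using g(2) that by (auto simp: S T')
    have "?\<Psi>' (g (\<Phi> (X \<otimes>\<^bsub>M\<^esub> Y))) = ?\<Psi>' (g (\<Phi> X)) \<otimes>\<^bsub>N\<^esub> ?\<Psi>' (g (\<Phi> Y))"
      if XY: "X \<in> carrier M" "Y \<in> carrier M" for X Y
    proof -
      obtain Z W where Z: "Z \<in> carrier N" "g (\<Phi> X) = \<Psi> Z" "W \<in> carrier N" "g (\<Phi> Y) = \<Psi> W"
        using gX XY by blast
      have "g (\<Phi> (X \<otimes>\<^bsub>M\<^esub> Y)) = \<Psi> (Z \<otimes>\<^bsub>N\<^esub> W)"
        using XY \<Phi>(2) \<Psi>(2) Z ghom_gm[OF g(1)] by (simp add: S)
      moreover have "Z \<otimes>\<^bsub>N\<^esub> W \<in> carrier N" using Z \<Psi>(2) by blast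
      ultimately show ?thesis using Z by (simp only: \<Psi>')
    qed
    moreover have "?\<Psi>' (g (\<Phi> X)) \<in> carrier N" if "X \<in> carrier M" for X
      using gX[OF that] by (auto simp: \<Psi>')
    ultimately show ?thesis by (auto simp: hom_def)
  qed
  have \<Phi>'S: "?\<Phi>' ` S = carrier M" using \<Phi>' by (force simp: S image_image)
  have \<Psi>'T: "?\<Psi>' ` T = carrier N" using \<Psi>' by (force simp: T' image_image)
  show "(\<exists>f. f \<in> epi M N) \<longleftrightarrow> (\<exists>g. ghom S g \<and> g ` S = T)"
  proof
    assume "\<exists>f. f \<in> epi M N"
    then obtain f where f: "f \<in> hom M N" "f ` carrier M = carrier N" by (auto simp: epi_def)
    have "(\<Psi> \<circ> f \<circ> ?\<Phi>') ` S = \<Psi> ` f ` ?\<Phi>' ` S" by (simp only: image_comp o_assoc)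
    then have "(\<Psi> \<circ> f \<circ> ?\<Phi>') ` S = T" by (simp only: \<Phi>'S f(2) T')
    then show "\<exists>g. ghom S g \<and> g ` S = T" using fwd[OF f(1)] by blast
  next
    assume "\<exists>g. ghom S g \<and> g ` S = T"
    then obtain g where g: "ghom S g" "g ` S = T" by blast
    have "(?\<Psi>' \<circ> g \<circ> \<Phi>) ` carrier M = ?\<Psi>' ` g ` S" by (simp only: S image_comp o_assoc)
    then have "?\<Psi>' \<circ> g \<circ> \<Phi> \<in> epi M N" using bwd[OF g(1)] g(2) \<Psi>'T by (simp add: epi_def)
    then show "\<exists>f. f \<in> epi M N" by blast
  qed
  have b\<Phi>': "bij_betw ?\<Phi>' S (carrier M)" and b\<Psi>': "bij_betw ?\<Psi>' T (carrier N)"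
    using bij_betw_inv_into \<Phi>(1) \<Psi>(1) by blast+
  show "M \<cong> N \<longleftrightarrow> (\<exists>g. ghom S g \<and> bij_betw g S T)"
  proof
    assume "M \<cong> N"
    then obtain f where f: "f \<in> hom M N" "bij_betw f (carrier M) (carrier N)" by (auto simp: is_iso_def iso_def)
    have "bij_betw (\<Psi> \<circ> f \<circ> ?\<Phi>') S T" using b\<Phi>' f(2) \<Psi>(1) by (blast intro: bij_betw_trans)
    then show "\<exists>g. ghom S g \<and> bij_betw g S T" using fwd[OF f(1)] by blast
  next
    assume "\<exists>g. ghom S g \<and> bij_betw g S T"
    then obtain g where g: "ghom S g" "bij_betw g S T" by blast
    have "bij_betw (?\<Psi>' \<circ> g \<circ> \<Phi>) (carrier M) (carrier N)" using \<Phi>(1) g(2) b\<Psi>' by (blast intro: bij_betw_trans)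
    moreover have "g ` S \<subseteq> T" using g(2) by (simp add: bij_betw_def)
    ultimately show "M \<cong> N" using bwd[OF g(1)] by (auto simp: is_iso_def iso_def)
  qed
qed

lemma homomorphic_image_GG:
  assumes "l \<noteq> 0" "m \<noteq> 0" "k1 \<noteq> 0" "k2 \<noteq> 0"
  shows "homomorphic_image (Glmk l m k1) (Glmk l m k2) \<longleftrightarrow> (\<exists>g. ghom (GG l m k2) g \<and> g ` GG l m k2 = GG l m k1)"
proof -
  obtain \<Phi> \<Psi> where "bij_betw \<Phi> (carrier (Glmk l m k2)) (GG l m k2) \<and>
    (\<forall>X\<in>carrier (Glmk l m k2). \<forall>Y\<in>carrier (Glmk l m k2).
      X \<otimes>\<^bsub>Glmk l m k2\<^esub> Y \<in> carrier (Glmk l m k2) \<and> \<Phi> (X \<otimes>\<^bsub>Glmk l m k2\<^esub> Y) = \<Phi> X \<cdot> \<Phi> Y)"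
    "bij_betw \<Psi> (carrier (Glmk l m k1)) (GG l m k1) \<and>
    (\<forall>X\<in>carrier (Glmk l m k1). \<forall>Y\<in>carrier (Glmk l m k1).
      X \<otimes>\<^bsub>Glmk l m k1\<^esub> Y \<in> carrier (Glmk l m k1) \<and> \<Psi> (X \<otimes>\<^bsub>Glmk l m k1\<^esub> Y) = \<Psi> X \<cdot> \<Psi> Y)"
    using Glmk_realization assms by metis
  then show ?thesis unfolding homomorphic_image_def
    using hom_realization(1)[of \<Phi> "Glmk l m k2" "GG l m k2" \<Psi> "Glmk l m k1" "GG l m k1"] GG_sgrp assms by blast
qed

lemma iso_GG:
  assumes "l \<noteq> 0" "m \<noteq> 0" "k1 \<noteq> 0" "k2 \<noteq> 0"
  shows "Glmk l m k1 \<cong> Glmk l m k2 \<longleftrightarrow> (\<exists>g. ghom (GG l m k1) g \<and> bij_betw g (GG l m k1) (GG l m k2))"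
proof -
  obtain \<Phi> \<Psi> where "bij_betw \<Phi> (carrier (Glmk l m k1)) (GG l m k1) \<and>
    (\<forall>X\<in>carrier (Glmk l m k1). \<forall>Y\<in>carrier (Glmk l m k1).
      X \<otimes>\<^bsub>Glmk l m k1\<^esub> Y \<in> carrier (Glmk l m k1) \<and> \<Phi> (X \<otimes>\<^bsub>Glmk l m k1\<^esub> Y) = \<Phi> X \<cdot> \<Phi> Y)"
    "bij_betw \<Psi> (carrier (Glmk l m k2)) (GG l m k2) \<and>
    (\<forall>X\<in>carrier (Glmk l m k2). \<forall>Y\<in>carrier (Glmk l m k2).
      X \<otimes>\<^bsub>Glmk l m k2\<^esub> Y \<in> carrier (Glmk l m k2) \<and> \<Psi> (X \<otimes>\<^bsub>Glmk l m k2\<^esub> Y) = \<Psi> X \<cdot> \<Psi> Y)"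
    using Glmk_realization assms by metis
  then show ?thesis
    using hom_realization(2)[of \<Phi> "Glmk l m k1" "GG l m k1" \<Psi> "Glmk l m k2" "GG l m k2"] GG_sgrp assms by blast
qed

section \<open>Homomorphisms between the groups\<close>

lemma steps_conj:
  fixes \<alpha> \<beta> :: "'g::grp"
  assumes r: "gi \<beta> \<cdot> (\<alpha> \<up> l) \<cdot> \<beta> = \<alpha> \<up> m"
  shows "(step l m ^^ n) u v \<Longrightarrow> gi (\<beta> \<up> int n) \<cdot> (\<alpha> \<up> u) \<cdot> (\<beta> \<up> int n) = \<alpha> \<up> v"
proof (induction n arbitrary: v)
  case (Suc n)
  then obtain w where "(step l m ^^ n) u w" "step l m w v" by auto
  then obtain j where j: "(step l m ^^ n) u (l * j)" "v = m * j" by (auto simp: step_def[of l m w])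
  have "\<beta> \<up> int (Suc n) = (\<beta> \<up> int n) \<cdot> \<beta>" using pw_add[of \<beta> "int n" 1] by (simp add: add.commute)
  then have "gi (\<beta> \<up> int (Suc n)) \<cdot> (\<alpha> \<up> u) \<cdot> (\<beta> \<up> int (Suc n)) = gi \<beta> \<cdot> (gi (\<beta> \<up> int n) \<cdot> (\<alpha> \<up> u) \<cdot> (\<beta> \<up> int n)) \<cdot> \<beta>"
    by simp
  also have "\<dots> = gi \<beta> \<cdot> (\<alpha> \<up> (l * j)) \<cdot> \<beta>" unfolding Suc.IH[OF j(1)] ..
  also have "\<dots> = \<alpha> \<up> v" using pw_conj[of \<beta> "\<alpha> \<up> l" j] by (simp add: r pw_pw j)
  finally show ?case .
qed simp

text \<open>The converse of \<open>conj_scale\<close>, valid in every group in which the relation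
  holds.\<close>

lemma scale_conj:
  fixes \<alpha> \<beta> :: "'g::grp"
  assumes r: "gi \<beta> \<cdot> (\<alpha> \<up> l) \<cdot> \<beta> = \<alpha> \<up> m" and s: "scale l m p u v"
  shows "gi (\<beta> \<up> p) \<cdot> (\<alpha> \<up> u) \<cdot> (\<beta> \<up> p) = \<alpha> \<up> v"
proof (cases "p \<ge> 0")
  case True
  then show ?thesis using s steps_conj[OF r, of "nat p" u v] by (simp add: scale_def)
next
  case False
  then have "gi (\<beta> \<up> (- p)) \<cdot> (\<alpha> \<up> v) \<cdot> (\<beta> \<up> (- p)) = \<alpha> \<up> u"
    using s steps_conj[OF r, of "nat (- p)" v u] by (simp add: scale_def)
  then have "(\<beta> \<up> p) \<cdot> (\<alpha> \<up> v) \<cdot> gi (\<beta> \<up> p) = \<alpha> \<up> u" by (simp add: pw_minus)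
  then show ?thesis unfolding conj_swap by simp
qed

lemma scale_rat:
  assumes "l \<noteq> 0" "m \<noteq> 0" "scale l m p u v"
  shows "(of_int u :: rat) = of_int v * (of_int l / of_int m) powi p"
proof -
  have *: "(of_int u :: rat) = of_int v * (of_int l / of_int m) ^ n" if "(step l m ^^ n) u v" for n u v
  proof -
    have "(of_int (u * m ^ n) :: rat) = of_int (v * l ^ n)" using steps_eq[OF that] by simp
    then show ?thesis using assms by (simp add: power_divide field_simps)
  qed
  show ?thesis
  proof (cases "p \<ge> 0")
    case True
    then show ?thesis using assms(3) * by (simp add: scale_def power_int_def)
  next
    case False
    have "(of_int l / of_int m :: rat) \<noteq> 0" using assms by simp
    then show ?thesis using False assms(3) *[of "nat (- p)" v u] by (simp add: scale_def power_int_def field_simps)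
  qed
qed

lemma steps_mult: "(step (m * s) m ^^ n) (m * j * s ^ n) (m * j)"
proof (induction n)
  case (Suc n)
  have "step (m * s) m (m * j * s ^ Suc n) (m * j * s ^ n)"
    unfolding step_def by (rule exI[of _ "j * s ^ n"]) simp
  then show ?case using Suc relpowp_Suc_I2 by metis
qed simp

text \<open>Each step leads from a multiple of \<open>m * s\<close> to a multiple of
  \<open>m\<close>, and for nonzero \<open>p\<close> there is a step at either end.\<close>

lemma scale_dvd:
  assumes "scale (m * s) m p u v" "p \<noteq> 0" shows "m dvd u" "m dvd v"
proof -
  have *: "m dvd u \<and> m dvd v" if st: "(step (m * s) m ^^ n) u v" and n: "n \<noteq> 0" for n u v
  proof -
    obtain i where i: "n = Suc i" using n not0_implies_Suc by blast
    obtain w w' where "step (m * s) m u w" "step (m * s) m w' v"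
      using relpowp_Suc_E2[OF st[unfolded i]] relpowp_Suc_E[OF st[unfolded i]] by metis
    then show ?thesis by (auto simp: step_def)
  qed
  show "m dvd u" "m dvd v"
    using assms *[of "nat p" u v] *[of "nat (- p)" v u] by (auto simp: scale_def split: if_splits)
qed

text \<open>The cyclic group of variable order \<open>q\<close>, inside one fixed type.\<close>

definition rot :: "int \<Rightarrow> int \<Rightarrow> int sym" where
  "rot q j = Sym (\<lambda>i. if 0 \<le> i \<and> i < q then (i + j) mod q else i)"

lemma app_rot: "app (rot q j) i = (if 0 \<le> i \<and> i < q then (i + j) mod q else i)"
proof -
  have "bij (\<lambda>i. if 0 \<le> i \<and> i < q then (i + j) mod q else i)"
    by (rule o_bij[of "\<lambda>i. if 0 \<le> i \<and> i < q then (i - j) mod q else i"]) (auto simp: fun_eq_iff mod_simps)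
  then show ?thesis by (simp add: rot_def app_Sym)
qed

lemma rot_hom: "ghom UNIV (rot q)"
  unfolding ghom_def
  by (auto intro!: sym_eqI simp: app_rot int_grp mod_simps algebra_simps)

lemma rot_pw: "rot q j \<up> n = rot q (j * n)"
  using ghom_pw[OF rot_hom, of j q n] by (simp add: sgrp_def pw_int)

lemma rot_ge: "q > 0 \<Longrightarrow> rot q j = ge \<longleftrightarrow> q dvd j"
proof
  assume "q > 0" "rot q j = ge"
  then have "app (rot q j) 0 = 0" by simp
  then show "q dvd j" using \<open>q > 0\<close> by (simp add: app_rot dvd_eq_mod_eq_0)
next
  assume "q dvd j"
  then show "rot q j = ge" by (auto intro!: sym_eqI simp: app_rot mod_add_eq[symmetric] elim!: dvdE)
qed

context
  fixes l m k1 :: int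
  assumes l0: "l \<noteq> 0" and m0: "m \<noteq> 0" and k1: "k1 \<noteq> 0"
begin

lemma GG_ext:
  assumes f: "ghom (GG l m k1) f" "ghom (GG l m k1) g" "f (GGa l m k1) = g (GGa l m k1)" "f (GGt l m k1) = g (GGt l m k1)"
    and x: "x \<in> GG l m k1"
  shows "f x = g x"
proof -
  let ?S = "{x \<in> GG l m k1. f x = g x}"
  note G = GG_sgrp[OF l0 m0 k1]
  have "sgrp ?S" unfolding sgrp_def
    using f by (auto simp: ghom_gm ghom_gi[OF _ G] ghom_ge[OF _ G] sgrp_gm[OF G] sgrp_gi[OF G] sgrp_ge[OF G])
  then have "GG l m k1 \<subseteq> ?S"
    by (rule GG_least[OF l0 m0 k1]) (use f GGa_in[OF l0 m0 k1] GGt_in[OF l0 m0 k1] in auto)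
  then show ?thesis using x by blast
qed

lemma GG_image_least:
  assumes f: "ghom (GG l m k1) f" and S: "sgrp S" "f (GGa l m k1) \<in> S" "f (GGt l m k1) \<in> S"
  shows "f ` GG l m k1 \<subseteq> S"
proof -
  let ?S = "{x \<in> GG l m k1. f x \<in> S}"
  note G = GG_sgrp[OF l0 m0 k1]
  have "sgrp ?S" unfolding sgrp_def
    using f S by (auto simp: ghom_gm ghom_gi[OF _ G] ghom_ge[OF _ G] sgrp_gm[OF G] sgrp_gi[OF G] sgrp_ge[OF G] sgrp_gm sgrp_gi sgrp_ge)
  then have "GG l m k1 \<subseteq> ?S"
    by (rule GG_least[OF l0 m0 k1]) (use S GGa_in[OF l0 m0 k1] GGt_in[OF l0 m0 k1] in auto)
  then show ?thesis by blast
qed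

end

definition GGb :: "int \<Rightarrow> int \<Rightarrow> int \<Rightarrow> gg" where
  "GGb l m k = gi (GGt l m k) \<cdot> (GGa l m k \<up> k) \<cdot> GGt l m k"

lemma GGb_rel:
  assumes "l \<noteq> 0" "m \<noteq> 0" "k \<noteq> 0"
  shows "gi (GGb l m k) \<cdot> (GGa l m k \<up> l) \<cdot> GGb l m k = GGa l m k \<up> m"
  using GG_rel[OF assms] by (simp add: relG_def GGb_def)

lemma GGb_in:
  assumes "l \<noteq> 0" "m \<noteq> 0" "k \<noteq> 0" shows "GGb l m k \<in> GG l m k"
  unfolding GGb_def using GG_sgrp[OF assms] GGa_in[OF assms] GGt_in[OF assms]
  by (simp add: sgrp_gm sgrp_gi sgrp_pw)

lemma ghom_GGb:
  assumes "l \<noteq> 0" "m \<noteq> 0" "k \<noteq> 0" and f: "ghom (GG l m k) f"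
  shows "f (GGb l m k) = gi (f (GGt l m k)) \<cdot> (f (GGa l m k) \<up> k) \<cdot> f (GGt l m k)"
  using GG_sgrp[OF assms(1-3)] GGa_in[OF assms(1-3)] GGt_in[OF assms(1-3)]
  by (simp add: GGb_def ghom_gm[OF f] ghom_gi[OF f] ghom_pw[OF f] sgrp_gm sgrp_gi sgrp_pw)

lemma ghom_relG:
  assumes "l \<noteq> 0" "m \<noteq> 0" "k \<noteq> 0" and f: "ghom (GG l m k) f"
  shows "relG l m k (f (GGa l m k)) (f (GGt l m k))"
proof -
  note G = GG_sgrp[OF assms(1-3)]
  show ?thesis
    unfolding relG_def ghom_GGb[OF assms, symmetric]
    using arg_cong[OF GGb_rel[OF assms(1-3)], of f] GGa_in[OF assms(1-3)] GGb_in[OF assms(1-3)]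
    by (simp add: ghom_gm[OF f] ghom_gi[OF f G] ghom_pw[OF f G] sgrp_gm[OF G] sgrp_gi[OF G] sgrp_pw[OF G])
qed

lemma conj_pw_rel:
  fixes \<alpha> \<beta> :: "'g::grp"
  assumes "gi \<beta> \<cdot> (\<alpha> \<up> l) \<cdot> \<beta> = \<alpha> \<up> m"
  shows "gi \<beta> \<cdot> ((\<alpha> \<up> x) \<up> l) \<cdot> \<beta> = (\<alpha> \<up> x) \<up> m"
  using pw_conj[of \<beta> "\<alpha> \<up> l" x] by (simp add: assms pw_pw mult.commute)

context
  fixes l m k1 k2 x p :: int
  assumes l0: "l \<noteq> 0" and m0: "m \<noteq> 0" and k1: "k1 \<noteq> 0" and k2: "k2 \<noteq> 0"
    and sc: "scale l m p (x * k1) k2"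
begin

text \<open>Conjugation by \<open>b \<up> p\<close> takes \<open>a \<up> (x * k1)\<close> to
  \<open>a \<up> k2\<close>, and \<open>t\<close> takes this to \<open>b\<close>. So
  \<open>b\<close> goes to \<open>b\<close>, and the required relation is a power of the one that
  holds.\<close>

lemma scale_hom:
  obtains f where "ghom (GG l m k1) f" "f (GGa l m k1) = GGa l m k2 \<up> x" "f (GGt l m k1) = (GGb l m k2 \<up> p) \<cdot> GGt l m k2" "f (GGb l m k1) = GGb l m k2" "f ` GG l m k1 \<subseteq> GG l m k2"
proof -
  let ?a1 = "GGa l m k1" and ?t1 = "GGt l m k1" and ?b1 = "GGb l m k1"
  let ?a2 = "GGa l m k2" and ?t2 = "GGt l m k2" and ?b2 = "GGb l m k2"
  have "gi ((?b2 \<up> p) \<cdot> ?t2) \<cdot> ((?a2 \<up> x) \<up> k1) \<cdot> ((?b2 \<up> p) \<cdot> ?t2) = gi ?t2 \<cdot> (gi (?b2 \<up> p) \<cdot> (?a2 \<up> (x * k1)) \<cdot> (?b2 \<up> p)) \<cdot> ?t2"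
    by (simp add: pw_pw)
  also have "\<dots> = ?b2" unfolding scale_conj[OF GGb_rel[OF l0 m0 k2] sc] by (simp add: GGb_def)
  finally have b: "gi ((?b2 \<up> p) \<cdot> ?t2) \<cdot> ((?a2 \<up> x) \<up> k1) \<cdot> ((?b2 \<up> p) \<cdot> ?t2) = ?b2" .
  have "relG l m k1 (?a2 \<up> x) ((?b2 \<up> p) \<cdot> ?t2)"
    unfolding relG_def b by (rule conj_pw_rel[OF GGb_rel[OF l0 m0 k2]])
  then obtain f where f: "ghom (GG l m k1) f" "f ?a1 = ?a2 \<up> x" "f ?t1 = (?b2 \<up> p) \<cdot> ?t2"
    using GG_universal[OF l0 m0 k1] by blast
  have "f ?b1 = ?b2" using ghom_GGb[OF l0 m0 k1 f(1)] b by (simp only: f)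
  moreover have "f ` GG l m k1 \<subseteq> GG l m k2"
    by (rule GG_image_least[OF l0 m0 k1 f(1) GG_sgrp[OF l0 m0 k2]])
       (use GG_sgrp[OF l0 m0 k2] GGa_in[OF l0 m0 k2] GGt_in[OF l0 m0 k2] GGb_in[OF l0 m0 k2] in \<open>simp_all add: f sgrp_pw sgrp_gm\<close>)
  ultimately show ?thesis using that f by blast
qed

text \<open>The image contains \<open>b\<close>, \<open>t\<close> and \<open>a \<up> x\<close>,
  hence \<open>a \<up> (m * s ^ N)\<close>, which \<open>b \<up> N\<close> conjugates to
  \<open>a \<up> m\<close>. As \<open>x\<close> and \<open>m\<close> are coprime, \<open>a\<close>
  follows.\<close>

lemma scale_epi:
  assumes l: "l = m * s" and xy: "x * y = s ^ N" and cop: "coprime x m"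
  shows "\<exists>f. ghom (GG l m k1) f \<and> f ` GG l m k1 = GG l m k2"
proof -
  let ?a1 = "GGa l m k1" and ?t1 = "GGt l m k1" and ?b1 = "GGb l m k1"
  let ?a2 = "GGa l m k2" and ?t2 = "GGt l m k2" and ?b2 = "GGb l m k2"
  obtain f where f: "ghom (GG l m k1) f" "f ?a1 = ?a2 \<up> x" "f ?t1 = (?b2 \<up> p) \<cdot> ?t2" "f ?b1 = ?b2" "f ` GG l m k1 \<subseteq> GG l m k2"
    using scale_hom .
  let ?S = "f ` GG l m k1"
  have S: "sgrp ?S" by (rule sgrp_image[OF f(1) GG_sgrp[OF l0 m0 k1]])
  have b: "?b2 \<in> ?S" using f(4) GGb_in[OF l0 m0 k1] by (metis image_eqI)
  have "(?b2 \<up> p) \<cdot> ?t2 \<in> ?S" using f(3) GGt_in[OF l0 m0 k1] by (metis image_eqI)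
  then have t: "?t2 \<in> ?S" using sgrp_gm_iff[OF S sgrp_pw[OF S b]] by blast
  have ax: "?a2 \<up> x \<in> ?S" using f(2) GGa_in[OF l0 m0 k1] by (metis image_eqI)
  have "(step l m ^^ N) (m * 1 * s ^ N) (m * 1)" unfolding l by (rule steps_mult)
  then have "gi (?b2 \<up> int N) \<cdot> (?a2 \<up> (m * s ^ N)) \<cdot> (?b2 \<up> int N) = ?a2 \<up> m"
    using steps_conj[OF GGb_rel[OF l0 m0 k2]] by simp
  moreover have "?a2 \<up> (m * s ^ N) = (?a2 \<up> x) \<up> (y * m)" by (simp add: pw_pw algebra_simps flip: xy)
  ultimately have am: "?a2 \<up> m \<in> ?S"
    using S ax b by (metis sgrp_gi sgrp_gm sgrp_pw)
  obtain u v where uv: "u * x + v * m = 1" using cop by (metis bezout_int coprime_iff_gcd_eq_1)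
  have "?a2 = ((?a2 \<up> x) \<up> u) \<cdot> ((?a2 \<up> m) \<up> v)"
    using uv by (simp add: pw_pw mult.commute flip: pw_add)
  then have "?a2 \<in> ?S" using S ax am by (metis sgrp_gm sgrp_pw)
  then have "GG l m k2 \<subseteq> ?S" by (rule GG_least[OF l0 m0 k2 S _ t])
  then show ?thesis using f by blast
qed

lemma scale_iso:
  assumes xy: "scale l m N (x * y) 1"
  shows "\<exists>f. ghom (GG l m k1) f \<and> bij_betw f (GG l m k1) (GG l m k2)"
proof -
  let ?a1 = "GGa l m k1" and ?t1 = "GGt l m k1" and ?b1 = "GGb l m k1"
  let ?a2 = "GGa l m k2" and ?t2 = "GGt l m k2" and ?b2 = "GGb l m k2"
  obtain f where f: "ghom (GG l m k1) f" "f ?a1 = ?a2 \<up> x" "f ?t1 = (?b2 \<up> p) \<cdot> ?t2" "f ?b1 = ?b2" "f ` GG l m k1 \<subseteq> GG l m k2"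
    using scale_hom .
  \<comment> \<open>The inverse map must send \<open>?a2\<close> to an \<open>x\<close>-th root of
    \<open>?a1\<close>. This is one, because \<open>?b1 \<up> N\<close> conjugates
    \<open>?a1 \<up> (x * y)\<close> to \<open>?a1\<close>; \<open>\<tau>\<close> solves for
    \<open>?t2\<close> in the same way.\<close>
  define \<alpha> where "\<alpha> = gi (?b1 \<up> N) \<cdot> (?a1 \<up> y) \<cdot> (?b1 \<up> N)"
  define \<tau> where "\<tau> = (?b1 \<up> (- p)) \<cdot> ?t1"
  note r1 = GGb_rel[OF l0 m0 k1] and r2 = GGb_rel[OF l0 m0 k2]
  have \<alpha>x: "\<alpha> \<up> x = ?a1"
    using scale_conj[OF r1 xy] unfolding \<alpha>_def pw_conj by (simp add: pw_pw mult.commute)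
  have c: "gi ?b1 \<cdot> gi (?b1 \<up> N) = gi (?b1 \<up> N) \<cdot> gi ?b1" "(?b1 \<up> N) \<cdot> ?b1 = ?b1 \<cdot> (?b1 \<up> N)"
    using commute_pw[of ?b1 ?b1 N] by (simp_all flip: gi_gm)
  have "gi ?b1 \<cdot> (\<alpha> \<up> l) \<cdot> ?b1 = (gi ?b1 \<cdot> gi (?b1 \<up> N)) \<cdot> ((?a1 \<up> y) \<up> l) \<cdot> ((?b1 \<up> N) \<cdot> ?b1)"
    unfolding \<alpha>_def pw_conj by simp
  also have "\<dots> = gi (?b1 \<up> N) \<cdot> (gi ?b1 \<cdot> ((?a1 \<up> y) \<up> l) \<cdot> ?b1) \<cdot> (?b1 \<up> N)"
    unfolding c by simp
  also have "\<dots> = \<alpha> \<up> m" unfolding conj_pw_rel[OF r1] by (simp add: \<alpha>_def pw_conj)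
  finally have r\<alpha>: "gi ?b1 \<cdot> (\<alpha> \<up> l) \<cdot> ?b1 = \<alpha> \<up> m" .
  have "gi (?b1 \<up> p) \<cdot> (\<alpha> \<up> (x * k1)) \<cdot> (?b1 \<up> p) = \<alpha> \<up> k2" by (rule scale_conj[OF r\<alpha> sc])
  then have k2_eq: "\<alpha> \<up> k2 = gi (?b1 \<up> p) \<cdot> (?a1 \<up> k1) \<cdot> (?b1 \<up> p)" by (simp add: \<alpha>x flip: pw_pw)
  have "gi \<tau> \<cdot> (\<alpha> \<up> k2) \<cdot> \<tau> = gi ?t1 \<cdot> (?a1 \<up> k1) \<cdot> ?t1"
    unfolding k2_eq \<tau>_def pw_minus by simp
  then have b\<tau>: "gi \<tau> \<cdot> (\<alpha> \<up> k2) \<cdot> \<tau> = ?b1" unfolding GGb_def .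
  have "relG l m k2 \<alpha> \<tau>" unfolding relG_def b\<tau> by (rule r\<alpha>)
  then obtain g where g: "ghom (GG l m k2) g" "g ?a2 = \<alpha>" "g ?t2 = \<tau>" using GG_universal[OF l0 m0 k2] by blast
  have gb: "g ?b2 = ?b1" using ghom_GGb[OF l0 m0 k2 g(1)] b\<tau> by (simp only: g)
  note G1 = GG_sgrp[OF l0 m0 k1] and G2 = GG_sgrp[OF l0 m0 k2]
  note in1 = GGa_in[OF l0 m0 k1] GGt_in[OF l0 m0 k1] GGb_in[OF l0 m0 k1]
  note in2 = GGa_in[OF l0 m0 k2] GGt_in[OF l0 m0 k2] GGb_in[OF l0 m0 k2]
  have gim: "g ` GG l m k2 \<subseteq> GG l m k1"
    by (rule GG_image_least[OF l0 m0 k2 g(1) G1])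
       (use G1 in1 in \<open>simp_all add: g \<alpha>_def \<tau>_def sgrp_pw sgrp_gm sgrp_gi\<close>)
  have id: "ghom S (\<lambda>x. x)" for S :: "gg set" by (simp add: ghom_def)
  have gf: "(g \<circ> f) z = z" if "z \<in> GG l m k1" for z
  proof (rule GG_ext[OF l0 m0 k1 ghom_comp[OF f(1) g(1) f(5)] id _ _ that])
    show "(g \<circ> f) ?a1 = ?a1" using in2 by (simp add: f ghom_pw[OF g(1) G2] g \<alpha>x)
    show "(g \<circ> f) ?t1 = ?t1" using in2
      by (simp add: f ghom_gm[OF g(1)] ghom_pw[OF g(1) G2] sgrp_pw[OF G2] g gb \<tau>_def pw_minus)
  qed
  have fg: "(f \<circ> g) z = z" if "z \<in> GG l m k2" for z
  proof (rule GG_ext[OF l0 m0 k2 ghom_comp[OF g(1) f(1) gim] id _ _ that])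
    have "f \<alpha> = gi (?b2 \<up> N) \<cdot> (?a2 \<up> (x * y)) \<cdot> (?b2 \<up> N)" using in1
      by (simp add: \<alpha>_def f ghom_gm[OF f(1)] ghom_gi[OF f(1) G1] ghom_pw[OF f(1) G1] sgrp_pw[OF G1] sgrp_gm[OF G1] sgrp_gi[OF G1] pw_pw)
    then show "(f \<circ> g) ?a2 = ?a2" using scale_conj[OF r2 xy] by (simp add: g)
    show "(f \<circ> g) ?t2 = ?t2" using in1
      by (simp add: g \<tau>_def f ghom_gm[OF f(1)] ghom_pw[OF f(1) G1] sgrp_pw[OF G1] pw_minus sgrp_gi[OF G1] ghom_gi[OF f(1) G1])
  qed
  have "bij_betw f (GG l m k1) (GG l m k2)"
    by (rule bij_betw_byWitness[of _ g]) (use gf fg f(5) gim in auto)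
  then show ?thesis using f(1) by blast
qed

end

lemma epi_data:
  fixes l m k1 k2 :: int
  assumes m: "m > 0" and lm: "\<bar>l\<bar> > m" and k1: "k1 \<noteq> 0" and k2: "k2 \<noteq> 0"
    and f: "ghom (GG l m k1) f" "f ` GG l m k1 = GG l m k2"
  obtains g x p where "g \<in> GG l m k2" "gi g \<cdot> f (GGa l m k1) \<cdot> g = GGa l m k2 \<up> x" "scale l m p (x * k1) k2"
    "\<And>q. prime q \<Longrightarrow> q dvd l \<Longrightarrow> q dvd m \<Longrightarrow> \<not> q dvd x"
proof -
  have l0: "l \<noteq> 0" and m0: "m \<noteq> 0" using m lm by auto
  let ?a = "GGa l m k2" and ?t = "GGt l m k2"
  note G1 = GG_sgrp[OF l0 m0 k1] and G2 = GG_sgrp[OF l0 m0 k2]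
  obtain H A1 A L1 L \<tau> where gbg: "gbg (GG l m k2) H ?a (gi ?t \<cdot> (?a \<up> k2) \<cdot> ?t) ?t A1 A L1 L l m \<tau> k2"
    using GG_gbg[OF l0 m0 k2] by blast
  interpret gbg_big "GG l m k2" H ?a "gi ?t \<cdot> (?a \<up> k2) \<cdot> ?t" ?t A1 A L1 L l m \<tau> k2
    unfolding gbg_big_def gbg_big_axioms_def using gbg m lm by blast
  have a: "f (GGa l m k1) \<in> GG l m k2" and t: "f (GGt l m k1) \<in> GG l m k2"
    using f(2) GGa_in[OF l0 m0 k1] GGt_in[OF l0 m0 k1] by blast+
  have r: "relG l m k1 (f (GGa l m k1)) (f (GGt l m k1))"
    by (rule ghom_relG[OF l0 m0 k1 f(1)])
  have gen: "GG l m k2 \<subseteq> S" if "sgrp S" "f (GGa l m k1) \<in> S" "f (GGt l m k1) \<in> S" for S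
    using GG_image_least[OF l0 m0 k1 f(1) that] f(2) by simp
  obtain g x p where g: "g \<in> GG l m k2" "gi g \<cdot> f (GGa l m k1) \<cdot> g = ?a \<up> x" "scale l m p (x * k1) k2"
    using generating_pair[OF a t k1 gen r[unfolded relG_def]] by blast
  have "\<not> q dvd x" if q: "prime q" "q dvd l" "q dvd m" for q
  proof
    assume qx: "q dvd x"
    have q0: "q > 0" using q prime_gt_0_int by blast
    \<comment> \<open>Since \<open>q\<close> divides \<open>l\<close> and \<open>m\<close>, the
      group maps onto Z/q times Z. If \<open>q\<close> divided \<open>x\<close>, the image of the
      first generator would vanish there and the second alone would generate a group that is not
      cyclic.\<close>
    define \<alpha> :: "int sym \<times> int" where "\<alpha> = (rot q 1, 0)"
    define \<tau>' :: "int sym \<times> int" where "\<tau>' = (ge, 1)"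
    have \<alpha>: "\<alpha> \<up> u = (rot q u, 0)" for u by (simp add: \<alpha>_def pw_prod rot_pw pw_int)
    have "\<alpha> \<up> l = ge" "\<alpha> \<up> m = ge" using q q0 by (simp_all add: \<alpha> rot_ge prod_grp int_grp)
    then have "relG l m k2 \<alpha> \<tau>'" by (simp add: relG_def)
    then obtain F where F: "ghom (GG l m k2) F" "F ?a = \<alpha>" "F ?t = \<tau>'" using GG_universal[OF l0 m0 k2] by blast
    have "F (?a \<up> x) = ge" using qx q0 GGa_in[OF l0 m0 k2]
      by (simp add: ghom_pw[OF F(1) G2] F \<alpha> rot_ge prod_grp int_grp)
    moreover have "f (GGa l m k1) = g \<cdot> (?a \<up> x) \<cdot> gi g" using g(2) unfolding conj_swap .
    ultimately have Fa: "F (f (GGa l m k1)) = ge" using g(1) GGa_in[OF l0 m0 k2]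
      by (simp add: ghom_gm[OF F(1)] ghom_gi[OF F(1) G2] sgrp_gm[OF G2] sgrp_gi[OF G2] sgrp_pw[OF G2])
    let ?C = "cyc (F (f (GGt l m k1)))"
    have "F ` GG l m k2 \<subseteq> ?C"
    proof -
      have "ghom (GG l m k1) (F \<circ> f)" using ghom_comp[OF f(1) F(1)] f(2) by simp
      then have "(F \<circ> f) ` GG l m k1 \<subseteq> ?C"
        by (rule GG_image_least[OF l0 m0 k1]) (use Fa cycI[of "F (f (GGt l m k1))" 0] cycI[of "F (f (GGt l m k1))" 1] in \<open>auto simp: sgrp_cyc\<close>)
      then show ?thesis unfolding f(2)[symmetric] image_comp .
    qed
    then have "\<alpha> \<in> ?C" "\<tau>' \<in> ?C" using F GGa_in[OF l0 m0 k2] GGt_in[OF l0 m0 k2] by (metis image_subset_iff)+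
    then obtain i j where ij: "\<alpha> = F (f (GGt l m k1)) \<up> i" "\<tau>' = F (f (GGt l m k1)) \<up> j" by (auto elim!: cycE)
    have "snd (F (f (GGt l m k1))) * i = 0" "snd (F (f (GGt l m k1))) * j = 1"
      using ij by (auto simp: \<alpha>_def \<tau>'_def pw_prod pw_int)
    then have "i = 0" by auto
    then have "rot q 1 = ge" using ij by (simp add: \<alpha>_def prod_grp)
    then have "q dvd 1" using q0 by (simp add: rot_ge)
    then show False using q not_prime_unit by blast
  qed
  then show ?thesis using that g by blast
qed

text \<open>The conjugator lies in \<open>H\<close>, so 1 and \<open>u\<close> are related by
  \<open>scale\<close>. Neither \<open>l\<close> nor \<open>m\<close> divides 1, so no step can
  start or end at 1 and the number of steps is 0.\<close>

lemma conj_pw_one: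
  fixes l m k u :: int
  assumes m: "m > 1" and lm: "\<bar>l\<bar> > m" and k: "k \<noteq> 0"
    and g: "g \<in> GG l m k" "gi g \<cdot> GGa l m k \<cdot> g = GGa l m k \<up> u"
  shows "u = 1"
proof -
  have l0: "l \<noteq> 0" and m0: "m \<noteq> 0" using m lm by auto
  let ?a = "GGa l m k" and ?t = "GGt l m k"
  obtain H A1 A L1 L \<tau> where gbg: "gbg (GG l m k) H ?a (gi ?t \<cdot> (?a \<up> k) \<cdot> ?t) ?t A1 A L1 L l m \<tau> k"
    using GG_gbg[OF l0 m0 k] by blast
  interpret gbg_big "GG l m k" H ?a "gi ?t \<cdot> (?a \<up> k) \<cdot> ?t" ?t A1 A L1 L l m \<tau> k
    unfolding gbg_big_def gbg_big_axioms_def using gbg m lm by auto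
  have c: "gi g \<cdot> (?a \<up> 1) \<cdot> g = ?a \<up> u" using g by simp
  have "g \<in> H" using a_pw_conj_a[OF g(1) _ c] by simp
  then have s: "scale l m (\<tau> g) 1 u" using inner.conj_scale c by blast
  have "\<not> m dvd 1" "\<not> l dvd 1" using m lm by auto
  have "\<tau> g = 0"
  proof (rule ccontr)
    assume "\<tau> g \<noteq> 0"
    then consider i where "(step l m ^^ Suc i) 1 u" | i where "(step l m ^^ Suc i) u 1"
      using s unfolding scale_def by (cases "\<tau> g > 0") (metis Suc_pred' zero_less_nat_eq less_le not_le neg_0_less_iff_less less_imp_le)+
    then show False
    proof cases
      case 1
      then obtain w where "step l m 1 w" using relpowp_Suc_E2 by metis
      then have "l dvd 1" unfolding step_def by (metis dvd_triv_left)
      then show False using \<open>\<not> l dvd 1\<close> by blast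
    next
      case 2
      then obtain w where "step l m w 1" by auto
      then have "m dvd 1" unfolding step_def by (metis dvd_triv_left)
      then show False using \<open>\<not> m dvd 1\<close> by blast
    qed
  qed
  then show ?thesis using s by simp
qed

section \<open>Finite representations of HNN extensions\<close>

text \<open>Stands for the symmetric group of \<open>Z\<close>, finite when \<open>Z\<close>
  is.\<close>

definition FS :: "'z set \<Rightarrow> 'z sym set" where
  "FS Z = {g. \<forall>z. z \<notin> Z \<longrightarrow> app g z = z}"

lemma FS_maps: "g \<in> FS Z \<Longrightarrow> app g z \<in> Z \<longleftrightarrow> z \<in> Z"
proof -
  assume g: "g \<in> FS Z"
  have "app g z = z" if "app g z \<notin> Z"
  proof -
    have "app g (app g z) = app g z" using g that unfolding FS_def by blast
    then show ?thesis by simp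
  qed
  moreover have "app g z = z" if "z \<notin> Z" using g that unfolding FS_def by blast
  ultimately show "app g z \<in> Z \<longleftrightarrow> z \<in> Z" by metis
qed

lemma sgrp_FS: "sgrp (FS Z)"
proof -
  have "gi g \<in> FS Z" if "g \<in> FS Z" for g :: "'a sym"
    using that unfolding FS_def by (simp add: app_gi_eq)
  then show ?thesis by (auto simp: sgrp_def FS_def)
qed

lemma finite_FS: assumes "finite Z" shows "finite (FS Z)"
proof (rule inj_on_finite)
  show "inj_on (\<lambda>g. restrict (app g) Z) (FS Z)"
  proof (rule inj_onI)
    fix g h assume *: "g \<in> FS Z" "h \<in> FS Z" "restrict (app g) Z = restrict (app h) Z"
    show "g = h"
    proof (rule sym_eqI)
      fix z show "app g z = app h z"
        using * by (cases "z \<in> Z") (auto simp: FS_def dest: fun_cong[of _ _ z])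
    qed
  qed
  show "(\<lambda>g. restrict (app g) Z) ` FS Z \<subseteq> (\<Pi>\<^sub>E z\<in>Z. Z)"
    by (auto simp: FS_maps)
  show "finite (\<Pi>\<^sub>E z\<in>Z. Z)" using assms by (simp add: finite_PiE)
qed

lemma finite_order:
  assumes S: "finite S" "sgrp S" and x: "x \<in> S"
  obtains N where "N > 0" "\<And>i. x \<up> i = ge \<longleftrightarrow> N dvd i"
proof -
  have "\<not> inj (\<lambda>n::nat. x \<up> int n)"
  proof
    assume "inj (\<lambda>n::nat. x \<up> int n)"
    moreover have "range (\<lambda>n::nat. x \<up> int n) \<subseteq> S" using sgrp_pw[OF S(2) x] by blast
    ultimately show False using S(1) by (meson finite_subset finite_imageD infinite_UNIV_nat)
  qed
  then obtain i j :: nat where ij: "i < j" "x \<up> int i = x \<up> int j"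
    unfolding inj_def by (metis linorder_neqE_nat)
  have "(x \<up> int i) \<cdot> (x \<up> int (j - i)) = x \<up> int j" using ij(1) by (simp add: of_nat_diff flip: pw_add)
  then have ex: "j - i > 0 \<and> x \<up> int (j - i) = ge" using ij by simp
  define n where "n = (LEAST n. n > 0 \<and> x \<up> int n = ge)"
  have n: "n > 0" "x \<up> int n = ge" using LeastI[of "\<lambda>n. n > 0 \<and> x \<up> int n = ge", OF ex] by (auto simp: n_def)
  have "x \<up> i = ge \<longleftrightarrow> int n dvd i" for i
  proof
    assume i: "x \<up> i = ge"
    have "x \<up> i = ((x \<up> int n) \<up> (i div int n)) \<cdot> (x \<up> (i mod int n))"
      unfolding pw_pw pw_add[symmetric] by simp
    then have m: "x \<up> (i mod int n) = ge" using i n by simp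
    have "\<not> nat (i mod int n) > 0"
    proof
      assume p: "nat (i mod int n) > 0"
      have "n \<le> nat (i mod int n)"
        using Least_le[of "\<lambda>n. n > 0 \<and> x \<up> int n = ge" "nat (i mod int n)", folded n_def] m p n by simp
      moreover have "i mod int n < int n" using n by simp
      ultimately show False using n by linarith
    qed
    moreover have "i mod int n \<ge> 0" using n by simp
    ultimately have "i mod int n = 0" by linarith
    then show "int n dvd i" by (rule mod_0_imp_dvd)
  next
    assume "int n dvd i"
    then obtain c where "i = int n * c" by blast
    then show "x \<up> i = ge" using n by (simp flip: pw_pw)
  qed
  then show ?thesis using that[of "int n"] n by simp
qed

lemma finite_exponent:
  assumes S: "finite S" "sgrp S"
  obtains e where "e > 0" "\<And>x i. x \<in> S \<Longrightarrow> e dvd i \<Longrightarrow> x \<up> i = ge"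
proof -
  have "\<forall>x\<in>S. \<exists>N>0. \<forall>i. x \<up> i = ge \<longleftrightarrow> N dvd i" using finite_order[OF S] by metis
  then obtain N where N: "\<And>x. x \<in> S \<Longrightarrow> N x > 0" "\<And>x i. x \<in> S \<Longrightarrow> x \<up> i = ge \<longleftrightarrow> N x dvd i" by metis
  have "prod N S > 0" by (rule prod_pos) (use N in blast)
  moreover have "x \<up> i = ge" if "x \<in> S" "prod N S dvd i" for x i
    using N(2)[OF that(1)] that dvd_prodI[OF S(1) that(1), of N] by (meson dvd_trans)
  ultimately show ?thesis using that by blast
qed

lemma app_pw_add: "app (q \<up> (i + j)) z = app (q \<up> i) (app (q \<up> j) z)"
  by (simp add: pw_add)

text \<open>A maximal set of points in distinct orbits that contains the prescribed ones meets every
  orbit. All orbits have exactly \<open>N\<close> points, so pairs of a representative and an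
  exponent below \<open>N\<close> are coordinates on \<open>Z\<close>.\<close>

lemma transversal:
  assumes Z: "finite Z" and q: "q \<in> FS Z" and N: "N > 0" "\<And>z i. z \<in> Z \<Longrightarrow> app (q \<up> i) z = z \<longleftrightarrow> N dvd i"
    and d: "d ` J \<subseteq> Z" "\<And>s s' i. s \<in> J \<Longrightarrow> s' \<in> J \<Longrightarrow> app (q \<up> i) (d s) = d s' \<Longrightarrow> s = s'"
  shows "\<exists>R. R \<subseteq> Z \<and> d ` J \<subseteq> R \<and> bij_betw (\<lambda>(r, i). app (q \<up> i) r) (R \<times> {0..<N}) Z \<and>
    (\<forall>z\<in>Z. \<exists>r\<in>R. \<exists>i. z = app (q \<up> i) r)"
proof -
  define P where "P = {R. R \<subseteq> Z \<and> d ` J \<subseteq> R \<and> (\<forall>r\<in>R. \<forall>r'\<in>R. \<forall>i. app (q \<up> i) r = r' \<longrightarrow> r = r')}"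
  have fin: "finite P" by (rule finite_subset[of _ "Pow Z"]) (use Z in \<open>auto simp: P_def\<close>)
  have mem: "d ` J \<in> P" using d by (auto simp: P_def)
  obtain R where RP: "R \<in> P" and max: "\<And>S. S \<in> P \<Longrightarrow> R \<subseteq> S \<Longrightarrow> R = S"
    using finite_has_maximal2[OF fin mem] by auto
  have R: "R \<subseteq> Z" "d ` J \<subseteq> R" "\<And>r r' i. r \<in> R \<Longrightarrow> r' \<in> R \<Longrightarrow> app (q \<up> i) r = r' \<Longrightarrow> r = r'"
    using RP unfolding P_def by blast+
  have qZ: "app (q \<up> i) z \<in> Z \<longleftrightarrow> z \<in> Z" for i z
    by (rule FS_maps[OF sgrp_pw[OF sgrp_FS q]])
  have orb: "\<exists>r\<in>R. \<exists>i. z = app (q \<up> i) r" if z: "z \<in> Z" for z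
  proof (rule ccontr)
    assume no: "\<not> ?thesis"
    have 1: "app (q \<up> i) z \<noteq> r" if "r \<in> R" for r i
    proof
      assume "app (q \<up> i) z = r"
      then have "z = app (q \<up> (- i)) r" by (simp add: pw_minus app_gi_eq)
      then show False using no that by metis
    qed
    have 2: "r \<noteq> app (q \<up> i) z" "z \<noteq> app (q \<up> i) r" if "r \<in> R" for r i
      using 1[OF that] no that by metis+
    have 3: "r = r'" if "r \<in> insert z R" "r' \<in> insert z R" "app (q \<up> i) r = r'" for r r' i
      using that R(3)[OF _ _ that(3)] 2(1)[of r' i] 2(2)[of r i] by auto
    have "insert z R \<in> P" unfolding P_def mem_Collect_eq
      using R(1,2) z 3 by (intro conjI ballI allI impI) blast+
    then have "z \<in> R" using max by blast
    then show False using 1[of z 0] by simp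
  qed
  have "bij_betw (\<lambda>(r, i). app (q \<up> i) r) (R \<times> {0..<N}) Z"
    unfolding bij_betw_def
  proof
    show "inj_on (\<lambda>(r, i). app (q \<up> i) r) (R \<times> {0..<N})"
    proof (rule inj_onI, clarsimp)
      fix r i r' j assume *: "r \<in> R" "r' \<in> R" "0 \<le> i" "i < N" "0 \<le> j" "j < N" "app (q \<up> i) r = app (q \<up> j) r'"
      have "app (q \<up> (i - j)) r = app (q \<up> (- j)) (app (q \<up> i) r)" by (simp flip: app_pw_add)
      also have "\<dots> = r'" unfolding *(7) by (simp flip: app_pw_add)
      finally have e: "app (q \<up> (i - j)) r = r'" .
      then have "r = r'" using R(3) * by blast
      moreover have "r \<in> Z" using R(1) * by blast
      ultimately have "N dvd i - j" using e N(2) by metis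
      then have "i mod N = j mod N" by (simp add: mod_eq_dvd_iff)
      then show "r = r' \<and> i = j" using * \<open>r = r'\<close> by simp
    qed
    show "(\<lambda>(r, i). app (q \<up> i) r) ` (R \<times> {0..<N}) = Z"
    proof
      show "(\<lambda>(r, i). app (q \<up> i) r) ` (R \<times> {0..<N}) \<subseteq> Z" using R(1) qZ by auto
      show "Z \<subseteq> (\<lambda>(r, i). app (q \<up> i) r) ` (R \<times> {0..<N})"
      proof
        fix z assume "z \<in> Z"
        then obtain r i where r: "r \<in> R" "z = app (q \<up> i) r" using orb by blast
        then have rZ: "r \<in> Z" using R(1) by blast
        have "app (q \<up> i) r = app (q \<up> (i mod N)) (app (q \<up> (N * (i div N))) r)" by (simp flip: app_pw_add)
        also have "app (q \<up> (N * (i div N))) r = r" using N(2)[OF rZ] by simp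
        finally have "z = (\<lambda>(r, i). app (q \<up> i) r) (r, i mod N)" using r by simp
        moreover have "(r, i mod N) \<in> R \<times> {0..<N}" using r N(1) by simp
        ultimately show "z \<in> (\<lambda>(r, i). app (q \<up> i) r) ` (R \<times> {0..<N})" by blast
      qed
    qed
  qed
  then show ?thesis using R(1,2) orb by (intro exI[of _ R] conjI ballI)
qed

text \<open>All orbits of \<open>q\<close> and of \<open>p\<close> on \<open>Z\<close> have length
  \<open>N\<close>, so there are equally many of them. Any bijection of transversals extending
  \<open>d s\<close> to \<open>w s\<close> then extends to a conjugating permutation.\<close>

lemma extend_equivariant:
  assumes Z: "finite Z" and q: "q \<in> FS Z" and p: "p \<in> FS Z" and N: "N > 0"
    and Nq: "\<And>z i. z \<in> Z \<Longrightarrow> app (q \<up> i) z = z \<longleftrightarrow> N dvd i"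
    and Np: "\<And>z i. z \<in> Z \<Longrightarrow> app (p \<up> i) z = z \<longleftrightarrow> N dvd i"
    and d: "d ` J \<subseteq> Z" "\<And>s s' i. s \<in> J \<Longrightarrow> s' \<in> J \<Longrightarrow> app (q \<up> i) (d s) = d s' \<Longrightarrow> s = s'"
    and w: "w ` J \<subseteq> Z" "\<And>s s' i. s \<in> J \<Longrightarrow> s' \<in> J \<Longrightarrow> app (p \<up> i) (w s) = w s' \<Longrightarrow> s = s'"
  shows "\<exists>\<tau>. \<tau> \<in> FS Z \<and> \<tau> \<cdot> q = p \<cdot> \<tau> \<and> (\<forall>s\<in>J. app \<tau> (d s) = w s)"
proof -
  have "\<exists>R. R \<subseteq> Z \<and> d ` J \<subseteq> R \<and> bij_betw (\<lambda>(r, i). app (q \<up> i) r) (R \<times> {0..<N}) Z \<and>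
    (\<forall>z\<in>Z. \<exists>r\<in>R. \<exists>i. z = app (q \<up> i) r)"
  proof (rule transversal)
    show "app (q \<up> i) z = z \<longleftrightarrow> N dvd i" if "z \<in> Z" for z i using that by (rule Nq)
    show "s = s'" if "s \<in> J" "s' \<in> J" "app (q \<up> i) (d s) = d s'" for s s' i using that by (rule d(2))
  qed (fact Z q N d(1))+
  then obtain R where R: "R \<subseteq> Z" "d ` J \<subseteq> R" "bij_betw (\<lambda>(r, i). app (q \<up> i) r) (R \<times> {0..<N}) Z"
    "\<forall>z\<in>Z. \<exists>r\<in>R. \<exists>i. z = app (q \<up> i) r" by (elim exE conjE)
  have "\<exists>R. R \<subseteq> Z \<and> w ` J \<subseteq> R \<and> bij_betw (\<lambda>(r, i). app (p \<up> i) r) (R \<times> {0..<N}) Z \<and>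
    (\<forall>z\<in>Z. \<exists>r\<in>R. \<exists>i. z = app (p \<up> i) r)"
  proof (rule transversal)
    show "app (p \<up> i) z = z \<longleftrightarrow> N dvd i" if "z \<in> Z" for z i using that by (rule Np)
    show "s = s'" if "s \<in> J" "s' \<in> J" "app (p \<up> i) (w s) = w s'" for s s' i using that by (rule w(2))
  qed (fact Z p N w(1))+
  then obtain Q where Q: "Q \<subseteq> Z" "w ` J \<subseteq> Q" "bij_betw (\<lambda>(r, i). app (p \<up> i) r) (Q \<times> {0..<N}) Z"
    by (elim exE conjE)
  have fin: "finite R" "finite Q" using R Q Z finite_subset by blast+
  have "card R * nat N = card Z" "card Q * nat N = card Z"
    using bij_betw_same_card[OF R(3)] bij_betw_same_card[OF Q(3)] by (simp_all add: card_cartesian_product)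
  then have card: "card R = card Q" using N by (metis mult_right_cancel zero_less_nat_eq less_numeral_extra(3))
  have injd: "inj_on d J" using d(2)[of _ _ 0] by (auto simp: inj_on_def)
  have injw: "inj_on w J" using w(2)[of _ _ 0] by (auto simp: inj_on_def)
  have "card (R - d ` J) = card (Q - w ` J)"
    using card fin R(2) Q(2) by (simp add: card_Diff_subset finite_subset card_image[OF injd] card_image[OF injw])
  then obtain \<beta>1 where \<beta>1: "bij_betw \<beta>1 (R - d ` J) (Q - w ` J)"
    using fin finite_same_card_bij by blast
  define \<beta> where "\<beta> r = (if r \<in> d ` J then w (inv_into J d r) else \<beta>1 r)" for r
  have \<beta>d: "\<beta> (d s) = w s" if "s \<in> J" for s using that injd by (simp add: \<beta>_def)
  have "bij_betw \<beta> (d ` J) (w ` J)"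
    unfolding bij_betw_def inj_on_def by (auto simp: \<beta>d image_image dest: inj_onD[OF injw] cong: image_cong)
  moreover have "bij_betw \<beta> (R - d ` J) (Q - w ` J)"
    using \<beta>1 by (rule bij_betw_cong[THEN iffD1, rotated]) (simp add: \<beta>_def)
  ultimately have "bij_betw \<beta> (d ` J \<union> (R - d ` J)) (w ` J \<union> (Q - w ` J))"
    by (rule bij_betw_combine) auto
  then have \<beta>: "bij_betw \<beta> R Q" using R(2) Q(2) by (simp add: Un_absorb1)
  let ?q = "\<lambda>(r, i). app (q \<up> i) r" and ?p = "\<lambda>(r, i). app (p \<up> i) r"
  define \<tau>0 where "\<tau>0 = ?p \<circ> map_prod \<beta> (\<lambda>i. i) \<circ> inv_into (R \<times> {0..<N}) ?q"
  have "bij_betw (map_prod \<beta> (\<lambda>i. i)) (R \<times> {0..<N}) (Q \<times> {0..<N})"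
    using bij_betw_map_prod[OF \<beta>, of "\<lambda>i. i" "{0..<N}" "{0..<N}"] by (simp add: bij_betw_def inj_on_def)
  then have \<tau>0: "bij_betw \<tau>0 Z Z"
    unfolding \<tau>0_def using bij_betw_inv_into[OF R(3)] Q(3) by (blast intro: bij_betw_trans)
  have \<tau>0q: "\<tau>0 (app (q \<up> i) r) = app (p \<up> i) (\<beta> r)" if r: "r \<in> R" for i r
  proof -
    have rZ: "r \<in> Z" "\<beta> r \<in> Z" using r R(1) Q(1) \<beta> by (auto simp: bij_betw_def)
    have i: "i = i mod N + N * (i div N)" by simp
    have "app (q \<up> i) r = app (q \<up> (i mod N)) (app (q \<up> (N * (i div N))) r)" by (simp flip: app_pw_add)
    then have 1: "app (q \<up> i) r = ?q (r, i mod N)" using Nq[OF rZ(1)] by simp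
    have "app (p \<up> i) (\<beta> r) = app (p \<up> (i mod N)) (app (p \<up> (N * (i div N))) (\<beta> r))" by (simp flip: app_pw_add)
    then have 2: "app (p \<up> i) (\<beta> r) = ?p (\<beta> r, i mod N)" using Np[OF rZ(2)] by simp
    have "(r, i mod N) \<in> R \<times> {0..<N}" using r N by simp
    then have "inv_into (R \<times> {0..<N}) ?q (?q (r, i mod N)) = (r, i mod N)"
      using R(3) by (meson bij_betw_imp_inj_on inv_into_f_f)
    then show ?thesis unfolding 1 2 by (simp add: \<tau>0_def)
  qed
  define \<tau> where "\<tau> = Sym (\<lambda>z. if z \<in> Z then \<tau>0 z else z)"
  have "bij_betw (\<lambda>z. if z \<in> Z then \<tau>0 z else z) (Z \<union> - Z) (Z \<union> - Z)"
    by (rule bij_betw_disjoint_Un[OF \<tau>0]) (auto simp: bij_betw_def)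
  then have app\<tau>: "app \<tau> = (\<lambda>z. if z \<in> Z then \<tau>0 z else z)"
    unfolding \<tau>_def by (intro app_Sym) simp
  have 1: "\<tau> \<in> FS Z" by (simp add: FS_def app\<tau>)
  have 2: "\<tau> \<cdot> q = p \<cdot> \<tau>"
  proof (rule sym_eqI)
    fix z
    show "app (\<tau> \<cdot> q) z = app (p \<cdot> \<tau>) z"
    proof (cases "z \<in> Z")
      case True
      then obtain r i where r: "r \<in> R" "z = app (q \<up> i) r" using R(4) by blast
      have "app q z = app (q \<up> (1 + i)) r" by (simp add: r pw_add)
      then have "\<tau>0 (app q z) = app (p \<up> (1 + i)) (\<beta> r)" using \<tau>0q[OF r(1)] by simp
      also have "\<dots> = app p (\<tau>0 z)" using \<tau>0q[OF r(1)] by (simp add: pw_add r(2))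
      finally show ?thesis using True q by (simp add: app\<tau> FS_maps)
    next
      case False
      then show ?thesis using p q by (simp add: app\<tau> FS_def)
    qed
  qed
  have "app \<tau> (d s) = w s" if "s \<in> J" for s
    using \<tau>0q[of "d s" 0] R(1,2) that by (auto simp: app\<tau> \<beta>d)
  then show ?thesis using 1 2 by (intro exI[of _ \<tau>] conjI ballI)
qed

text \<open>The left regular action on \<open>n + 1\<close> copies of \<open>R\<close>. It is free
  there, so all orbits of an element have the length of its order.\<close>

definition left_mult :: "'k::grp set \<Rightarrow> nat \<Rightarrow> 'k \<Rightarrow> ('k \<times> nat) sym" where
  "left_mult R n g = Sym (\<lambda>x. if x \<in> R \<times> {..n} then (g \<cdot> fst x, snd x) else x)"

lemma app_left_mult:
  assumes "sgrp R" "g \<in> R"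
  shows "app (left_mult R n g) x = (if x \<in> R \<times> {..n} then (g \<cdot> fst x, snd x) else x)"
proof -
  have "bij (\<lambda>x. if x \<in> R \<times> {..n} then (g \<cdot> fst x, snd x) else x)"
    using assms by (intro o_bij[of "\<lambda>x. if x \<in> R \<times> {..n} then (gi g \<cdot> fst x, snd x) else x"])
      (auto simp: fun_eq_iff sgrp_gm sgrp_gi)
  then show ?thesis by (simp add: left_mult_def app_Sym)
qed

lemma left_mult_hom: "sgrp R \<Longrightarrow> ghom R (left_mult R n)"
  unfolding ghom_def by (auto intro!: sym_eqI simp: app_left_mult sgrp_gm)

context hnn_base
begin

lemma vl_nth:
  "vl xs \<Longrightarrow> s < length xs \<Longrightarrow> fst (xs ! s) \<in> H \<and> rep (snd (xs ! s)) (fst (xs ! s)) = fst (xs ! s)"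
  by (induction xs arbitrary: s) (auto simp: nth_Cons split: nat.splits)

lemma vl_nth_Suc:
  "vl xs \<Longrightarrow> Suc s < length xs \<Longrightarrow> snd (xs ! Suc s) = (\<not> snd (xs ! s)) \<Longrightarrow> fst (xs ! Suc s) \<notin> A (snd (xs ! Suc s))"
proof (induction xs arbitrary: s)
  case (Cons x xs)
  show ?case
  proof (cases s)
    case 0
    then have "\<not> canc (snd x) xs" "xs ! 0 = hd xs" "xs \<noteq> []" using Cons by (auto simp: hd_conv_nth)
    then have "xs ! 0 \<noteq> (ge, \<not> snd x)" unfolding canc_def by (metis list.collapse)
    moreover have "snd (xs ! 0) = (\<not> snd x)" using Cons 0 by simp
    ultimately have "fst (xs ! 0) \<noteq> ge" by (simp add: prod_eq_iff)
    moreover have "rep (snd (xs ! 0)) (fst (xs ! 0)) = fst (xs ! 0)" using vl_nth[of xs 0] Cons \<open>xs \<noteq> []\<close> by auto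
    ultimately have "fst (xs ! 0) \<notin> A (snd (xs ! 0))" using rep_ge by metis
    then show ?thesis using 0 by simp
  next
    case (Suc j)
    then show ?thesis using Cons by simp
  qed
qed simp

text \<open>Copies \<open>R \<times> {0}, \<dots>, R \<times> {n}\<close> of a finite quotient \<open>R\<close> of \<open>H\<close> are joined by the stable letter
  along the normal form, so that the element moves copy \<open>n\<close> to copy \<open>0\<close>.\<close>
lemma finite_representation:
  fixes \<rho> :: "'h \<Rightarrow> 'k::grp"
  assumes A: "A True = cyc p" "A False = cyc q" and fp: "f True p = q"
    and \<rho>: "ghom H \<rho>" and fin: "finite (\<rho> ` H)"
    and order: "\<And>i. \<rho> p \<up> i = ge \<longleftrightarrow> \<rho> q \<up> i = ge"
    and x: "(xs, h) \<in> V"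
    and sep: "\<And>r e e'. (r, e) \<in> set xs \<Longrightarrow> r \<notin> A e' \<Longrightarrow> \<rho> r \<notin> \<rho> ` A e'"
  obtains F :: "_ \<Rightarrow> ('k \<times> nat) sym" where "ghom Gr F" "finite (F ` Gr)"
    "app (F (nf (xs, h))) (gi (\<rho> h), length xs) = (ge, 0)"
    "\<And>g z s. g \<in> H \<Longrightarrow> snd (app (F (hi g)) (z, s)) = s"
proof -
  define R where "R = \<rho> ` H"
  define n where "n = length xs"
  define Z where "Z = R \<times> {..n}"
  have R: "sgrp R" unfolding R_def by (rule sgrp_image[OF \<rho> sH])
  have Z: "finite Z" using fin by (simp add: Z_def R_def)
  have vl: "vl xs" and h: "h \<in> H" using x by (auto simp: V_def)
  have pq: "p \<in> H" "q \<in> H" using A AHD cycI[of _ 1] by (metis pw_1)+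
  define L where "L g = left_mult R n (\<rho> g)" for g
  have appL: "app (L g) (z, s) = (if z \<in> R \<and> s \<le> n then (\<rho> g \<cdot> z, s) else (z, s))" if "g \<in> H" for g z s
    using app_left_mult[OF R, of "\<rho> g" n "(z, s)"] that by (simp add: L_def R_def)
  have L_hom: "ghom H L"
    using ghom_comp[OF \<rho> left_mult_hom[OF R, of n]] by (simp add: R_def L_def[abs_def] comp_def)
  have L_FS: "L g \<in> FS Z" if "g \<in> H" for g using appL[OF that] by (auto simp: FS_def Z_def)
  have L_pw: "app (L g \<up> i) (z, s) = (if z \<in> R \<and> s \<le> n then (\<rho> g \<up> i \<cdot> z, s) else (z, s))" if "g \<in> H" for g i z s
    using appL[OF sgrp_pw[OF sH that], of i z s] that
    by (simp add: ghom_pw[OF L_hom sH] ghom_pw[OF \<rho> sH])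
  obtain N where N: "N > 0" "\<And>i. \<rho> p \<up> i = ge \<longleftrightarrow> N dvd i"
    using finite_order[OF fin[folded R_def] R, of "\<rho> p"] pq by (auto simp: R_def)
  have Np: "app (L p \<up> i) z = z \<longleftrightarrow> N dvd i" and Nq: "app (L q \<up> i) z = z \<longleftrightarrow> N dvd i" if "z \<in> Z" for z i
    using that L_pw[OF pq(1)] L_pw[OF pq(2)] N order by (auto simp: Z_def)
  define r where "r s = fst (xs ! s)" for s
  define e where "e s = snd (xs ! s)" for s
  have rs: "r s \<in> H" "(r s, e s) \<in> set xs" if "s < n" for s
    using vl_nth[OF vl] that by (auto simp: r_def e_def n_def)
  have rR: "gi (\<rho> (r s)) \<in> R" if "s < n" for s using rs[OF that] R sgrp_gi by (auto simp: R_def)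
  have geR: "ge \<in> R" by (rule sgrp_ge[OF R])
  have nA: "\<rho> (r (Suc s)) \<notin> \<rho> ` A (e (Suc s))" if "Suc s < n" "e (Suc s) = (\<not> e s)" for s
    using sep[OF rs(2)[OF that(1)]] vl_nth_Suc[OF vl, of s] that by (simp add: r_def e_def n_def)
  have pwA: "\<rho> p \<up> i \<in> \<rho> ` A True" "\<rho> q \<up> i \<in> \<rho> ` A False" for i
    using pq by (auto simp: A simp flip: ghom_pw[OF \<rho> sH])
  \<comment> \<open>Prescribed points of different positions can share an orbit only at neighbouring
    letters of opposite sign, and only if the coefficient between them is a pinch in the quotient;
    \<open>sep\<close> excludes that.\<close>
  have stuck: False if "s = Suc s'" "s < n" "e s = (\<not> e s')" "\<rho> c \<up> i \<cdot> gi (\<rho> (r s)) = ge" "c = (if e s then p else q)" for s s' i c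
  proof -
    have "\<rho> (r s) = \<rho> c \<up> i" using that(4) by (metis gi_gi gi_unique gm_assoc gi_left gi_right ge_left ge_right gi_shift)
    then show False using nA[of s'] that pwA[of i] by (auto split: if_splits)
  qed
  have stuck': False if "s = Suc s'" "s < n" "e s = (\<not> e s')" "\<rho> c \<up> i = gi (\<rho> (r s))" "c = (if e s then p else q)" for s s' i c
    using stuck[OF that(1,2,3) _ that(5), of "- i"] that(4) by (simp add: pw_minus)
  \<comment> \<open>\<open>\<tau>\<close> will take \<open>d s\<close> to \<open>w s\<close>. The
    letter at position \<open>s\<close> then leads from \<open>(ge, Suc s)\<close> to
    \<open>(gi (\<rho> (r s)), s)\<close>, which its coefficient moves to \<open>(ge, s)\<close>;
    for a negative letter \<open>\<tau>\<close> itself is prescribed in the opposite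
    direction.\<close>
  define d where "d s = (if e s then (ge, Suc s) else (gi (\<rho> (r s)), s))" for s
  define w where "w s = (if e s then (gi (\<rho> (r s)), s) else (ge, Suc s))" for s
  have dwZ: "d ` {..<n} \<subseteq> Z" "w ` {..<n} \<subseteq> Z" using rR geR by (auto simp: d_def w_def Z_def)
  have dd: "s = s'" if s: "s \<in> {..<n}" "s' \<in> {..<n}" and eq: "app (L q \<up> i) (d s) = d s'" for s s' i
  proof -
    have "\<not> (e s \<and> \<not> e s')"
    proof
      assume c: "e s \<and> \<not> e s'"
      then have "s' = Suc s" "\<rho> q \<up> i = gi (\<rho> (r s'))" using s eq geR by (auto simp: d_def L_pw[OF pq(2)])
      then show False using stuck'[of s' s q i] s c by simp
    qed
    moreover have "\<not> (\<not> e s \<and> e s')"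
    proof
      assume c: "\<not> e s \<and> e s'"
      then have "s = Suc s'" "\<rho> q \<up> i \<cdot> gi (\<rho> (r s)) = ge" using s eq rR[of s] by (auto simp: d_def L_pw[OF pq(2)])
      then show False using stuck[of s s' q i] s c by simp
    qed
    ultimately show ?thesis using s eq rR geR by (auto simp: d_def L_pw[OF pq(2)] split: if_splits)
  qed
  have ww: "s = s'" if s: "s \<in> {..<n}" "s' \<in> {..<n}" and eq: "app (L p \<up> i) (w s) = w s'" for s s' i
  proof -
    have "\<not> (\<not> e s \<and> e s')"
    proof
      assume c: "\<not> e s \<and> e s'"
      then have "s' = Suc s" "\<rho> p \<up> i = gi (\<rho> (r s'))" using s eq geR by (auto simp: w_def L_pw[OF pq(1)])
      then show False using stuck'[of s' s p i] s c by simp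
    qed
    moreover have "\<not> (e s \<and> \<not> e s')"
    proof
      assume c: "e s \<and> \<not> e s'"
      then have "s = Suc s'" "\<rho> p \<up> i \<cdot> gi (\<rho> (r s)) = ge" using s eq rR[of s] by (auto simp: w_def L_pw[OF pq(1)])
      then show False using stuck[of s s' p i] s c by simp
    qed
    ultimately show ?thesis using s eq rR geR by (auto simp: w_def L_pw[OF pq(1)] split: if_splits)
  qed
  have "\<exists>\<tau>. \<tau> \<in> FS Z \<and> \<tau> \<cdot> L q = L p \<cdot> \<tau> \<and> (\<forall>s\<in>{..<n}. app \<tau> (d s) = w s)"
  proof (rule extend_equivariant)
    show "L q \<in> FS Z" "L p \<in> FS Z" using L_FS pq by simp_all
    show "app (L q \<up> i) z = z \<longleftrightarrow> N dvd i" if "z \<in> Z" for z i using that by (rule Nq)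
    show "app (L p \<up> i) z = z \<longleftrightarrow> N dvd i" if "z \<in> Z" for z i using that by (rule Np)
    show "s = s'" if "s \<in> {..<n}" "s' \<in> {..<n}" "app (L q \<up> i) (d s) = d s'" for s s' i using that by (rule dd)
    show "s = s'" if "s \<in> {..<n}" "s' \<in> {..<n}" "app (L p \<up> i) (w s) = w s'" for s s' i using that by (rule ww)
  qed (fact Z N(1) dwZ)+
  then obtain \<tau> where \<tau>: "\<tau> \<in> FS Z" "\<tau> \<cdot> L q = L p \<cdot> \<tau>" "\<forall>s\<in>{..<n}. app \<tau> (d s) = w s"
    by (elim exE conjE)
  have te: "app (te \<tau> (e s)) (ge, Suc s) = (gi (\<rho> (r s)), s)" if "s < n" for s
    using bspec[OF \<tau>(3), of s] that by (auto simp: d_def w_def te_def app_gi_eq split: if_splits)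
  have Lpq: "gi \<tau> \<cdot> L p \<cdot> \<tau> = L q" using \<tau>(2) unfolding gi_shift by simp
  have Lpw: "L (p \<up> i) \<cdot> \<tau> = \<tau> \<cdot> L (q \<up> i)" for i
    using pw_conj[of \<tau> "L p" i] pq unfolding Lpq by (simp add: ghom_pw[OF L_hom sH] gi_shift)
  have "ghom (A True) (f True)" using f_gm by (simp add: ghom_def)
  moreover have "p \<in> A True" using A cycI[of p 1] by simp
  ultimately have fpw: "f True (p \<up> i) = q \<up> i" for i using ghom_pw[OF _ sA] fp by metis
  have fqw: "f False (q \<up> i) = p \<up> i" for i using f_f[of "p \<up> i" True] fpw A by simp
  have rel: "L c \<cdot> te \<tau> s = te \<tau> s \<cdot> L (f s c)" if c: "c \<in> A s" for c s
  proof (cases s)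
    case True
    then show ?thesis using c Lpw fpw by (auto simp: A elim!: cycE)
  next
    case False
    then obtain i where i: "c = q \<up> i" using c by (auto simp: A elim!: cycE)
    have "gi \<tau> \<cdot> L (p \<up> i) \<cdot> \<tau> = L (q \<up> i)" using Lpw by (simp add: gi_shift)
    then show ?thesis using False by (simp add: i fqw) (metis gm_assoc gi_right ge_right)
  qed
  obtain F where F: "ghom Gr F" "\<And>g. g \<in> H \<Longrightarrow> F (hi g) = L g" "F tt = \<tau>"
    using universal[OF L_hom rel] by blast
  have tt: "tt \<in> Gr" using te_Gr[of True] by simp
  have Fevl: "F (evl hi tt ys) = evl L \<tau> ys" if "vl ys" for ys
    using that
  proof (induction ys)
    case Nil then show ?case using ghom_ge[OF F(1) sGr] by simp
  next
    case (Cons y ys)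
    then show ?case
      by (simp add: ghom_gm[OF F(1)] hi_Gr te_Gr evl_Gr Gr_gm F ghom_te[OF F(1) sGr tt])
  qed
  have path: "s \<le> n \<Longrightarrow> app (evl L \<tau> (drop s xs)) (ge, n) = (ge, s)" for s
  proof (induction rule: inc_induct)
    case base then show ?case by (simp add: n_def)
  next
    case (step s)
    have "drop s xs = (r s, e s) # drop (Suc s) xs"
      using step(2) by (simp add: r_def e_def n_def Cons_nth_drop_Suc)
    then show ?case using step rs[of s] rR[of s] by (simp add: te appL)
  qed
  have "app (F (nf (xs, h))) (gi (\<rho> h), n) = (ge, 0)"
  proof -
    have "F (nf (xs, h)) = evl L \<tau> xs \<cdot> L h"
      using vl h by (simp add: ev_def ghom_gm[OF F(1)] evl_Gr hi_Gr Fevl F)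
    moreover have "gi (\<rho> h) \<in> R" using h R sgrp_gi by (auto simp: R_def)
    ultimately show ?thesis using path[of 0] h by (simp add: appL)
  qed
  moreover have "finite (F ` Gr)"
  proof (rule finite_subset)
    have "F g \<in> FS Z" if "g \<in> Gr" for g
      using that
    proof (induction rule: Gr.induct)
      case Gr_ge then show ?case using ghom_ge[OF F(1) sGr] sgrp_ge[OF sgrp_FS] by simp
    next
      case (Gr_hi g h)
      then show ?case by (simp add: ghom_gm[OF F(1)] hi_Gr F L_FS sgrp_gm[OF sgrp_FS])
    next
      case (Gr_te g e)
      then show ?case
        by (simp add: ghom_gm[OF F(1)] te_Gr F ghom_te[OF F(1) sGr tt] sgrp_gm[OF sgrp_FS] sgrp_te[OF sgrp_FS \<tau>(1)])
    qed
    then show "F ` Gr \<subseteq> FS Z" by blast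
    show "finite (FS Z)" by (rule finite_FS[OF Z])
  qed
  moreover have "snd (app (F (hi g)) (z, s)) = s" if "g \<in> H" for g z s
    using that by (simp add: F appL)
  ultimately show ?thesis using that F(1) by (simp add: n_def)
qed

end

section \<open>Residual finiteness when l and m agree up to sign\<close>

text \<open>Inversion on Z/M; it represents \<open>b\<close> when \<open>l = - m\<close>.\<close>

definition mirror :: "int \<Rightarrow> int sym" where
  "mirror M = Sym (\<lambda>i. if 0 \<le> i \<and> i < M then (- i) mod M else i)"

lemma app_mirror: "app (mirror M) i = (if 0 \<le> i \<and> i < M then (- i) mod M else i)"
proof -
  have "bij (\<lambda>i. if 0 \<le> i \<and> i < M then (- i) mod M else i)"
    by (rule o_bij[of "\<lambda>i. if 0 \<le> i \<and> i < M then (- i) mod M else i"]) (auto simp: fun_eq_iff mod_minus_eq)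
  then show ?thesis by (simp add: mirror_def app_Sym)
qed

lemma mirror_mirror [simp]: "mirror M \<cdot> mirror M = ge"
  by (rule sym_eqI) (auto simp: app_mirror mod_minus_eq)

lemma mirror_rot: "mirror M \<cdot> rot M j \<cdot> mirror M = rot M (- j)"
proof (rule sym_eqI)
  fix i
  have "- ((- i mod M + j) mod M) mod M = (i - j) mod M"
    by (metis add.commute diff_conv_add_uminus minus_diff_eq mod_add_left_eq mod_minus_eq)
  then show "app (mirror M \<cdot> rot M j \<cdot> mirror M) i = app (rot M (- j)) i"
    by (auto simp: app_mirror app_rot)
qed

lemma rot_FS: "rot M j \<in> FS {0..<M}" and mirror_FS: "mirror M \<in> FS {0..<M}"
  by (auto simp: FS_def app_rot app_mirror)

context
  fixes l m :: int
  assumes l0: "l \<noteq> 0" and m0: "m \<noteq> 0"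
begin

lemma BS_bs: obtains A L \<tau> where "bs (BS l m) (BSa l m) (BSb l m) A L l m \<tau>"
  using bs_BS[OF l0 m0] by blast

lemma sBS: "sgrp (BS l m)" and BSa_BS: "BSa l m \<in> BS l m" and BSb_BS: "BSb l m \<in> BS l m"
proof -
  obtain A L \<tau> where "bs (BS l m) (BSa l m) (BSb l m) A L l m \<tau>" by (rule BS_bs)
  then interpret bs "BS l m" "BSa l m" "BSb l m" A L l m \<tau> .
  show "sgrp (BS l m)" "BSa l m \<in> BS l m" "BSb l m \<in> BS l m" using sG aG[of 1] tG by simp_all
qed

lemma BS_image_least:
  assumes f: "ghom (BS l m) f" and S: "sgrp S" "f (BSa l m) \<in> S" "f (BSb l m) \<in> S"
  shows "f ` BS l m \<subseteq> S"
proof -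
  let ?S = "{x \<in> BS l m. f x \<in> S}"
  note G = sBS
  have "sgrp ?S" unfolding sgrp_def
    using f S by (auto simp: ghom_gm ghom_gi[OF _ G] ghom_ge[OF _ G] sgrp_gm[OF G] sgrp_gi[OF G] sgrp_ge[OF G] sgrp_gm sgrp_gi sgrp_ge)
  then have "BS l m \<subseteq> ?S"
    by (rule BS_least[OF l0 m0]) (use S BSa_BS BSb_BS in auto)
  then show ?thesis by blast
qed

text \<open>Both associated subgroups consist of the multiples of \<open>m\<close>, and reduction
  modulo \<open>\<bar>m\<bar>\<close> keeps everything else away from them. In the resulting
  representation powers of \<open>a\<close> preserve each copy, while \<open>x\<close> moves a point
  to another copy.\<close>

lemma BS_not_in_a:
  assumes lm: "\<bar>l\<bar> = \<bar>m\<bar>" and x: "x \<in> BS l m" "x \<notin> cyc (BSa l m)"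
  shows "\<exists>F :: bsg \<Rightarrow> (int sym \<times> nat) sym. ghom (BS l m) F \<and> finite (F ` BS l m) \<and> F x \<notin> cyc (F (BSa l m))"
proof -
  interpret hnn_base UNIV "bsA l m" "bsf l m" by (rule hnn_base_bs[OF l0 m0])
  have Gr: "Gr = BS l m" by (simp add: BS_def)
  obtain xs h where xh: "app x x0 = (xs, h)" by fastforce
  have V: "(xs, h) \<in> V" using Gr_V[OF _ x0_V, of x] x xh Gr by simp
  have nf: "nf (xs, h) = x" using nf_app[of x] x xh Gr by simp
  have "xs \<noteq> []"
  proof
    assume "xs = []"
    then have "x = hi h" using nf by (simp add: ev_def)
    then show False using x(2) hi_eq[OF l0 m0, of h] by simp
  qed
  let ?q = "\<bar>m\<bar>"
  have q: "?q > 0" using m0 by simp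
  have A: "bsA l m True = cyc l" "bsA l m False = cyc m" by (simp_all add: bsA_def cyc_def pw_int)
  have dvdA: "r \<in> bsA l m e \<longleftrightarrow> m dvd r" for r e
  proof -
    have "l dvd r \<longleftrightarrow> m dvd r" using lm by (metis abs_dvd_iff)
    moreover have "r \<in> bsA l m True \<longleftrightarrow> l dvd r" "r \<in> bsA l m False \<longleftrightarrow> m dvd r" by (auto simp: bsA_def)
    ultimately show ?thesis by (cases e) auto
  qed
  have rot_A: "rot ?q r = ge \<longleftrightarrow> r \<in> bsA l m e" for r e
    using q by (simp add: rot_ge dvdA)
  have "rot ?q j = rot ?q (j mod ?q)" for j
    by (rule sym_eqI) (simp add: app_rot mod_simps)
  then have "range (rot ?q) \<subseteq> rot ?q ` {0..<?q}" using q by (metis (no_types, lifting) atLeastLessThan_iff imageI image_subsetI pos_mod_bound pos_mod_sign)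
  then have fin: "finite (range (rot ?q))" by (rule finite_subset) simp
  have lm1: "rot ?q l = ge" "rot ?q m = ge" using rot_A[of l True] rot_A[of m False] by (simp_all add: dvdA) (metis lm abs_dvd_iff dvd_refl)
  obtain F :: "bsg \<Rightarrow> (int sym \<times> nat) sym" where F: "ghom Gr F" "finite (F ` Gr)"
    "app (F (nf (xs, h))) (gi (rot ?q h), length xs) = (ge, 0)"
    "\<And>g z s. g \<in> UNIV \<Longrightarrow> snd (app (F (hi g)) (z, s)) = s"
  proof (rule finite_representation[OF A, of "rot ?q" xs h])
    show "bsf l m True l = m" using l0 by (simp add: bsf_def)
    show "ghom UNIV (rot ?q)" by (rule rot_hom)
    show "rot ?q l \<up> i = ge \<longleftrightarrow> rot ?q m \<up> i = ge" for i by (simp add: lm1)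
    show "rot ?q r \<notin> rot ?q ` bsA l m e'" if "r \<notin> bsA l m e'" for r e'
      using that rot_A by (metis imageE)
  qed (use fin V in auto)
  have "F x \<noteq> F (BSa l m) \<up> i" for i
  proof
    assume eq: "F x = F (BSa l m) \<up> i"
    have "F (BSa l m) \<up> i = F (hi i)"
      using ghom_pw[OF F(1)] sBS BSa_BS by (simp add: Gr hi_eq[OF l0 m0])
    then have "snd (app (F x) (gi (rot ?q h), length xs)) = length xs" using F(4) eq by simp
    then show False using F(3) nf \<open>xs \<noteq> []\<close> by simp
  qed
  then show ?thesis using F(1,2) unfolding Gr by (auto elim!: cycE)
qed

end

text \<open>A product of permutations over an index set, as one permutation; the type stays the same
  however many factors there are.\<close>

definition block :: "'c set \<Rightarrow> ('c \<Rightarrow> 'y sym) \<Rightarrow> ('c \<times> 'y) sym" where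
  "block C \<phi> = Sym (\<lambda>x. if fst x \<in> C then (fst x, app (\<phi> (fst x)) (snd x)) else x)"

lemma app_block: "app (block C \<phi>) x = (if fst x \<in> C then (fst x, app (\<phi> (fst x)) (snd x)) else x)"
proof -
  have "bij (\<lambda>x. if fst x \<in> C then (fst x, app (\<phi> (fst x)) (snd x)) else x)"
    by (rule o_bij[of "\<lambda>x. if fst x \<in> C then (fst x, app (gi (\<phi> (fst x))) (snd x)) else x"])
      (auto simp: fun_eq_iff)
  then show ?thesis by (simp add: block_def app_Sym)
qed

lemma block_hom:
  assumes "\<And>c. c \<in> C \<Longrightarrow> ghom S (F c)" shows "ghom S (\<lambda>x. block C (\<lambda>c. F c x))"
  unfolding ghom_def by (auto intro!: sym_eqI simp: app_block ghom_gm[OF assms])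

lemma block_eq: "block C \<phi> = block C \<psi> \<Longrightarrow> c \<in> C \<Longrightarrow> \<phi> c = \<psi> c"
  by (rule sym_eqI) (metis app_block fst_conv snd_conv)

lemma block_finite:
  assumes "finite C" "\<And>c. c \<in> C \<Longrightarrow> finite (F c ` S)"
  shows "finite ((\<lambda>x. block C (\<lambda>c. F c x)) ` S)"
proof (rule finite_subset)
  have "block C (\<lambda>c. F c x) = block C (\<lambda>c\<in>C. F c x)" for x
    by (rule sym_eqI) (simp add: app_block)
  then show "(\<lambda>x. block C (\<lambda>c. F c x)) ` S \<subseteq> block C ` (\<Pi>\<^sub>E c\<in>C. F c ` S)"
    by (auto intro!: image_eqI)
  show "finite (block C ` (\<Pi>\<^sub>E c\<in>C. F c ` S))" using assms by (simp add: finite_PiE)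
qed

text \<open>An element outside \<open>\<langle>b\<rangle>\<close> either fails to commute with \<open>b\<close>, which a finite quotient detects,
  or is of the form \<open>b\<^sup>u a\<^sup>v\<close> with \<open>v \<noteq> 0\<close>. The last two components equalise the orders of the images
  of \<open>a\<^sup>k\<close> and \<open>b\<close>.\<close>
lemma finite_separation:
  fixes l m k :: int
  assumes m: "m > 0" and lm: "\<bar>l\<bar> = m" and k: "k > 0" and X: "finite X" "X \<subseteq> BS l m"
  obtains \<rho> :: "bsg \<Rightarrow> (bsg \<times> int sym \<times> nat) sym \<times> int sym \<times> int sym" where
    "ghom (BS l m) \<rho>" "finite (\<rho> ` BS l m)" "\<And>i. \<rho> (BSa l m \<up> k) \<up> i = ge \<longleftrightarrow> \<rho> (BSb l m) \<up> i = ge"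
    "\<And>x. x \<in> X \<Longrightarrow> x \<notin> cyc (BSa l m \<up> k) \<Longrightarrow> \<rho> x \<notin> cyc (\<rho> (BSa l m \<up> k))"
    "\<And>x. x \<in> X \<Longrightarrow> x \<notin> cyc (BSb l m) \<Longrightarrow> \<rho> x \<notin> cyc (\<rho> (BSb l m))"
    "\<And>x. x \<in> X \<Longrightarrow> x \<noteq> ge \<Longrightarrow> \<rho> x \<noteq> ge"
proof -
  have l0: "l \<noteq> 0" and m0: "m \<noteq> 0" using m lm by auto
  let ?a = "BSa l m" and ?b = "BSb l m" and ?S = "BS l m"
  obtain A L \<tau> where bs: "bs ?S ?a ?b A L l m \<tau>" by (rule BS_bs[OF l0 m0])
  interpret bs "BS l m" "BSa l m" "BSb l m" A L l m \<tau> by (rule bs)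
  have aS: "?a \<in> ?S" using aG[of 1] by simp
  \<comment> \<open>The commutator with \<open>?b\<close>. It dies in any quotient where
    \<open>x\<close> becomes a power of \<open>?b\<close>, so it has to be detected as well.\<close>
  define com where "com x = gi x \<cdot> gi ?b \<cdot> x \<cdot> ?b" for x
  have comS: "com x \<in> ?S" if "x \<in> ?S" for x using that tG by (simp add: com_def G_closed)
  define C where "C = {c \<in> X \<union> com ` X. c \<notin> cyc ?a}"
  have C: "finite C" "C \<subseteq> ?S" using X comS by (auto simp: C_def)
  have "\<forall>c\<in>C. \<exists>F :: bsg \<Rightarrow> (int sym \<times> nat) sym. ghom ?S F \<and> finite (F ` ?S) \<and> F c \<notin> cyc (F ?a)"
    using BS_not_in_a[OF l0 m0] lm m C by (auto simp: C_def)
  then obtain F :: "bsg \<Rightarrow> bsg \<Rightarrow> (int sym \<times> nat) sym" where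
    F: "\<And>c. c \<in> C \<Longrightarrow> ghom ?S (F c) \<and> finite (F c ` ?S) \<and> F c c \<notin> cyc (F c ?a)" by metis
  define \<rho>0 where "\<rho>0 x = block C (\<lambda>c. F c x)" for x
  have \<rho>0: "ghom ?S \<rho>0" unfolding \<rho>0_def[abs_def] by (rule block_hom) (use F in blast)
  have fin0: "finite (\<rho>0 ` ?S)" unfolding \<rho>0_def[abs_def] by (rule block_finite[OF C(1)]) (use F in blast)
  have sep0: "\<rho>0 c \<noteq> \<rho>0 ?a \<up> i" if c: "c \<in> C" for c i
  proof
    assume "\<rho>0 c = \<rho>0 ?a \<up> i"
    then have "\<rho>0 c = \<rho>0 (?a \<up> i)" using ghom_pw[OF \<rho>0 sG aS] by simp
    then have "F c c = F c (?a \<up> i)" unfolding \<rho>0_def by (rule block_eq[OF _ c])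
    then show False using F[OF c] ghom_pw[OF _ sG aS, of "F c" i] by auto
  qed
  obtain e0 where e0: "e0 > 0" "\<And>x i. x \<in> \<rho>0 ` ?S \<Longrightarrow> e0 dvd i \<Longrightarrow> x \<up> i = ge"
    using finite_exponent[OF fin0 sgrp_image[OF \<rho>0 sG]] by metis
  \<comment> \<open>Exponents of elements of the form b^u a^v. Other elements receive arbitrary
    values, which merely enlarge the bound \<open>W\<close>.\<close>
  define u where "u x = (SOME u. \<exists>v. x = (?b \<up> u) \<cdot> (?a \<up> v))" for x
  define v where "v x = (SOME v. \<exists>u. x = (?b \<up> u) \<cdot> (?a \<up> v))" for x
  have uv: "u x = i \<and> v x = j" if x: "x = (?b \<up> i) \<cdot> (?a \<up> j)" for x i j
  proof -
    have \<tau>u: "\<tau> ((?b \<up> i') \<cdot> (?a \<up> j')) = i'" for i' j'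
      using \<tau>_gm[OF bG aG] by (simp add: \<tau>_apw \<tau>_bpw)
    have unique: "i = i' \<and> j = j'" if "x = (?b \<up> i') \<cdot> (?a \<up> j')" for i' j'
      using \<tau>u[of i j] \<tau>u[of i' j'] that x a_inj by auto
    have "\<exists>j'. x = (?b \<up> u x) \<cdot> (?a \<up> j')" unfolding u_def by (rule someI[of _ i]) (use x in blast)
    moreover have "\<exists>i'. x = (?b \<up> i') \<cdot> (?a \<up> v x)" unfolding v_def by (rule someI[of _ j]) (use x in blast)
    ultimately show ?thesis using unique by blast
  qed
  define Y where "Y = X \<union> com ` X"
  define W where "W = 1 + (\<Sum>x\<in>Y. \<bar>u x\<bar> + \<bar>v x\<bar>)"
  have W: "\<bar>u x\<bar> < W" "\<bar>v x\<bar> < W" if "x \<in> Y" for x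
  proof -
    have "\<bar>u x\<bar> + \<bar>v x\<bar> \<le> (\<Sum>x\<in>Y. \<bar>u x\<bar> + \<bar>v x\<bar>)"
      using X(1) that by (intro member_le_sum) (auto simp: Y_def)
    then show "\<bar>u x\<bar> < W" "\<bar>v x\<bar> < W" by (auto simp: W_def)
  qed
  have W0: "W > 0" using X(1) by (simp add: W_def sum_nonneg add_pos_nonneg)
  \<comment> \<open>\<open>N\<close> will be the common order of the images of
    \<open>?a \<up> k\<close> and \<open>?b\<close>. The factor \<open>e0\<close> absorbs the orders
    under \<open>\<rho>0\<close>, the 2 absorbs that of the reflection, and \<open>W\<close> keeps
    the occurring exponents nonzero modulo \<open>N\<close>. A rotation of order
    \<open>M = k * N\<close> for \<open>?a\<close> gives \<open>?a \<up> k\<close> order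
    \<open>N\<close>.\<close>
  define N where "N = 2 * e0 * W"
  define M where "M = k * N"
  have N: "N > 0" "W \<le> N" "2 dvd N" "e0 dvd N" using e0(1) W0 by (auto simp: N_def)
  have M: "M > 0" "N \<le> M" using N k by (auto simp: M_def)
  \<comment> \<open>With \<open>?a\<close> a rotation, the relation asks \<open>?b\<close> to
    commute with it if \<open>l = m\<close> and may be met by inverting it if
    \<open>l = - m\<close>.\<close>
  define \<beta> where "\<beta> = (if l = m then ge else mirror M)"
  have \<beta>\<beta>: "\<beta> \<cdot> \<beta> = ge" by (simp add: \<beta>_def)
  have \<beta>pw: "\<beta> \<up> i = ge" if i: "2 dvd i" for i
  proof -
    obtain j where "i = 2 * j" using i by blast
    moreover have "\<beta> \<up> 2 = ge" using pw_Suc[of \<beta> 1] \<beta>\<beta> by simp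
    ultimately show ?thesis by (simp flip: pw_pw)
  qed
  have \<beta>gi: "gi \<beta> = \<beta>" by (rule gi_unique[OF \<beta>\<beta>])
  have "gi \<beta> \<cdot> (rot M 1 \<up> l) \<cdot> \<beta> = rot M 1 \<up> m"
  proof (cases "l = m")
    case False
    then have "l = - m" using lm m by auto
    then show ?thesis unfolding \<beta>gi using False by (simp add: \<beta>_def rot_pw mirror_rot)
  qed (simp add: \<beta>_def)
  then obtain F1 where F1: "ghom ?S F1" "F1 ?a = rot M 1" "F1 ?b = \<beta>" by (rule BS_universal[OF l0 m0])
  obtain F2 where F2: "ghom ?S F2" "F2 ?a = ge" "F2 ?b = rot N 1"
    by (rule BS_universal[OF l0 m0, of "rot N 1" ge]) simp_all
  have F1p: "F1 (?a \<up> i) = rot M i" "F1 (?b \<up> i) = \<beta> \<up> i" for i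
    using F1 aS tG by (simp_all add: ghom_pw[OF F1(1) sG] rot_pw)
  have F2p: "F2 (?a \<up> i) = ge" "F2 (?b \<up> i) = rot N i" for i
    using F2 aS tG by (simp_all add: ghom_pw[OF F2(1) sG] rot_pw)
  define \<rho> where "\<rho> x = (\<rho>0 x, F1 x, F2 x)" for x
  have \<rho>: "ghom ?S \<rho>"
    unfolding ghom_def \<rho>_def by (auto simp: prod_grp ghom_gm[OF \<rho>0] ghom_gm[OF F1(1)] ghom_gm[OF F2(1)])
  have fin: "finite (\<rho> ` ?S)"
  proof (rule finite_subset)
    have "F1 ` ?S \<subseteq> FS {0..<M}" "F2 ` ?S \<subseteq> FS {0..<N}"
      by (rule BS_image_least[OF l0 m0]; use F1 F2 in \<open>simp add: sgrp_FS rot_FS mirror_FS \<beta>_def sgrp_ge[OF sgrp_FS]\<close>)+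
    then show "\<rho> ` ?S \<subseteq> \<rho>0 ` ?S \<times> FS {0..<M} \<times> FS {0..<N}" by (auto simp: \<rho>_def)
    show "finite (\<rho>0 ` ?S \<times> FS {0..<M} \<times> FS {0..<N})" using fin0 finite_FS by blast
  qed
  have e0': "\<rho>0 (?a \<up> i) = ge" "\<rho>0 (?b \<up> i) = ge" if "e0 dvd i" for i
    using e0(2)[OF _ that] aS tG by (simp_all add: ghom_pw[OF \<rho>0 sG])
  have pw: "\<rho> (?a \<up> k) \<up> i = \<rho> (?a \<up> (k * i))" "\<rho> ?b \<up> i = \<rho> (?b \<up> i)" for i
    using aS tG by (simp_all add: ghom_pw[OF \<rho> sG] pw_pw)
  have rel_order: "\<rho> (?a \<up> k) \<up> i = ge \<longleftrightarrow> \<rho> ?b \<up> i = ge" for i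
  proof -
    have "\<rho> (?a \<up> k) \<up> i = ge \<longleftrightarrow> N dvd i"
    proof
      assume "\<rho> (?a \<up> k) \<up> i = ge"
      then have "rot M (k * i) = ge" unfolding pw by (simp add: \<rho>_def F1p prod_grp)
      then show "N dvd i" using M(1) k by (simp add: rot_ge M_def)
    next
      assume "N dvd i"
      then have "M dvd k * i" "e0 dvd k * i" using N(4) by (auto simp: M_def intro: dvd_trans)
      then show "\<rho> (?a \<up> k) \<up> i = ge" using M(1) unfolding pw by (simp add: \<rho>_def F1p F2p e0' rot_ge prod_grp)
    qed
    moreover have "\<rho> ?b \<up> i = ge \<longleftrightarrow> N dvd i"
    proof
      assume "\<rho> ?b \<up> i = ge"
      then have "rot N i = ge" unfolding pw by (simp add: \<rho>_def F2p prod_grp)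
      then show "N dvd i" using N(1) by (simp add: rot_ge)
    next
      assume Ni: "N dvd i"
      then have "2 dvd i" "e0 dvd i" using N(3,4) dvd_trans by blast+
      then show "\<rho> ?b \<up> i = ge" using N(1) Ni unfolding pw by (simp add: \<rho>_def F1p F2p e0' rot_ge prod_grp \<beta>pw)
    qed
    ultimately show ?thesis by blast
  qed
  have small: "i = 0" if "M dvd i \<or> N dvd i" "\<bar>i\<bar> < W" for i
  proof (rule ccontr)
    assume "i \<noteq> 0"
    then have "N \<le> \<bar>i\<bar>" using that(1) M(2) by (meson dvd_imp_le_int order_trans zdvd_imp_le abs_ge_self)
    then show False using that(2) N(2) by simp
  qed
  have sepa: "\<rho> x \<notin> cyc (\<rho> (?a \<up> k))" if x: "x \<in> X" "x \<notin> cyc (?a \<up> k)" for x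
  proof
    assume "\<rho> x \<in> cyc (\<rho> (?a \<up> k))"
    then obtain i where i: "\<rho> x = \<rho> (?a \<up> (k * i))" by (auto simp: pw elim!: cycE)
    show False
    proof (cases "x \<in> cyc ?a")
      case True
      then obtain j where j: "x = ?a \<up> j" by (auto elim!: cycE)
      then have "rot M j = rot M (k * i)" using i by (simp add: \<rho>_def F1p)
      then have "app (rot M j) 0 = app (rot M (k * i)) 0" by simp
      then have "M dvd j - k * i" using M(1) by (simp add: app_rot mod_eq_dvd_iff)
      then have "k dvd j - k * i" unfolding M_def by (rule dvd_mult_left)
      then have "k dvd j" using dvd_add[of k "j - k * i" "k * i"] by simp
      then show False using x(2) by (auto simp: j pw_pw cyc_def)
    next
      case False
      then have "x \<in> C" using x by (simp add: C_def)
      then show False using sep0[of x "k * i"] i aS by (simp add: \<rho>_def ghom_pw[OF \<rho>0 sG])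
    qed
  qed
  have sepb: "\<rho> x \<notin> cyc (\<rho> ?b)" if x: "x \<in> X" "x \<notin> cyc ?b" for x
  proof
    assume "\<rho> x \<in> cyc (\<rho> ?b)"
    then obtain i where i: "\<rho> x = \<rho> ?b \<up> i" by (auto elim!: cycE)
    have xS: "x \<in> ?S" using x X by blast
    \<comment> \<open>The dying commutator is forced into \<open>cyc ?a\<close> by
      \<open>\<rho>0\<close> and then to be trivial by the size of \<open>M\<close>. So
      \<open>x\<close> commutes with \<open>?b\<close> and has the form b^i' a^j', and size rules
      out nonzero \<open>j'\<close> once more.\<close>
    have "\<rho> (com x) = gi (\<rho> x) \<cdot> gi (\<rho> ?b) \<cdot> \<rho> x \<cdot> \<rho> ?b"
      using xS tG by (simp add: com_def ghom_gm[OF \<rho>] ghom_gi[OF \<rho> sG] G_closed)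
    also have "\<dots> = ge" unfolding i gi_shift using commute_pw[of "\<rho> ?b" "\<rho> ?b" i] by simp
    finally have c: "\<rho> (com x) = ge" .
    have "com x \<in> cyc ?a"
    proof (rule ccontr)
      assume "com x \<notin> cyc ?a"
      then have "com x \<in> C" using x by (simp add: C_def)
      then show False using sep0[of "com x" 0] c by (simp add: \<rho>_def prod_grp)
    qed
    then obtain j where j: "com x = ?a \<up> j" by (auto elim!: cycE)
    have "rot M j = ge" using c by (simp add: j \<rho>_def F1p prod_grp)
    then have "M dvd j" using M(1) by (simp add: rot_ge)
    moreover have "v (com x) = j" using uv[of "com x" 0 j] j by simp
    then have "\<bar>j\<bar> < W" using W(2)[of "com x"] x by (auto simp: Y_def)
    ultimately have "j = 0" using small by blast
    then have "(gi x \<cdot> gi ?b \<cdot> x) \<cdot> ?b = ge" using j by (simp add: com_def)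
    from gi_unique[OF this] have "gi (gi (gi x \<cdot> gi ?b \<cdot> x)) = gi ?b" by (rule arg_cong)
    then have "gi x \<cdot> gi ?b \<cdot> x = gi ?b" unfolding gi_gi .
    then have cb: "gi x \<cdot> (?b \<up> -1) \<cdot> x = ?b \<up> -1" by (simp add: pw_minus)
    obtain i' j' where ij: "x = (?b \<up> i') \<cdot> (?a \<up> j')"
      by (rule centralizer_b[OF xS _ cb]) simp_all
    have \<rho>x: "F1 x = (\<beta> \<up> i') \<cdot> rot M j'" "F2 x = rot N i'"
      unfolding ij by (simp_all add: ghom_gm[OF F1(1) bG aG] ghom_gm[OF F2(1) bG aG] F1p F2p)
    have "rot N i' = rot N i" "(\<beta> \<up> i') \<cdot> rot M j' = \<beta> \<up> i"
      using i \<rho>x unfolding pw by (simp_all add: \<rho>_def F1p F2p)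
    then have "app (rot N i') 0 = app (rot N i) 0" by simp
    then have "N dvd i - i'" using N(1) by (simp add: app_rot mod_eq_dvd_iff dvd_diff_commute)
    then have "2 dvd i - i'" using N(3) dvd_trans by blast
    then have "\<beta> \<up> (i - i') = ge" by (rule \<beta>pw)
    then have "\<beta> \<up> i = \<beta> \<up> i'" using pw_add[of \<beta> "i - i'" i'] by simp
    then have "rot M j' = ge" using \<open>(\<beta> \<up> i') \<cdot> rot M j' = \<beta> \<up> i\<close> by simp
    then have "M dvd j'" using M(1) by (simp add: rot_ge)
    moreover have "\<bar>j'\<bar> < W" using W(2)[of x] x uv[OF ij] by (simp add: Y_def)
    ultimately have "j' = 0" using small by blast
    then show False using x(2) ij by simp
  qed
  have sep1: "\<rho> x \<noteq> ge" if x: "x \<in> X" "x \<noteq> ge" for x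
  proof (cases "x \<in> cyc ?b")
    case True
    then obtain i where i: "x = ?b \<up> i" by (auto elim!: cycE)
    then have "i \<noteq> 0" using x by auto
    moreover have "\<bar>i\<bar> < W" using W(1)[of x] x uv[of x i 0] i by (simp add: Y_def)
    ultimately have "rot N i \<noteq> ge" using small N(1) by (auto simp: rot_ge)
    then show ?thesis by (auto simp: i \<rho>_def F2p prod_grp)
  next
    case False
    then show ?thesis using sepb[OF x(1)] cycI[of "\<rho> ?b" 0] by (auto simp del: cycI)
  qed
  show ?thesis using that[OF \<rho> fin rel_order sepa sepb sep1] by blast
qed

type_synonym quot = "((bsg \<times> int sym \<times> nat) sym \<times> int sym \<times> int sym) \<times> nat"

text \<open>The finitely many entries of the normal form of \<open>g\<close> are separated in a
  finite quotient of BS(l,m). In the resulting representation \<open>g\<close> changes the copy if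
  its length is positive; otherwise \<open>\<rho> h\<close> itself is nontrivial.\<close>

lemma GG_residually_finite:
  fixes l m k :: int
  assumes m: "m > 0" and lm: "\<bar>l\<bar> = m" and k: "k > 0" and g: "g \<in> GG l m k" "g \<noteq> ge"
  obtains F :: "gg \<Rightarrow> quot sym" where "ghom (GG l m k) F" "finite (F ` GG l m k)" "F g \<noteq> ge"
proof -
  have l0: "l \<noteq> 0" and m0: "m \<noteq> 0" and k0: "k \<noteq> 0" using m lm k by auto
  interpret hnn_base "BS l m" "gA l m k" "gf l m k" by (rule hnn_base_GG[OF l0 m0 k0])
  have Gr: "Gr = GG l m k" by (simp add: GG_def)
  obtain xs h where xh: "app g x0 = (xs, h)" by fastforce
  have V: "(xs, h) \<in> V" using Gr_V[OF _ x0_V, of g] g xh Gr by simp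
  have nf: "nf (xs, h) = g" using nf_app[of g] g xh Gr by simp
  have xsH: "set xs \<subseteq> BS l m \<times> UNIV" if "vl xs" for xs using that by (induction xs) auto
  let ?X = "insert h (fst ` set xs)"
  have X: "finite ?X" "?X \<subseteq> BS l m" using V xsH[of xs] by (auto simp: V_def)
  obtain \<rho> :: "bsg \<Rightarrow> (bsg \<times> int sym \<times> nat) sym \<times> int sym \<times> int sym" where \<rho>:
    "ghom (BS l m) \<rho>" "finite (\<rho> ` BS l m)" "\<And>i. \<rho> (BSa l m \<up> k) \<up> i = ge \<longleftrightarrow> \<rho> (BSb l m) \<up> i = ge"
    "\<And>x. x \<in> ?X \<Longrightarrow> x \<notin> cyc (BSa l m \<up> k) \<Longrightarrow> \<rho> x \<notin> cyc (\<rho> (BSa l m \<up> k))"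
    "\<And>x. x \<in> ?X \<Longrightarrow> x \<notin> cyc (BSb l m) \<Longrightarrow> \<rho> x \<notin> cyc (\<rho> (BSb l m))"
    "\<And>x. x \<in> ?X \<Longrightarrow> x \<noteq> ge \<Longrightarrow> \<rho> x \<noteq> ge"
    by (rule finite_separation[OF m lm k X]) blast
  have akS: "BSa l m \<up> k \<in> BS l m" using sgrp_pw[OF sH BSa_in[OF l0 m0 k0]] .
  have cyc_im: "\<rho> ` cyc y = cyc (\<rho> y)" if "y \<in> BS l m" for y
    using ghom_pw[OF \<rho>(1) sH that] by (auto simp: cyc_def image_image)
  obtain F :: "gg \<Rightarrow> quot sym" where F: "ghom Gr F" "finite (F ` Gr)"
    "app (F (nf (xs, h))) (gi (\<rho> h), length xs) = (ge, 0)"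
    "\<And>g z s. g \<in> BS l m \<Longrightarrow> snd (app (F (hi g)) (z, s)) = s"
  proof (rule finite_representation[of "BSa l m \<up> k" "BSb l m" \<rho> xs h])
    show "gA l m k True = cyc (BSa l m \<up> k)" "gA l m k False = cyc (BSb l m)" by (simp_all add: gA_def)
    show "gf l m k True (BSa l m \<up> k) = BSb l m" using gf_simps(1)[OF l0 m0 k0, of 1] by simp
    show "\<rho> r \<notin> \<rho> ` gA l m k e'" if r: "(r, e) \<in> set xs" "r \<notin> gA l m k e'" for r e e'
    proof -
      have "r \<in> ?X" using r(1) by force
      then show ?thesis using r(2) \<rho>(4,5)[of r]
        by (cases e') (simp_all add: gA_def cyc_im[OF akS] cyc_im[OF BSb_in[OF l0 m0 k0]])
    qed
  qed (use \<rho> V in auto)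
  have "(gi (\<rho> h), length xs) \<noteq> (ge, 0)"
  proof
    assume "(gi (\<rho> h), length xs) = (ge, 0)"
    then have xs: "xs = []" "\<rho> h = ge" by auto
    then have "h = ge" using \<rho>(6)[of h] by auto
    then have "g = ge" using nf xs(1) ghom_ge[OF hi_hom sH] by (simp add: ev_def)
    then show False using g by simp
  qed
  then have "F g \<noteq> ge" using F(3) nf by auto
  then show ?thesis using that F(1,2) unfolding Gr by blast
qed

text \<open>Malcev's argument: surjections in both directions induce injections between the finite sets of
  homomorphisms to a fixed finite group, hence bijections.\<close>
lemma epi_both_ways_inj:
  fixes l m k1 k2 :: int
  assumes m: "m > 0" and lm: "\<bar>l\<bar> = m" and k1: "k1 > 0" and k2: "k2 > 0"
    and f: "ghom (GG l m k1) f" "f ` GG l m k1 = GG l m k2"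
    and h: "ghom (GG l m k2) h" "h ` GG l m k2 = GG l m k1"
  shows "inj_on f (GG l m k1)"
proof -
  have l0: "l \<noteq> 0" and m0: "m \<noteq> 0" and k10: "k1 \<noteq> 0" and k20: "k2 \<noteq> 0" using m lm k1 k2 by auto
  let ?G1 = "GG l m k1" and ?G2 = "GG l m k2"
  let ?a1 = "GGa l m k1" and ?t1 = "GGt l m k1" and ?a2 = "GGa l m k2" and ?t2 = "GGt l m k2"
  note G1 = GG_sgrp[OF l0 m0 k10] and G2 = GG_sgrp[OF l0 m0 k20]
  have ker: "g = ge" if g: "g \<in> ?G1" "f g = ge" for g
  proof (rule ccontr)
    assume "g \<noteq> ge"
    then obtain F :: "gg \<Rightarrow> quot sym" where F: "ghom ?G1 F" "finite (F ` ?G1)" "F g \<noteq> ge"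
      using GG_residually_finite[OF m lm k1 g(1)] by blast
    define S where "S = F ` ?G1"
    have S: "sgrp S" "finite S" unfolding S_def using sgrp_image[OF F(1) G1] F(2) by auto
    \<comment> \<open>Homomorphisms into \<open>S\<close>, encoded by the images of the two
      generators, which makes their number finite.\<close>
    define M where "M k = {(\<alpha>, \<tau>). \<alpha> \<in> S \<and> \<tau> \<in> S \<and> relG l m k \<alpha> \<tau>}" for k
    have finM: "finite (M k)" for k by (rule finite_subset[of _ "S \<times> S"]) (use S in \<open>auto simp: M_def\<close>)
    define E where "E k y = (SOME F'. ghom (GG l m k) F' \<and> F' (GGa l m k) = fst y \<and> F' (GGt l m k) = snd y)"
      for k and y :: "quot sym \<times> quot sym"
    have E: "ghom (GG l m k) (E k y)" "E k y (GGa l m k) = fst y" "E k y (GGt l m k) = snd y" "E k y ` GG l m k \<subseteq> S"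
      if y: "y \<in> M k" and k: "k \<noteq> 0" for k y
    proof -
      have r: "relG l m k (fst y) (snd y)" "fst y \<in> S" "snd y \<in> S" using y by (auto simp: M_def)
      have "\<exists>F'. ghom (GG l m k) F' \<and> F' (GGa l m k) = fst y \<and> F' (GGt l m k) = snd y"
        using GG_universal[OF l0 m0 k r(1)] by blast
      from someI_ex[OF this] show e: "ghom (GG l m k) (E k y)" "E k y (GGa l m k) = fst y" "E k y (GGt l m k) = snd y"
        by (auto simp: E_def)
      show "E k y ` GG l m k \<subseteq> S" by (rule GG_image_least[OF l0 m0 k e(1) S(1)]) (use e r in auto)
    qed
    define pull where "pull k c k' y = (E k y (c (GGa l m k')), E k y (c (GGt l m k')))" for k c k' y
    have pull: "inj_on (pull k c k') (M k)" "pull k c k' ` M k \<subseteq> M k'"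
      if c: "ghom (GG l m k') c" "c ` GG l m k' = GG l m k" and k: "k \<noteq> 0" "k' \<noteq> 0" for k c k'
    proof -
      have comp: "ghom (GG l m k') (E k y \<circ> c)" if "y \<in> M k" for y
        by (rule ghom_comp[OF c(1) E(1)[OF that k(1)]]) (simp add: c)
      show "inj_on (pull k c k') (M k)"
      proof (rule inj_onI)
        fix y z assume y: "y \<in> M k" and z: "z \<in> M k" and eq: "pull k c k' y = pull k c k' z"
        have "(E k y \<circ> c) x = (E k z \<circ> c) x" if "x \<in> GG l m k'" for x
          by (rule GG_ext[OF l0 m0 k(2) comp[OF y] comp[OF z] _ _ that]) (use eq in \<open>auto simp: pull_def\<close>)
        then have "E k y x = E k z x" if "x \<in> GG l m k" for x using that c(2) by force
        then have "fst y = fst z" "snd y = snd z"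
          using E(2,3)[OF y k(1)] E(2,3)[OF z k(1)] GGa_in[OF l0 m0 k(1)] GGt_in[OF l0 m0 k(1)] by metis+
        then show "y = z" by (simp add: prod_eq_iff)
      qed
      show "pull k c k' ` M k \<subseteq> M k'"
      proof
        fix w assume "w \<in> pull k c k' ` M k"
        then obtain y where y: "y \<in> M k" "w = pull k c k' y" by blast
        have "relG l m k' ((E k y \<circ> c) (GGa l m k')) ((E k y \<circ> c) (GGt l m k'))"
          by (rule ghom_relG[OF l0 m0 k(2) comp[OF y(1)]])
        moreover have "c (GGa l m k') \<in> GG l m k" "c (GGt l m k') \<in> GG l m k"
          using c(2) GGa_in[OF l0 m0 k(2)] GGt_in[OF l0 m0 k(2)] by blast+
        ultimately show "w \<in> M k'" using E(4)[OF y(1) k(1)] by (auto simp: y(2) M_def pull_def)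
      qed
    qed
    \<comment> \<open>Pulling back along \<open>h\<close> embeds \<open>M k1\<close> into
      \<open>M k2\<close>, so the injection the other way, along \<open>f\<close>, is onto. Hence
      \<open>F\<close> factors through \<open>f\<close> and cannot detect \<open>g\<close> in its
      kernel.\<close>
    have "card (M k1) \<le> card (M k2)"
      by (rule card_inj_on_le[OF pull[OF h k10 k20] finM])
    then have "pull k2 f k1 ` M k2 = M k1"
      using pull[OF f k20 k10] by (intro card_seteq[OF finM]) (simp_all add: card_image)
    moreover have "(F ?a1, F ?t1) \<in> M k1"
      using ghom_relG[OF l0 m0 k10 F(1)] GGa_in[OF l0 m0 k10] GGt_in[OF l0 m0 k10] by (auto simp: M_def S_def)
    ultimately have "(F ?a1, F ?t1) \<in> pull k2 f k1 ` M k2" by (simp only:)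
    then obtain y where y: "y \<in> M k2" "(F ?a1, F ?t1) = pull k2 f k1 y" by (rule imageE)
    have "ghom ?G1 (E k2 y \<circ> f)" by (rule ghom_comp[OF f(1) E(1)[OF y(1) k20]]) (simp add: f)
    then have "F g = (E k2 y \<circ> f) g"
      by (rule GG_ext[OF l0 m0 k10 F(1) _ _ _ g(1)]) (use y(2) in \<open>auto simp: pull_def\<close>)
    also have "\<dots> = ge" using g(2) ghom_ge[OF E(1)[OF y(1) k20] G2] by simp
    finally show False using F(3) by simp
  qed
  show ?thesis
  proof (rule inj_onI)
    fix x y assume *: "x \<in> ?G1" "y \<in> ?G1" "f x = f y"
    then have "gi x \<cdot> y \<in> ?G1" "f (gi x \<cdot> y) = ge"
      by (simp_all add: sgrp_gm[OF G1] sgrp_gi[OF G1] ghom_gm[OF f(1)] ghom_gi[OF f(1) G1])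
    then have "gi x \<cdot> y = ge" by (rule ker)
    then show "x = y" by (simp add: gi_shift)
  qed
qed

section \<open>The arithmetic conditions\<close>

text \<open>The converse of \<open>scale_rat\<close> for \<open>l = m * s\<close>: all intermediate
  values are an end value times a power of \<open>s\<close>, and divisibility of the ends by
  \<open>m\<close> makes each step legal.\<close>

lemma scale_of_rat:
  assumes s: "s \<noteq> 0" and uv: "m dvd u" "m dvd v" and eq: "of_int u = of_int v * (of_int s :: rat) powi q"
  shows "scale (m * s) m q u v"
proof -
  have *: "(step (m * s) m ^^ n) x y" if xy: "m dvd y" "(of_int x :: rat) = of_int y * of_int s ^ n" for n x y
  proof -
    obtain j where j: "y = m * j" using xy(1) by blast
    have "(of_int x :: rat) = of_int (y * s ^ n)" using xy(2) by simp
    then have "x = m * j * s ^ n" unfolding of_int_eq_iff j .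
    then show ?thesis using steps_mult[where m = m and s = s and n = n and j = j] by (simp add: j)
  qed
  show ?thesis
  proof (cases "q \<ge> 0")
    case True
    then show ?thesis using *[OF uv(2), of u "nat q"] eq by (simp add: scale_def power_int_def)
  next
    case False
    have "(of_int v :: rat) = of_int u * of_int s ^ nat (- q)"
      using eq s False by (simp add: power_int_def field_simps)
    then show ?thesis using *[OF uv(1), of v "nat (- q)"] False by (simp add: scale_def)
  qed
qed

lemma dvd_power_of_prime_divisors:
  fixes u s :: int
  assumes "u \<noteq> 0" "\<And>q. prime q \<Longrightarrow> q dvd u \<Longrightarrow> q dvd s"
  shows "\<exists>n. u dvd s ^ n"
  using assms
proof (induction "nat \<bar>u\<bar>" arbitrary: u rule: less_induct)
  case less
  show ?case
  proof (cases "is_unit u")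
    case True
    then have "u dvd s ^ 0" by simp
    then show ?thesis by blast
  next
    case False
    then obtain q where q: "prime q" "q dvd u" using prime_divisor_exists less(2) by blast
    then obtain w where w: "u = q * w" by blast
    have "w \<noteq> 0" "nat \<bar>w\<bar> < nat \<bar>u\<bar>"
      using less(2) w prime_gt_1_int[OF q(1)] by (auto simp: abs_mult)
    moreover have "p dvd s" if "prime p" "p dvd w" for p using less(3)[OF that(1)] that(2) w by simp
    ultimately obtain n where "w dvd s ^ n" using less(1) by blast
    then have "u dvd s * s ^ n" using less(3)[OF q] unfolding w by (intro mult_dvd_mono)
    then have "u dvd s ^ Suc n" by simp
    then show ?thesis by blast
  qed
qed

lemma rat_quotient:
  fixes k1 k2 :: int
  assumes "k1 > 0" "k2 > 0"
  obtains u v where "quotient_of (of_int k1 / of_int k2) = (u, v)" "v > 0" "u \<noteq> 0" "coprime u v" "k1 * v = k2 * u"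
proof -
  obtain u v where q: "quotient_of (of_int k1 / of_int k2) = (u, v)" by fastforce
  have v: "v > 0" by (rule quotient_of_denom_pos[OF q])
  have c: "coprime u v" by (rule quotient_of_coprime[OF q])
  have "(of_int k1 / of_int k2 :: rat) = of_int u / of_int v" by (rule quotient_of_div[OF q])
  then have "(of_int (k1 * v) :: rat) = of_int (k2 * u)" using v assms by (simp add: field_simps)
  then have e: "k1 * v = k2 * u" unfolding of_int_eq_iff .
  then have "u \<noteq> 0" using v assms by auto
  then show ?thesis using that q v c e by blast
qed

lemma epis_imp_conditions:
  fixes l m k1 k2 :: int
  assumes m: "m > 0" and lm: "\<bar>l\<bar> > m" and k1: "k1 > 0" and k2: "k2 > 0"
    and f: "ghom (GG l m k1) f" "f ` GG l m k1 = GG l m k2"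
    and h: "ghom (GG l m k2) h" "h ` GG l m k2 = GG l m k1"
    and noiso: "\<nexists>g. ghom (GG l m k1) g \<and> bij_betw g (GG l m k1) (GG l m k2)"
  shows "m > 1 \<and> m dvd l \<and> m dvd k1 \<and> m dvd k2 \<and> coprime (l div m) m \<and>
    rat_n_number (l div m) (of_int k1 / of_int k2) \<and>
    (\<forall>p::int. of_int k1 / of_int k2 \<noteq> (of_int (l div m) :: rat) powi p \<and>
              of_int k1 / of_int k2 \<noteq> - ((of_int (l div m) :: rat) powi p))"
proof -
  have l0: "l \<noteq> 0" and m0: "m \<noteq> 0" and k10: "k1 \<noteq> 0" and k20: "k2 \<noteq> 0" using m lm k1 k2 by auto
  obtain x p where x: "scale l m p (x * k1) k2" "\<And>q. prime q \<Longrightarrow> q dvd l \<Longrightarrow> q dvd m \<Longrightarrow> \<not> q dvd x"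
    by (rule epi_data[OF m lm k10 k20 f]) blast
  obtain y p' where y: "scale l m p' (y * k2) k1" "\<And>q. prime q \<Longrightarrow> q dvd l \<Longrightarrow> q dvd m \<Longrightarrow> \<not> q dvd y"
    by (rule epi_data[OF m lm k20 k10 h]) blast
  define r :: rat where "r = of_int l / of_int m"
  have r0: "r \<noteq> 0" using l0 m0 by (simp add: r_def)
  have xr: "of_int (x * k1) = of_int k2 * r powi p" and yr: "of_int (y * k2) = of_int k1 * r powi p'"
    unfolding r_def by (rule scale_rat[OF l0 m0 x(1)], rule scale_rat[OF l0 m0 y(1)])
  have "of_int (x * k1) * of_int (y * k2) = (of_int k2 * r powi p) * (of_int k1 * r powi p')" unfolding xr yr ..
  then have "(of_int k1 * of_int k2) * of_int (x * y) = (of_int k1 * of_int k2) * (r powi p * r powi p')"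
    by (simp add: mult_ac)
  then have xyr: "of_int (x * y) = r powi (p + p')" using k10 k20 r0 by (simp add: power_int_add)
  have x0: "x * y \<noteq> 0"
  proof
    assume "x * y = 0"
    then have "of_int (x * y) = (0 :: rat)" by (simp only: of_int_0)
    then have "r powi (p + p') = 0" unfolding xyr .
    then show False using r0 by simp
  qed
  \<comment> \<open>A negative power of l/m has absolute value below 1 and cannot be the nonzero
    integer \<open>x * y\<close>.\<close>
  have nonneg: "p + p' \<ge> 0"
  proof (rule ccontr)
    assume neg: "\<not> p + p' \<ge> 0"
    define n where "n = nat (- (p + p'))"
    have n: "n > 0" using neg by (simp add: n_def)
    have "of_int (x * y) * r ^ n = 1" using xyr neg r0 by (simp add: power_int_def n_def field_simps)
    then have "(of_int (x * y * l ^ n) :: rat) = of_int (m ^ n)"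
      using m0 by (simp add: r_def power_divide field_simps)
    then have "x * y * l ^ n = m ^ n" unfolding of_int_eq_iff .
    then have "\<bar>x * y\<bar> * \<bar>l\<bar> ^ n = m ^ n" using m by (metis abs_mult abs_of_pos power_abs)
    moreover have "1 \<le> \<bar>x * y\<bar>" using x0 by linarith
    then have "1 * \<bar>l\<bar> ^ n \<le> \<bar>x * y\<bar> * \<bar>l\<bar> ^ n" by (rule mult_right_mono) simp
    moreover have "m ^ n < \<bar>l\<bar> ^ n" using lm m n by (intro power_strict_mono) auto
    ultimately show False by simp
  qed
  define N where "N = nat (p + p')"
  have "of_int (x * y) * of_int m ^ N = (of_int l ^ N :: rat)"
    using xyr nonneg m0 by (simp add: power_int_def N_def r_def power_divide)
  then have "(of_int (x * y * m ^ N) :: rat) = of_int (l ^ N)" by simp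
  then have xyN: "x * y * m ^ N = l ^ N" unfolding of_int_eq_iff .
  have N0: "N > 0"
  proof (rule ccontr)
    assume "\<not> N > 0"
    then have "scale l m 0 (x * y) 1" using xyN by simp
    then show False using scale_iso[OF l0 m0 k10 k20 x(1)] noiso by blast
  qed
  have "m ^ N dvd l ^ N" using xyN by (metis dvd_triv_right)
  then have ml: "m dvd l" using N0 by simp
  then obtain s where s: "l = m * s" by blast
  have sdef: "l div m = s" using m by (simp add: s)
  have s0: "s \<noteq> 0" using l0 s by auto
  have xys: "x * y = s ^ N" using xyN m0 by (simp add: s power_mult_distrib)
  have rs: "r = of_int s" using m0 by (simp add: r_def s)
  \<comment> \<open>A common prime would divide \<open>s ^ N = x * y\<close>, hence \<open>x\<close>
    or \<open>y\<close>, which the second part of the data of the two epimorphisms forbids.\<close>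
  have cop: "coprime s m"
  proof (rule coprimeI, rule ccontr)
    fix c assume c: "c dvd s" "c dvd m" "\<not> is_unit c"
    then have "c \<noteq> 0" using m0 by auto
    then obtain q where q: "prime q" "q dvd c" using prime_divisor_exists c(3) by blast
    then have qs: "q dvd s" "q dvd m" using c dvd_trans by blast+
    then have "q dvd x * y" unfolding xys using N0 by (simp add: dvd_power_iff dvd_trans[OF _ dvd_power])
    then have "q dvd x \<or> q dvd y" using q(1) by (simp add: prime_dvd_mult_iff)
    moreover have "q dvd l" using qs by (simp add: s)
    ultimately show False using x(2) y(2) q(1) qs(2) by blast
  qed
  have xN: "x dvd s ^ N" "y dvd s ^ N" by (simp_all flip: xys)
  have copN: "coprime (s ^ N) m" using cop by simp
  have copx: "coprime x m" "coprime y m" using xN copN coprime_divisors[OF _ dvd_refl] by blast+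
  have "p \<noteq> 0 \<or> p' \<noteq> 0" using N0 by (auto simp: N_def)
  then have mk: "m dvd k1 \<and> m dvd k2"
  proof
    assume "p \<noteq> 0"
    then have "m dvd x * k1" "m dvd k2" using scale_dvd x(1) unfolding s by blast+
    then show ?thesis using copx(1) by (simp add: coprime_dvd_mult_right_iff coprime_commute)
  next
    assume "p' \<noteq> 0"
    then have "m dvd y * k2" "m dvd k1" using scale_dvd y(1) unfolding s by blast+
    then show ?thesis using copx(2) by (simp add: coprime_dvd_mult_right_iff coprime_commute)
  qed
  have m1: "m > 1"
  proof (rule ccontr)
    assume "\<not> m > 1"
    then have "m = 1" using m by simp
    then have "(step l m ^^ N) (x * y) 1" using steps_mult[where m = m and s = s and n = N and j = 1] by (simp add: s xys)
    then have "scale l m (int N) (x * y) 1" by (simp add: scale_def)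
    then show False using scale_iso[OF l0 m0 k10 k20 x(1)] noiso by blast
  qed
  \<comment> \<open>With \<open>c\<close> equal to 1 or -1 both signs are treated at once: such a
    ratio would make the map sending \<open>a\<close> to \<open>a \<up> c\<close> an
    isomorphism.\<close>
  have no: "of_int k1 / of_int k2 \<noteq> of_int c * (of_int s :: rat) powi q" if c: "c * c = 1" for c q
  proof
    assume "of_int k1 / of_int k2 = of_int c * (of_int s :: rat) powi q"
    then have "of_int c * of_int k1 = of_int c * of_int c * (of_int k2 * (of_int s :: rat) powi q)" using k20 by (simp add: field_simps)
    moreover have "of_int c * of_int c = (1 :: rat)" using c by (metis of_int_1 of_int_mult)
    ultimately have "of_int (c * k1) = of_int k2 * (of_int s :: rat) powi q" by simp
    then have "scale l m q (c * k1) k2" unfolding s using mk s0 by (intro scale_of_rat) auto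
    moreover have "scale l m 0 (c * c) 1" using c by simp
    ultimately show False using scale_iso[OF l0 m0 k10 k20] noiso by blast
  qed
  obtain u v where uv: "quotient_of (of_int k1 / of_int k2) = (u, v)" "v > 0" "u \<noteq> 0" "coprime u v" "k1 * v = k2 * u"
    using rat_quotient[OF k1 k2] .
  \<comment> \<open>Up to the side on which the power of \<open>s\<close> stands, x u = v s^p, and
    \<open>x\<close> divides a power of \<open>s\<close>. A prime not dividing \<open>s\<close>
    would divide \<open>u\<close> exactly when it divides \<open>v\<close>, against
    coprimality.\<close>
  have nn: "rat_n_number s (of_int k1 / of_int k2)"
  proof -
    have "x * (k2 * u) = x * k1 * v" using uv(5) by (simp add: mult_ac)
    then have "of_int x * (of_int k2 * of_int u) = of_int (x * k1) * (of_int v :: rat)"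
      by (metis of_int_mult)
    then have "of_int k2 * (of_int x * of_int u) = of_int k2 * (of_int v * (of_int s :: rat) powi p)"
      unfolding xr rs by (simp only: mult_ac)
    then have e: "of_int x * of_int u = of_int v * (of_int s :: rat) powi p" using k20 by simp
    have "q dvd s" if q: "prime q" "q dvd u \<or> q dvd v" for q
    proof (cases "p \<ge> 0")
      case True
      then have "(of_int (x * u) :: rat) = of_int (v * s ^ nat p)" using e by (simp add: power_int_def)
      then have e': "x * u = v * s ^ nat p" unfolding of_int_eq_iff .
      show ?thesis
      proof (rule ccontr)
        assume ns: "\<not> q dvd s"
        then have nsn: "\<not> q dvd s ^ j" for j using q(1) prime_dvd_power by blast
        have "\<not> q dvd x" using xN(1) nsn dvd_trans by blast
        then have "q dvd u \<longleftrightarrow> q dvd v" using e' q(1) nsn by (metis prime_dvd_mult_iff)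
        then show False using q uv(4) by (metis coprime_common_divisor not_prime_unit)
      qed
    next
      case False
      then have "(of_int (x * u * s ^ nat (- p)) :: rat) = of_int v" using e s0 by (simp add: power_int_def field_simps)
      then have e': "x * u * s ^ nat (- p) = v" unfolding of_int_eq_iff .
      show ?thesis
      proof (rule ccontr)
        assume ns: "\<not> q dvd s"
        then have nsn: "\<not> q dvd s ^ j" for j using q(1) prime_dvd_power by blast
        have "\<not> q dvd x" using xN(1) nsn dvd_trans by blast
        then have "q dvd u \<longleftrightarrow> q dvd v" using e' q(1) nsn by (metis prime_dvd_mult_iff)
        then show False using q uv(4) by (metis coprime_common_divisor not_prime_unit)
      qed
    qed
    then show ?thesis using uv k1 k2 by (simp add: rat_n_number_def int_n_number_def)
  qed
  show ?thesis unfolding sdef using m1 ml mk cop nn no[of 1] no[of "-1"] by auto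
qed

lemma n_number_epi:
  fixes m s k1 k2 u v :: int
  assumes m: "m \<noteq> 0" and s: "s \<noteq> 0" and k: "k1 \<noteq> 0" "k2 \<noteq> 0" and cop: "coprime s m" and mk: "m dvd k1" "m dvd k2"
    and uv: "u dvd s ^ i" "v dvd s ^ j" "v \<noteq> 0" "k1 * v = k2 * u"
  shows "\<exists>f. ghom (GG (m * s) m k1) f \<and> f ` GG (m * s) m k1 = GG (m * s) m k2"
proof -
  obtain u' v' where u': "s ^ i = u * u'" and v': "s ^ j = v * v'" using uv by blast
  \<comment> \<open>The solution of \<open>x * k1 = k2 * s ^ i\<close>, integral because
    \<open>u\<close> divides \<open>s ^ i\<close>; it divides a power of \<open>s\<close> because
    \<open>v\<close> does.\<close>
  define x where "x = u' * v"
  have xy: "x * (u * v') = s ^ (i + j)" by (simp add: x_def power_add u' v')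
  have "x * k1 = k2 * s ^ i" using uv(4) by (simp add: x_def u' mult_ac)
  then have "of_int (x * k1) = (of_int (k2 * s ^ i) :: rat)" by simp
  then have "scale (m * s) m (int i) (x * k1) k2"
    using s mk by (intro scale_of_rat) simp_all
  moreover have "x dvd s ^ (i + j)" using xy by (metis dvd_triv_left)
  then have "coprime x m" using cop coprime_divisors[OF _ dvd_refl, of x "s ^ (i + j)" m] by simp
  ultimately show ?thesis using scale_epi[of "m * s" m k1 k2 "int i" x s] m s k xy by simp
qed

text \<open>Composing the data of the isomorphism and of its inverse, the first generator becomes
  conjugate to its \<open>y * x\<close>-th power, so \<open>x\<close> is 1 or -1. This is the origin
  of the two signs.\<close>

lemma iso_imp_power:
  fixes l m k1 k2 :: int
  assumes m: "m > 1" and lm: "\<bar>l\<bar> > m" and k1: "k1 > 0" and k2: "k2 > 0"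
    and f: "ghom (GG l m k1) f" "bij_betw f (GG l m k1) (GG l m k2)"
  shows "\<exists>p. of_int k1 / of_int k2 = (of_int l / of_int m :: rat) powi p \<or>
    of_int k1 / of_int k2 = - ((of_int l / of_int m :: rat) powi p)"
proof -
  have l0: "l \<noteq> 0" and m0: "m \<noteq> 0" and k10: "k1 \<noteq> 0" and k20: "k2 \<noteq> 0" and m': "m > 0" using m lm k1 k2 by auto
  let ?G1 = "GG l m k1" and ?G2 = "GG l m k2"
  let ?a1 = "GGa l m k1" and ?a2 = "GGa l m k2"
  note G1 = GG_sgrp[OF l0 m0 k10] and G2 = GG_sgrp[OF l0 m0 k20]
  define h where "h = inv_into ?G1 f"
  have fim: "f ` ?G1 = ?G2" and inj: "inj_on f ?G1" using f(2) by (auto simp: bij_betw_def)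
  have hf: "h (f z) = z" if "z \<in> ?G1" for z using that inj by (simp add: h_def)
  have h_hom: "ghom ?G2 h"
    unfolding ghom_def
  proof (intro ballI)
    fix a b assume "a \<in> ?G2" "b \<in> ?G2"
    then obtain z w where z: "z \<in> ?G1" "a = f z" "w \<in> ?G1" "b = f w" using fim by blast
    have "h (a \<cdot> b) = h (f (z \<cdot> w))" using z by (simp add: ghom_gm[OF f(1)])
    then show "h (a \<cdot> b) = h a \<cdot> h b" using z by (simp add: hf sgrp_gm[OF G1])
  qed
  have him: "h ` ?G2 = ?G1" using hf by (force simp flip: fim simp: image_image)
  obtain g x p where x: "g \<in> ?G2" "gi g \<cdot> f ?a1 \<cdot> g = ?a2 \<up> x" "scale l m p (x * k1) k2"
    by (rule epi_data[OF m' lm k10 k20 f(1) fim]) blast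
  obtain g' y p' where y: "g' \<in> ?G1" "gi g' \<cdot> h ?a2 \<cdot> g' = ?a1 \<up> y"
    by (rule epi_data[OF m' lm k20 k10 h_hom him]) blast
  have a: "?a1 \<in> ?G1" "?a2 \<in> ?G2" using GGa_in[OF l0 m0] k10 k20 by auto
  have fa: "f ?a1 \<in> ?G2" using a fim by blast
  have hg: "h g \<in> ?G1" using x(1) him by blast
  have "h (gi g \<cdot> f ?a1 \<cdot> g) = gi (h g) \<cdot> ?a1 \<cdot> h g"
    using x(1) fa a by (simp add: ghom_gm[OF h_hom] ghom_gi[OF h_hom G2] sgrp_gm[OF G2] sgrp_gi[OF G2] hf)
  then have hx: "gi (h g) \<cdot> ?a1 \<cdot> h g = h ?a2 \<up> x" using x(2) a by (simp add: ghom_pw[OF h_hom G2])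
  have "gi (h g \<cdot> g') \<cdot> ?a1 \<cdot> (h g \<cdot> g') = gi g' \<cdot> (gi (h g) \<cdot> ?a1 \<cdot> h g) \<cdot> g'" by simp
  also have "\<dots> = gi g' \<cdot> (h ?a2 \<up> x) \<cdot> g'" unfolding hx ..
  also have "\<dots> = ?a1 \<up> (y * x)" unfolding pw_conj[symmetric] y(2) pw_pw ..
  finally have "y * x = 1" by (rule conj_pw_one[OF m lm k10 sgrp_gm[OF G1 hg y(1)]])
  then have "x = 1 \<or> x = -1" by (metis mult.commute zmult_eq_1_iff)
  moreover have "of_int (x * k1) = of_int k2 * (of_int l / of_int m :: rat) powi p"
    by (rule scale_rat[OF l0 m0 x(3)])
  ultimately have "of_int k1 = of_int k2 * (of_int l / of_int m :: rat) powi p \<or> of_int k1 = - (of_int k2 * (of_int l / of_int m :: rat) powi p)"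
    by (auto simp: minus_equation_iff)
  then show ?thesis using k20 by (auto simp: divide_simps mult.commute)
qed

theorem mainTheorem4:
  fixes l m k1 k2 :: int
  assumes "\<bar>l\<bar> \<ge> m" and "m > 0" and "k1 > 0" and "k2 > 0"
  shows "(homomorphic_image (Glmk l m k1) (Glmk l m k2) \<and>
          homomorphic_image (Glmk l m k2) (Glmk l m k1) \<and>
          \<not> (Glmk l m k1 \<cong> Glmk l m k2))
     \<longleftrightarrow>
         (\<bar>l\<bar> > m \<and> m > 1 \<and> m dvd l \<and> m dvd k1 \<and> m dvd k2 \<and>
          coprime (l div m) m \<and>
          rat_n_number (l div m) (of_int k1 / of_int k2) \<and>
          (\<forall>p::int. of_int k1 / of_int k2 \<noteq> (of_int (l div m) :: rat) powi p \<and>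
                    of_int k1 / of_int k2 \<noteq> - ((of_int (l div m) :: rat) powi p)))"
proof -
  have nz: "l \<noteq> 0" "m \<noteq> 0" "k1 \<noteq> 0" "k2 \<noteq> 0" using assms by auto
  show ?thesis
    unfolding homomorphic_image_GG[OF nz(1,2,3,4)] homomorphic_image_GG[OF nz(1,2,4,3)] iso_GG[OF nz]
  proof
    assume "(\<exists>g. ghom (GG l m k2) g \<and> g ` GG l m k2 = GG l m k1) \<and>
      (\<exists>g. ghom (GG l m k1) g \<and> g ` GG l m k1 = GG l m k2) \<and>
      \<not> (\<exists>g. ghom (GG l m k1) g \<and> bij_betw g (GG l m k1) (GG l m k2))"
    then obtain f h where f: "ghom (GG l m k1) f" "f ` GG l m k1 = GG l m k2"
      and h: "ghom (GG l m k2) h" "h ` GG l m k2 = GG l m k1"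
      and noiso: "\<nexists>g. ghom (GG l m k1) g \<and> bij_betw g (GG l m k1) (GG l m k2)" by blast
    have "\<bar>l\<bar> \<noteq> m"
    proof
      assume "\<bar>l\<bar> = m"
      then have "inj_on f (GG l m k1)" using epi_both_ways_inj[OF _ _ _ _ f h] assms by blast
      then show False using noiso f by (auto simp: bij_betw_def)
    qed
    then have lm: "\<bar>l\<bar> > m" using assms by simp
    then show "\<bar>l\<bar> > m \<and> m > 1 \<and> m dvd l \<and> m dvd k1 \<and> m dvd k2 \<and>
          coprime (l div m) m \<and>
          rat_n_number (l div m) (of_int k1 / of_int k2) \<and>
          (\<forall>p::int. of_int k1 / of_int k2 \<noteq> (of_int (l div m) :: rat) powi p \<and>
                    of_int k1 / of_int k2 \<noteq> - ((of_int (l div m) :: rat) powi p))"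
      using epis_imp_conditions[OF assms(2) lm assms(3,4) f h noiso] by blast
  next
    assume c: "\<bar>l\<bar> > m \<and> m > 1 \<and> m dvd l \<and> m dvd k1 \<and> m dvd k2 \<and>
          coprime (l div m) m \<and>
          rat_n_number (l div m) (of_int k1 / of_int k2) \<and>
          (\<forall>p::int. of_int k1 / of_int k2 \<noteq> (of_int (l div m) :: rat) powi p \<and>
                    of_int k1 / of_int k2 \<noteq> - ((of_int (l div m) :: rat) powi p))"
    define s where "s = l div m"
    have l: "l = m * s" using c by (simp add: s_def)
    have s0: "s \<noteq> 0" using nz l by auto
    obtain u v where uv: "quotient_of (of_int k1 / of_int k2) = (u, v)" "v > 0" "u \<noteq> 0" "coprime u v" "k1 * v = k2 * u"
      using rat_quotient[OF assms(3,4)] .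
    have "rat_n_number s (of_int k1 / of_int k2)" using c by (simp add: s_def)
    then have "\<And>q. prime q \<Longrightarrow> q dvd u \<Longrightarrow> q dvd s" "\<And>q. prime q \<Longrightarrow> q dvd v \<Longrightarrow> q dvd s"
      using uv(1) by (auto simp: rat_n_number_def int_n_number_def)
    then obtain i j where ij: "u dvd s ^ i" "v dvd s ^ j"
      using dvd_power_of_prime_divisors[of u s] dvd_power_of_prime_divisors[of v s] uv(2,3) by auto
    have cop: "coprime s m" using c by (simp add: s_def)
    have v0: "v \<noteq> 0" using uv(2) by simp
    have "\<exists>g. ghom (GG l m k2) g \<and> g ` GG l m k2 = GG l m k1"
      unfolding l by (rule n_number_epi[OF nz(2) s0 nz(4,3) cop _ _ ij(2,1) uv(3) uv(5)[symmetric]]) (use c in auto)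
    moreover have "\<exists>g. ghom (GG l m k1) g \<and> g ` GG l m k1 = GG l m k2"
      unfolding l by (rule n_number_epi[OF nz(2) s0 nz(3,4) cop _ _ ij v0 uv(5)]) (use c in auto)
    moreover have "\<not> (\<exists>g. ghom (GG l m k1) g \<and> bij_betw g (GG l m k1) (GG l m k2))"
    proof
      assume "\<exists>g. ghom (GG l m k1) g \<and> bij_betw g (GG l m k1) (GG l m k2)"
      then obtain g where g: "ghom (GG l m k1) g" "bij_betw g (GG l m k1) (GG l m k2)" by blast
      have "(of_int l / of_int m :: rat) = of_int (l div m)" using nz(2) l by (simp add: s_def[symmetric])
      then show False using iso_imp_power[OF _ _ assms(3,4) g] c by auto
    qed
    ultimately show "(\<exists>g. ghom (GG l m k2) g \<and> g ` GG l m k2 = GG l m k1) \<and>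
      (\<exists>g. ghom (GG l m k1) g \<and> g ` GG l m k1 = GG l m k2) \<and>
      \<not> (\<exists>g. ghom (GG l m k1) g \<and> bij_betw g (GG l m k1) (GG l m k2))" by blast
  qed
qed

end
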